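(* The \textsc{Spanner} problem (given a connected undirected graph $G=(V,E)$ with edge weights $w\colon E\to\mathbb{N}_{\ge0}$, edge lengths $\ell\colon E\to\mathbb{N}_{\ge1}$, a stretch factor $\alpha\ge1$ and a weight bound $W\in\mathbb{N}$, is there an $\alpha$-spanner $H=(V,F)$ of $G$ with $\sum_{e\in F}w(e)\le W$?) is $\textbf{para-NP}$-hard if parameterized by the bundle-breadth $b$ and/or the bundle-size $s$ and/or the local neighborhood size $h$ (i.e., by any nonempty combination of these parameters). This holds even for basic instances ($w(e)=\ell(e)=1$ for all $e\in E$) and constant $\alpha$.
   Context: For a subgraph $G'\subseteq G$ and $u,v\in V$, $\ell_{G'}[u,v]$ is the length of a shortest $u$-$v$-path in $G'$ w.r.t. $\ell$. A subgraph $H=(V,F)$, $F\subseteq E$, is an $\alpha$-spanner of $G$ if $\ell_H[u,v]\le\alpha\,\ell_G[u,v]$ for all $u,v\in V$; equivalently, for all $\{u,v\}\in E$. The set of terminal pairs is $K=E$. For $\{u,v\}\in E$, a simple $u$-$v$-path $P$ is settling if $\ell(P)\le\alpha\,\ell_G[u,v]$; it is alternative if it does not contain the edge $\{u,v\}$. $\mathcal{P}_{uv}$ is the set of all settling $u$-$v$-paths. An edge $\{u,v\}$ is mandatory if $\mathcal{P}_{uv}$ contains no alternative path. The trivial edges $T\subseteq E$ are the mandatory edges and the edges of weight $0$; the nontrivial edges are $N=E\setminus T$. A terminal pair $\{u,v\}\in E$ is critical if no settling $u$-$v$-path consists only of trivial edges; $C$ denotes the set of critical terminal pairs. Bundle-breadth: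 $b=\max_{\{u,v\}\in C}|\mathcal{P}_{uv}|$. Bundle-size: $s=\max_{\{u,v\}\in C}\big|\bigcup_{P\in\mathcal{P}_{uv}}(P\cap N)\big|$. Local neighborhood size: $h=\max_{\{u,v\}\in C}\big|\bigcup_{P\in\mathcal{P}_{uv}}V(P)\big|$. A parameterized problem is $\textbf{para-NP}$-hard if it is already $\textbf{NP}$-hard when restricted to instances with parameter values bounded by some constant. *)

theory Defs
  imports "HOL-Library.Extended_Real" "HOL-Computational_Algebra.Polynomial"
begin

section \<open>Turing machines, polynomial time and NP\<close>

text \<open>
  Deterministic multi-tape Turing machines with two-way infinite tapes. Symbols are natural
  numbers: 0 is the blank, 1 and 2 are the bits, further symbols are work symbols. The states are
  \<open>{..nstates}\<close>, with initial state 0 and halting state \<open>nstates\<close>.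
\<close>

datatype move = MoveL | Stay | MoveR

record tm =
  ntapes :: nat
  nsyms :: nat
  nstates :: nat
  delta :: "nat \<Rightarrow> nat list \<Rightarrow> nat \<times> (nat \<times> move) list"

definition tm_wf :: "tm \<Rightarrow> bool" where
  "tm_wf M \<longleftrightarrow> ntapes M \<ge> 1 \<and> nsyms M \<ge> 3 \<and>
     (\<forall>q rs. q < nstates M \<and> length rs = ntapes M \<and> set rs \<subseteq> {..<nsyms M} \<longrightarrow>
        (case delta M q rs of (q', acts) \<Rightarrow>
           q' \<le> nstates M \<and> length acts = ntapes M \<and> fst ` set acts \<subseteq> {..<nsyms M}))"

text \<open>A tape is its inscription together with the head position.\<close>

type_synonym tape = "(int \<Rightarrow> nat) \<times> int"
type_synonym config = "nat \<times> tape list"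

fun shift :: "move \<Rightarrow> int \<Rightarrow> int" where
  "shift MoveL i = i - 1"
| "shift Stay i = i"
| "shift MoveR i = i + 1"

definition act :: "tape \<Rightarrow> nat \<times> move \<Rightarrow> tape" where
  "act tp a = ((fst tp)(snd tp := fst a), shift (snd a) (snd tp))"

definition tm_step :: "tm \<Rightarrow> config \<Rightarrow> config" where
  "tm_step M c =
     (if fst c = nstates M then c
      else let (q', acts) = delta M (fst c) (map (\<lambda>tp. fst tp (snd tp)) (snd c))
           in (q', map2 act (snd c) acts))"

definition bit_sym :: "bool \<Rightarrow> nat" where
  "bit_sym b = (if b then 2 else 1)"

definition inscription :: "bool list \<Rightarrow> int \<Rightarrow> nat" where
  "inscription x i = (if 0 \<le> i \<and> i < int (length x) then bit_sym (x ! nat i) else 0)"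

text \<open>The input words are placed on the first tapes; all remaining tapes are blank.\<close>

definition tm_init :: "tm \<Rightarrow> bool list list \<Rightarrow> config" where
  "tm_init M xs =
     (0, map (\<lambda>j. (inscription (if j < length xs then xs ! j else []), 0)) [0..<ntapes M])"

text \<open>The output is read off the last tape.\<close>

definition tm_outputs_within :: "tm \<Rightarrow> bool list list \<Rightarrow> nat \<Rightarrow> bool list \<Rightarrow> bool" where
  "tm_outputs_within M xs T y \<longleftrightarrow> length xs \<le> ntapes M \<and>
     (\<exists>t\<le>T. \<exists>tps. (tm_step M ^^ t) (tm_init M xs) = (nstates M, tps) \<and>
        fst (last tps) = inscription y)"

definition polytime_function :: "(bool list \<Rightarrow> bool list) \<Rightarrow> bool" where
  "polytime_function f \<longleftrightarrow>
     (\<exists>M p. tm_wf M \<and>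
        (\<forall>x. tm_outputs_within M [x] (poly p (length x)) (f x)))"

definition polytime_relation :: "(bool list \<Rightarrow> bool list \<Rightarrow> bool) \<Rightarrow> bool" where
  "polytime_relation R \<longleftrightarrow>
     (\<exists>M p. tm_wf M \<and>
        (\<forall>x y. tm_outputs_within M [x, y] (poly p (length x + length y)) [R x y]))"

definition NP :: "bool list set set" where
  "NP = {A. \<exists>R p. polytime_relation R \<and>
             (\<forall>x. x \<in> A \<longleftrightarrow> (\<exists>y. length y \<le> poly p (length x) \<and> R x y))}"

text \<open>
  A decision problem consists of a set \<open>Inst\<close> of admissible instances, the set \<open>Yes\<close> of
  yes-instances and an encoding \<open>enc\<close> of instances as bit strings. The reduction must map every
  word to an admissible instance, so that passing to a smaller \<open>Inst\<close> really restricts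
  the problem.
\<close>

definition NP_hard :: "('i \<Rightarrow> bool list) \<Rightarrow> 'i set \<Rightarrow> 'i set \<Rightarrow> bool" where
  "NP_hard enc Inst Yes \<longleftrightarrow>
     (\<forall>A\<in>NP. \<exists>f. polytime_function f \<and>
        (\<forall>x. \<exists>i\<in>Inst. f x = enc i \<and> (x \<in> A \<longleftrightarrow> i \<in> Yes)))"

text \<open>Several parameters may be combined: \<open>Ks\<close> is the set of parameters in use.\<close>

definition para_NP_hard ::
  "('i \<Rightarrow> bool list) \<Rightarrow> 'i set \<Rightarrow> 'i set \<Rightarrow> ('i \<Rightarrow> nat) set \<Rightarrow> bool" where
  "para_NP_hard enc Inst Yes Ks \<longleftrightarrow>
     (\<exists>c. NP_hard enc {i \<in> Inst. \<forall>\<kappa>\<in>Ks. \<kappa> i \<le> c} Yes)"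


section \<open>Spanners and bundle parameters\<close>

record 'v wgraph =
  verts :: "'v set"
  edges :: "'v set set"
  weight :: "'v set \<Rightarrow> nat"
  len :: "'v set \<Rightarrow> nat"

text \<open>
  A simple path from \<open>u\<close> to \<open>v\<close> is given by the list of its vertices in order. Once
  \<open>u\<close> and \<open>v\<close> are fixed, these lists correspond bijectively to the undirected simple
  \<open>u\<close>-\<open>v\<close>-paths; swapping \<open>u\<close> and \<open>v\<close> reverses the lists.
\<close>

definition path_edges :: "'v list \<Rightarrow> 'v set set" where
  "path_edges p = {{p ! i, p ! Suc i} | i. Suc i < length p}"

definition simple_path :: "'v wgraph \<Rightarrow> 'v \<Rightarrow> 'v \<Rightarrow> 'v list \<Rightarrow> bool" where
  "simple_path G u v p \<longleftrightarrow> p \<noteq> [] \<and> hd p = u \<and> last p = v \<and> distinct p \<and>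
     set p \<subseteq> verts G \<and> path_edges p \<subseteq> edges G"

definition path_len :: "'v wgraph \<Rightarrow> 'v list \<Rightarrow> nat" where
  "path_len G p = (\<Sum>e\<in>path_edges p. len G e)"

definition connected_graph :: "'v wgraph \<Rightarrow> bool" where
  "connected_graph G \<longleftrightarrow> verts G \<noteq> {} \<and>
     (\<forall>u\<in>verts G. \<forall>v\<in>verts G. \<exists>p. simple_path G u v p)"

text \<open>The distance is \<open>\<infinity>\<close> if there is no path.\<close>

definition gdist :: "'v wgraph \<Rightarrow> 'v \<Rightarrow> 'v \<Rightarrow> ereal" where
  "gdist G u v = (INF p\<in>{p. simple_path G u v p}. ereal (real (path_len G p)))"

definition is_spanner :: "'v wgraph \<Rightarrow> rat \<Rightarrow> 'v set set \<Rightarrow> bool" where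
  "is_spanner G \<alpha> F \<longleftrightarrow> F \<subseteq> edges G \<and>
     (\<forall>u\<in>verts G. \<forall>v\<in>verts G.
        gdist (G\<lparr>edges := F\<rparr>) u v \<le> ereal (of_rat \<alpha>) * gdist G u v)"

definition settling_paths :: "'v wgraph \<Rightarrow> rat \<Rightarrow> 'v \<Rightarrow> 'v \<Rightarrow> 'v list set" where
  "settling_paths G \<alpha> u v =
     {p. simple_path G u v p \<and> ereal (real (path_len G p)) \<le> ereal (of_rat \<alpha>) * gdist G u v}"

definition mandatory_edges :: "'v wgraph \<Rightarrow> rat \<Rightarrow> 'v set set" where
  "mandatory_edges G \<alpha> =
     {{u, v} | u v. {u, v} \<in> edges G \<and>
        \<not> (\<exists>p\<in>settling_paths G \<alpha> u v. {u, v} \<notin> path_edges p)}"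

definition trivial_edges :: "'v wgraph \<Rightarrow> rat \<Rightarrow> 'v set set" where
  "trivial_edges G \<alpha> = mandatory_edges G \<alpha> \<union> {e \<in> edges G. weight G e = 0}"

definition nontrivial_edges :: "'v wgraph \<Rightarrow> rat \<Rightarrow> 'v set set" where
  "nontrivial_edges G \<alpha> = edges G - trivial_edges G \<alpha>"

definition critical_pairs :: "'v wgraph \<Rightarrow> rat \<Rightarrow> 'v set set" where
  "critical_pairs G \<alpha> =
     {{u, v} | u v. {u, v} \<in> edges G \<and>
        \<not> (\<exists>p\<in>settling_paths G \<alpha> u v. path_edges p \<subseteq> trivial_edges G \<alpha>)}"

text \<open>
  Each maximum is 0 if there is no critical pair. The inner cardinalities are invariant under
  swapping \<open>u\<close> and \<open>v\<close>, so both orientations of a pair may be listed.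
\<close>

definition bundle_breadth :: "'v wgraph \<Rightarrow> rat \<Rightarrow> nat" where
  "bundle_breadth G \<alpha> = Max (insert 0
     {card (settling_paths G \<alpha> u v) | u v. {u, v} \<in> critical_pairs G \<alpha>})"

definition bundle_size :: "'v wgraph \<Rightarrow> rat \<Rightarrow> nat" where
  "bundle_size G \<alpha> = Max (insert 0
     {card (\<Union>p\<in>settling_paths G \<alpha> u v. path_edges p \<inter> nontrivial_edges G \<alpha>) | u v.
        {u, v} \<in> critical_pairs G \<alpha>})"

definition local_nbhd_size :: "'v wgraph \<Rightarrow> rat \<Rightarrow> nat" where
  "local_nbhd_size G \<alpha> = Max (insert 0
     {card (\<Union>p\<in>settling_paths G \<alpha> u v. set p) | u v. {u, v} \<in> critical_pairs G \<alpha>})"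


section \<open>The Spanner problem\<close>

text \<open>
  An instance has vertices \<open>{..<nverts}\<close> and a list of entries \<open>((u, v), (w, l))\<close>,
  where \<open>u < v\<close> are the endpoints of an edge, \<open>w\<close> its weight and \<open>l\<close> its
  length. The stretch factor is rational, so that it can be part of the input.
\<close>

record spanner_input =
  nverts :: nat
  edge_list :: "((nat \<times> nat) \<times> (nat \<times> nat)) list"
  stretch :: rat
  wbound :: nat

definition graph_of :: "spanner_input \<Rightarrow> nat wgraph" where
  "graph_of I =
     \<lparr>verts = {..<nverts I},
      edges = {{u, v} | u v. (u, v) \<in> fst ` set (edge_list I)},
      weight = (\<lambda>e. fst (the (map_of (edge_list I) (Min e, Max e)))),
      len = (\<lambda>e. snd (the (map_of (edge_list I) (Min e, Max e))))\<rparr>"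

definition spanner_instances :: "spanner_input set" where
  "spanner_instances = {I.
     distinct (map fst (edge_list I)) \<and>
     (\<forall>((u, v), (w, l))\<in>set (edge_list I). u < v \<and> v < nverts I \<and> l \<ge> 1) \<and>
     connected_graph (graph_of I) \<and> stretch I \<ge> 1}"

definition spanner_yes :: "spanner_input set" where
  "spanner_yes = {I \<in> spanner_instances.
     \<exists>F. is_spanner (graph_of I) (stretch I) F \<and> (\<Sum>e\<in>F. weight (graph_of I) e) \<le> wbound I}"

definition basic_instance :: "spanner_input \<Rightarrow> bool" where
  "basic_instance I \<longleftrightarrow>
     (\<forall>e\<in>edges (graph_of I). weight (graph_of I) e = 1 \<and> len (graph_of I) e = 1)"

definition breadth_param :: "spanner_input \<Rightarrow> nat" where
  "breadth_param I = bundle_breadth (graph_of I) (stretch I)"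

definition size_param :: "spanner_input \<Rightarrow> nat" where
  "size_param I = bundle_size (graph_of I) (stretch I)"

definition nbhd_param :: "spanner_input \<Rightarrow> nat" where
  "nbhd_param I = local_nbhd_size (graph_of I) (stretch I)"

text \<open>
  Numbers are encoded in binary, least significant bit first, each bit preceded by \<open>True\<close>
  and the whole terminated by \<open>False\<close>; lists are delimited in the same manner.
\<close>

fun enc_nat :: "nat \<Rightarrow> bool list" where
  "enc_nat n = (if n = 0 then [False] else True # odd n # enc_nat (n div 2))"

declare enc_nat.simps [simp del]

fun enc_list :: "('a \<Rightarrow> bool list) \<Rightarrow> 'a list \<Rightarrow> bool list" where
  "enc_list enc [] = [False]"
| "enc_list enc (x # xs) = True # enc x @ enc_list enc xs"

definition enc_edge :: "(nat \<times> nat) \<times> (nat \<times> nat) \<Rightarrow> bool list" where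
  "enc_edge = (\<lambda>((u, v), (w, l)). enc_nat u @ enc_nat v @ enc_nat w @ enc_nat l)"

text \<open>The stretch factor is written as a reduced fraction.\<close>

definition encode :: "spanner_input \<Rightarrow> bool list" where
  "encode I = enc_nat (nverts I) @ enc_list enc_edge (edge_list I) @
     (case quotient_of (stretch I) of (a, b) \<Rightarrow> enc_nat (nat a) @ enc_nat (nat b)) @
     enc_nat (wbound I)"

lemma enc_nat_append_eq_iff: "enc_nat m @ r = enc_nat n @ s \<longleftrightarrow> m = n \<and> r = s"
proof (induction m arbitrary: n rule: less_induct)
  case (less m)
  show ?case
  proof (cases "m = 0 \<or> n = 0")
    case True
    then show ?thesis
      by (auto simp: enc_nat.simps[of m] enc_nat.simps[of n])
  next
    case False
    have IH: "enc_nat (m div 2) @ r = enc_nat (n div 2) @ s \<longleftrightarrow> m div 2 = n div 2 \<and> r = s"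
      using False by (intro less.IH) simp
    have "m = n \<longleftrightarrow> odd m = odd n \<and> m div 2 = n div 2"
      by (metis dvd_mult_div_cancel odd_two_times_div_two_succ)
    then show ?thesis
      using False IH by (auto simp: enc_nat.simps[of m] enc_nat.simps[of n])
  qed
qed

lemma enc_edge_append_eq_iff: "enc_edge x @ r = enc_edge y @ s \<longleftrightarrow> x = y \<and> r = s"
  by (cases x; cases y) (auto simp: enc_edge_def enc_nat_append_eq_iff split: prod.splits)

lemma enc_edge_list_append_eq_iff:
  "enc_list enc_edge xs @ r = enc_list enc_edge ys @ s \<longleftrightarrow> xs = ys \<and> r = s"
proof (induction xs arbitrary: ys)
  case Nil
  then show ?case by (cases ys) auto
next
  case (Cons x xs)
  then show ?case by (cases ys) (auto simp: enc_edge_append_eq_iff)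
qed

lemma inj_on_encode: "inj_on encode spanner_instances"
proof (rule inj_onI)
  fix I J
  assume I: "I \<in> spanner_instances" and J: "J \<in> spanner_instances"
    and eq: "encode I = encode J"
  obtain a b where ab: "quotient_of (stretch I) = (a, b)" by (cases "quotient_of (stretch I)")
  obtain c d where cd: "quotient_of (stretch J) = (c, d)" by (cases "quotient_of (stretch J)")
  have nonneg: "0 \<le> fst (quotient_of x) \<and> 0 \<le> snd (quotient_of x)" if "x \<ge> 1" for x :: rat
  proof -
    obtain p q where pq: "quotient_of x = (p, q)" by (cases "quotient_of x")
    have q: "q > 0" using pq quotient_of_denom_pos by blast
    have "x = of_int p / of_int q" using pq by (rule quotient_of_div)
    with q that have "p \<ge> 0" by (auto simp: field_simps)
    with q pq show ?thesis by simp
  qed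
  have pos: "a \<ge> 0" "b \<ge> 0" "c \<ge> 0" "d \<ge> 0"
    using nonneg[of "stretch I"] nonneg[of "stretch J"] I J ab cd
    by (auto simp: spanner_instances_def)
  have "nverts I = nverts J \<and> edge_list I = edge_list J \<and> nat a = nat c \<and> nat b = nat d \<and>
      enc_nat (wbound I) = enc_nat (wbound J)"
    using eq ab cd
    by (auto simp: encode_def enc_nat_append_eq_iff enc_edge_list_append_eq_iff)
  moreover from this have "wbound I = wbound J"
    using enc_nat_append_eq_iff[of "wbound I" "[]" "wbound J" "[]"] by simp
  moreover from calculation have "stretch I = stretch J"
    using pos ab cd by (metis nat_eq_iff2 quotient_of_inject)
  ultimately show "I = J" by simp
qed

end

theory Submission
  imports Defs
begin

text \<open>
  Every problem in NP is reduced directly to 2-spanners with unit weights and lengths. Whether a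
  verifier accepts for some certificate is a question about tableaux, hence about local constraints
  on a grid of cells; coded in bits, these become clauses with at most three literals, in which every
  literal occurs at most 216 times, independently of the problem.

  In the graph of the clauses, a hub is adjacent to all literals and all clauses, and every literal is
  joined to its clauses by triangles with an apex of degree two. A 2-spanner contains two edges of each
  triangle and, for each variable, at least one further edge; when the weight bound is tight, this
  is (without loss of generality) a single edge from the hub to a literal, and the clauses are
  spanned if and only if the chosen literals satisfy them. A settling path has at most two edges, so
  the parameters are controlled by the numbers of common neighbours of adjacent vertices. These
  are bounded although the degree of the hub is not.

  The reduction runs in polynomial time because the instance can be written edge by edge by a program
  with finitely many counters of polynomially bounded values, which is compiled to a Turing machine.
\<close>


section \<open>Spanners with stretch two in graphs with unit lengths\<close>

text \<open>The bound on the parameters has to be one number for all problems in NP, whereas the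
  machine of the verifier, and with it the numbers of states, symbols and forbidden windows, varies
  with the problem. One clause per forbidden window would make the bits of a cell occur as often as
  there are forbidden windows. Therefore the bits are copied from one forbidden vector to the next,
  and a literal occurs at most four times per kind of constraint and position in a window. The
  tableau is arranged so that nine kinds of constraints suffice for every machine, each with at most
  six positions in its window, hence 4 * 6 * 9 = 216. With clauses of length at most 3, every vertex
  except the hub has at most 9 + 2 * 3 + 2 * 216 = 447 neighbours, and 2 * 447 + 2 = 896 bounds all
  three parameters.\<close>

lemma path_edges_simps [simp]:
  "path_edges [] = {}" "path_edges [x] = {}"
  "path_edges (x # y # p) = insert {x, y} (path_edges (y # p))"
proof -
  show "path_edges (x # y # p) = insert {x, y} (path_edges (y # p))"
    unfolding path_edges_def
  proof (intro set_eqI iffI)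
    fix e assume "e \<in> {{(x # y # p) ! i, (x # y # p) ! Suc i} |i. Suc i < length (x # y # p)}"
    then obtain i where "e = {(x # y # p) ! i, (x # y # p) ! Suc i}" "Suc i < length (x # y # p)"
      by blast
    then show "e \<in> insert {x, y} {{(y # p) ! i, (y # p) ! Suc i} |i. Suc i < length (y # p)}"
      by (cases i) auto
  next
    fix e assume "e \<in> insert {x, y} {{(y # p) ! i, (y # p) ! Suc i} |i. Suc i < length (y # p)}"
    then consider "e = {x, y}"
      | i where "e = {(y # p) ! i, (y # p) ! Suc i}" "Suc i < length (y # p)" by blast
    then show "e \<in> {{(x # y # p) ! i, (x # y # p) ! Suc i} |i. Suc i < length (x # y # p)}"
    proof cases
      case 1
      then have "e = {(x # y # p) ! 0, (x # y # p) ! Suc 0} \<and> Suc 0 < length (x # y # p)" by simp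
      then show ?thesis by blast
    next
      case (2 i)
      then have "e = {(x # y # p) ! Suc i, (x # y # p) ! Suc (Suc i)} \<and>
          Suc (Suc i) < length (x # y # p)" by simp
      then show ?thesis by blast
    qed
  qed
qed (auto simp: path_edges_def)

lemma path_edges_Cons: "p \<noteq> [] \<Longrightarrow> path_edges (x # p) = insert {x, hd p} (path_edges p)"
  by (cases p) auto

lemma path_edges_subset_set: "e \<in> path_edges p \<Longrightarrow> e \<subseteq> set p"
  by (induction p rule: induct_list012) auto

lemma finite_path_edges [simp]: "finite (path_edges p)"
  by (induction p rule: induct_list012) auto

lemma card_path_edges: "distinct p \<Longrightarrow> card (path_edges p) = length p - 1"
proof (induction p rule: induct_list012)
  case (3 x y p)
  have "{x, y} \<notin> path_edges (y # p)"
    using 3 path_edges_subset_set[of "{x, y}" "y # p"] by auto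
  with 3 show ?case by simp
qed auto

lemma path_edges_append:
  "p \<noteq> [] \<Longrightarrow> q \<noteq> [] \<Longrightarrow> path_edges (p @ q) = path_edges p \<union> insert {last p, hd q} (path_edges q)"
proof (induction p rule: induct_list012)
  case (2 x)
  then show ?case by (simp add: path_edges_Cons)
qed auto

text \<open>Cycles are cut out from the end of the walk to its start: if the new first vertex
  already lies on the path found so far, only the part from that occurrence on is kept.\<close>

lemma walk_imp_path:
  "p \<noteq> [] \<Longrightarrow> path_edges p \<subseteq> E \<Longrightarrow>
    \<exists>p'. p' \<noteq> [] \<and> hd p' = hd p \<and> last p' = last p \<and> distinct p' \<and> set p' \<subseteq> set p \<and>
      path_edges p' \<subseteq> E \<and> length p' \<le> length p"
proof (induction p)
  case (Cons x q)
  show ?case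
  proof (cases "q = []")
    case True
    then show ?thesis by (intro exI[of _ "[x]"]) simp
  next
    case False
    with Cons obtain q' where q': "q' \<noteq> []" "hd q' = hd q" "last q' = last q" "distinct q'"
      "set q' \<subseteq> set q" "path_edges q' \<subseteq> E" "length q' \<le> length q"
      by (auto simp: path_edges_Cons)
    show ?thesis
    proof (cases "x \<in> set q'")
      case True
      then obtain as bs where ab: "q' = as @ x # bs" by (auto simp: in_set_conv_decomp)
      have "path_edges (x # bs) \<subseteq> path_edges q'"
        using ab by (cases "as = []") (auto simp: path_edges_append)
      then show ?thesis
        using ab q' False by (intro exI[of _ "x # bs"]) auto
    next
      case nin: False
      then show ?thesis
        using q' False Cons.prems by (intro exI[of _ "x # q'"]) (auto simp: path_edges_Cons)
    qed
  qed
qed simp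

section \<open>Distances in graphs with unit lengths\<close>

definition unit_graph :: "'v wgraph \<Rightarrow> bool" where
  "unit_graph G \<longleftrightarrow> (\<forall>e\<in>edges G. len G e = 1)"

lemma unit_graph_subgraph: "unit_graph G \<Longrightarrow> F \<subseteq> edges G \<Longrightarrow> unit_graph (G\<lparr>edges := F\<rparr>)"
  by (auto simp: unit_graph_def)

lemma path_len_unit: "unit_graph G \<Longrightarrow> simple_path G u v p \<Longrightarrow> path_len G p = length p - 1"
  unfolding path_len_def simple_path_def unit_graph_def
  by (subst sum.cong[where h = "\<lambda>_. 1"]) (auto simp: card_path_edges)

text \<open>The infimum is taken over natural numbers, so it is a minimum as soon as one path
  exists.\<close>

lemma gdist_attained:
  assumes "simple_path G u v p"
  obtains p0 where "simple_path G u v p0" "gdist G u v = ereal (real (path_len G p0))"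
proof -
  let ?P = "{p. simple_path G u v p}"
  define p0 where "p0 = arg_min (path_len G) (\<lambda>p. simple_path G u v p)"
  have p0: "simple_path G u v p0" "\<And>q. simple_path G u v q \<Longrightarrow> path_len G p0 \<le> path_len G q"
    unfolding p0_def using assms by (auto intro: arg_min_natI arg_min_nat_le)
  have "gdist G u v = ereal (real (path_len G p0))"
    unfolding gdist_def
  proof (rule antisym)
    show "(INF p\<in>?P. ereal (real (path_len G p))) \<le> ereal (real (path_len G p0))"
      by (rule INF_lower) (use p0 in auto)
    show "ereal (real (path_len G p0)) \<le> (INF p\<in>?P. ereal (real (path_len G p)))"
      by (rule INF_greatest) (use p0 in auto)
  qed
  with p0 that show ?thesis by blast
qed

lemma gdist_le: "simple_path G u v p \<Longrightarrow> gdist G u v \<le> ereal (real (path_len G p))"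
  unfolding gdist_def by (rule INF_lower) auto

lemma gdist_le_walk:
  assumes "unit_graph G" "p \<noteq> []" "hd p = u" "last p = v" "set p \<subseteq> verts G"
    "path_edges p \<subseteq> edges G"
  shows "gdist G u v \<le> ereal (real (length p - 1))"
proof -
  obtain p' where p': "p' \<noteq> []" "hd p' = hd p" "last p' = last p" "distinct p'"
    "set p' \<subseteq> set p" "path_edges p' \<subseteq> edges G" "length p' \<le> length p"
    using walk_imp_path[OF assms(2,6)] by blast
  then have sp: "simple_path G u v p'" using assms by (auto simp: simple_path_def)
  have "gdist G u v \<le> ereal (real (length p' - 1))"
    using gdist_le[OF sp] path_len_unit[OF assms(1) sp] by simp
  also have "\<dots> \<le> ereal (real (length p - 1))" using p' by simp
  finally show ?thesis .
qed

lemma edge_simple_path: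
  "{u, v} \<in> edges G \<Longrightarrow> u \<noteq> v \<Longrightarrow> u \<in> verts G \<Longrightarrow> v \<in> verts G \<Longrightarrow> simple_path G u v [u, v]"
  by (auto simp: simple_path_def)

definition spanned2 :: "'v set set \<Rightarrow> 'v \<Rightarrow> 'v \<Rightarrow> bool" where
  "spanned2 F u v \<longleftrightarrow> {u, v} \<in> F \<or> (\<exists>w. {u, w} \<in> F \<and> {w, v} \<in> F)"

lemma spanned2_commute: "spanned2 F u v \<longleftrightarrow> spanned2 F v u"
  by (auto simp: spanned2_def insert_commute)

definition loopfree :: "'v wgraph \<Rightarrow> bool" where
  "loopfree G \<longleftrightarrow> (\<forall>e\<in>edges G. \<exists>u v. e = {u, v} \<and> u \<noteq> v \<and> u \<in> verts G \<and> v \<in> verts G)"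

lemma loopfreeD: "loopfree G \<Longrightarrow> {u, v} \<in> edges G \<Longrightarrow> u \<noteq> v \<and> u \<in> verts G \<and> v \<in> verts G"
  unfolding loopfree_def by (metis doubleton_eq_iff)

text \<open>Each edge of the walk is replaced by itself or by its detour in \<open>F\<close>. This
  at most doubles the number of steps and carries the stretch from edges over to all pairs.\<close>

lemma walk_in_spanned:
  assumes "\<And>u v. {u, v} \<in> edges G \<Longrightarrow> spanned2 F u v" "loopfree G" "F \<subseteq> edges G"
    "p \<noteq> []" "path_edges p \<subseteq> edges G" "set p \<subseteq> verts G"
  shows "\<exists>q. q \<noteq> [] \<and> hd q = hd p \<and> last q = last p \<and> path_edges q \<subseteq> F \<and> set q \<subseteq> verts G \<and>
    length q - 1 \<le> 2 * (length p - 1)"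
  using assms(4-6)
proof (induction p rule: induct_list012)
  case (2 x)
  then show ?case by (intro exI[of _ "[x]"]) auto
next
  case (3 x y p)
  then obtain q where q: "q \<noteq> []" "hd q = y" "last q = last (y # p)" "path_edges q \<subseteq> F"
    "set q \<subseteq> verts G" "length q - 1 \<le> 2 * (length (y # p) - 1)" by auto
  have "spanned2 F x y" using 3 assms(1) by simp
  then consider "{x, y} \<in> F" | w where "{x, w} \<in> F" "{w, y} \<in> F" by (auto simp: spanned2_def)
  then show ?case
  proof cases
    case 1
    then show ?thesis using q 3 by (intro exI[of _ "x # q"]) (auto simp: path_edges_Cons)
  next
    case (2 w)
    then have "w \<in> verts G" using loopfreeD[OF assms(2)] assms(3) by blast
    then show ?thesis
      using q 3 2 by (intro exI[of _ "x # w # q"]) (auto simp: path_edges_Cons)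
  qed
qed simp

lemma short_path_cases:
  assumes "simple_path G u v p" "u \<noteq> v" "length p - 1 \<le> 2"
  obtains "p = [u, v]" "{u, v} \<in> edges G"
  | w where "p = [u, w, v]" "{u, w} \<in> edges G" "{w, v} \<in> edges G"
proof -
  consider "p = []" | a where "p = [a]" | a b where "p = [a, b]" | a b c where "p = [a, b, c]"
    | a b c d q where "p = a # b # c # d # q"
    by (metis neq_Nil_conv)
  then show thesis using assms that by cases (auto simp: simple_path_def)
qed

lemma is_spanner_iff_spanned2:
  assumes unit: "unit_graph G" and lf: "loopfree G"
  shows "is_spanner G 2 F \<longleftrightarrow> F \<subseteq> edges G \<and> (\<forall>u v. {u, v} \<in> edges G \<longrightarrow> spanned2 F u v)"
proof (intro iffI conjI allI impI)
  assume sp: "is_spanner G 2 F"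
  then show F: "F \<subseteq> edges G" by (simp add: is_spanner_def)
  fix u v assume e: "{u, v} \<in> edges G"
  note uv = loopfreeD[OF lf e]
  have path: "simple_path G u v [u, v]" using e uv by (intro edge_simple_path) auto
  have "gdist G u v \<le> 1"
    using gdist_le[OF path] path_len_unit[OF unit path] by (simp add: one_ereal_def)
  then have "2 * gdist G u v \<le> 2 * 1" by (intro ereal_mult_left_mono) auto
  moreover have "gdist (G\<lparr>edges := F\<rparr>) u v \<le> ereal (of_rat 2) * gdist G u v"
    using sp uv by (auto simp: is_spanner_def)
  ultimately have le: "gdist (G\<lparr>edges := F\<rparr>) u v \<le> 2" by simp
  \<comment> \<open>Without a path in \<open>F\<close> the distance would be infinite, but it is at
    most 2.\<close>
  have "\<exists>p. simple_path (G\<lparr>edges := F\<rparr>) u v p"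
  proof (rule ccontr)
    assume "\<not> ?thesis"
    then have "gdist (G\<lparr>edges := F\<rparr>) u v = \<infinity>" by (simp add: gdist_def top_ereal_def)
    with le show False by simp
  qed
  then obtain p where p: "simple_path (G\<lparr>edges := F\<rparr>) u v p"
    "gdist (G\<lparr>edges := F\<rparr>) u v = ereal (real (path_len (G\<lparr>edges := F\<rparr>) p))"
    by (metis gdist_attained)
  then have "length p - 1 \<le> 2"
    using le path_len_unit[OF unit_graph_subgraph[OF unit F] p(1)] by simp
  from short_path_cases[OF p(1) _ this] uv show "spanned2 F u v"
    by (auto simp: spanned2_def)
next
  assume "F \<subseteq> edges G \<and> (\<forall>u v. {u, v} \<in> edges G \<longrightarrow> spanned2 F u v)"
  then have F: "F \<subseteq> edges G" and s: "\<And>u v. {u, v} \<in> edges G \<Longrightarrow> spanned2 F u v" by auto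
  show "is_spanner G 2 F"
    unfolding is_spanner_def
  proof (intro conjI F ballI)
    fix u v assume uv: "u \<in> verts G" "v \<in> verts G"
    show "gdist (G\<lparr>edges := F\<rparr>) u v \<le> ereal (of_rat 2) * gdist G u v"
    proof (cases "\<exists>p. simple_path G u v p")
      case False
      then have "gdist G u v = \<infinity>" by (simp add: gdist_def top_ereal_def)
      then show ?thesis by simp
    next
      case True
      then obtain p where p: "simple_path G u v p" "gdist G u v = ereal (real (path_len G p))"
        by (metis gdist_attained)
      obtain q where q: "q \<noteq> []" "hd q = hd p" "last q = last p" "path_edges q \<subseteq> F"
        "set q \<subseteq> verts G" "length q - 1 \<le> 2 * (length p - 1)"
        using walk_in_spanned[OF s lf F, of p] p(1) by (auto simp: simple_path_def)
      have "gdist (G\<lparr>edges := F\<rparr>) u v \<le> ereal (real (length q - 1))"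
        using q p(1) by (intro gdist_le_walk unit_graph_subgraph unit F) (auto simp: simple_path_def)
      also have "\<dots> \<le> ereal (real (2 * (length p - 1)))"
        using q by (simp del: of_nat_mult)
      also have "\<dots> = 2 * gdist G u v"
        using p(2) path_len_unit[OF unit p(1)] by simp
      finally show ?thesis by simp
    qed
  qed
qed

section \<open>Settling paths and the three parameters\<close>

lemma settling_paths_subset:
  assumes unit: "unit_graph G" and lf: "loopfree G" and e: "{u, v} \<in> edges G"
  shows "settling_paths G 2 u v \<subseteq>
    insert [u, v] ((\<lambda>w. [u, w, v]) ` {w. {u, w} \<in> edges G \<and> {w, v} \<in> edges G})"
proof
  fix p assume "p \<in> settling_paths G 2 u v"
  then have p: "simple_path G u v p" "ereal (real (path_len G p)) \<le> 2 * gdist G u v"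
    by (auto simp: settling_paths_def)
  note uv = loopfreeD[OF lf e]
  \<comment> \<open>The ends of an edge have distance at most 1, so a settling path has length at
    most 2.\<close>
  have path: "simple_path G u v [u, v]" using e uv by (intro edge_simple_path) auto
  have "gdist G u v \<le> 1"
    using gdist_le[OF path] path_len_unit[OF unit path] by (simp add: one_ereal_def)
  then have "2 * gdist G u v \<le> 2 * 1" by (intro ereal_mult_left_mono) auto
  with p(2) have "ereal (real (path_len G p)) \<le> 2 * 1" by (rule order_trans)
  then have "length p - 1 \<le> 2" using path_len_unit[OF unit p(1)] by simp
  from short_path_cases[OF p(1) _ this] uv
  show "p \<in> insert [u, v] ((\<lambda>w. [u, w, v]) ` {w. {u, w} \<in> edges G \<and> {w, v} \<in> edges G})"
    by auto
qed

text \<open>The bound itself makes \<open>S\<close> finite, so \<open>Max\<close> can be estimated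
  without counting the critical pairs.\<close>

lemma Max_insert_0_le:
  fixes c :: nat
  assumes "\<And>x. x \<in> S \<Longrightarrow> x \<le> c"
  shows "Max (insert 0 S) \<le> c"
proof -
  have "finite S" by (rule finite_subset[of _ "{..c}"]) (use assms in auto)
  with assms show ?thesis by simp
qed

text \<open>With \<open>d\<close> common neighbours there are at most \<open>d + 1\<close> settling
  paths, on at most \<open>2 * d + 1\<close> edges and \<open>d + 2\<close> vertices;
  \<open>2 * d + 2\<close> covers all three counts.\<close>

lemma settling_bounds:
  assumes unit: "unit_graph G" and lf: "loopfree G" and e: "{u, v} \<in> edges G"
    and cn: "finite {w. {u, w} \<in> edges G \<and> {w, v} \<in> edges G}"
      "card {w. {u, w} \<in> edges G \<and> {w, v} \<in> edges G} \<le> d"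
  shows "card (settling_paths G 2 u v) \<le> 2 * d + 2"
    and "card (\<Union>p\<in>settling_paths G 2 u v. path_edges p \<inter> N) \<le> 2 * d + 2"
    and "card (\<Union>p\<in>settling_paths G 2 u v. set p) \<le> 2 * d + 2"
proof -
  let ?C = "{w. {u, w} \<in> edges G \<and> {w, v} \<in> edges G}"
  let ?S = "insert [u, v] ((\<lambda>w. [u, w, v]) ` ?C)"
  note sub = settling_paths_subset[OF unit lf e]
  have "card (settling_paths G 2 u v) \<le> card ?S" using sub cn by (intro card_mono) auto
  also have "\<dots> \<le> Suc (card ?C)"
    using card_insert_le_m1 card_image_le[OF cn(1), of "\<lambda>w. [u, w, v]"] cn(1)
    by (simp add: card_insert_if)
  finally show "card (settling_paths G 2 u v) \<le> 2 * d + 2" using cn(2) by simp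
  have "(\<Union>p\<in>settling_paths G 2 u v. path_edges p \<inter> N) \<subseteq> (\<Union>p\<in>?S. path_edges p)"
    using sub by blast
  also have "\<dots> \<subseteq> insert {u, v} ((\<lambda>w. {u, w}) ` ?C \<union> (\<lambda>w. {w, v}) ` ?C)" by auto
  finally have "card (\<Union>p\<in>settling_paths G 2 u v. path_edges p \<inter> N) \<le> card \<dots>"
    using cn by (intro card_mono) auto
  also have "\<dots> \<le> Suc (card ((\<lambda>w. {u, w}) ` ?C \<union> (\<lambda>w. {w, v}) ` ?C))"
    using cn by (simp add: card_insert_if)
  also have "\<dots> \<le> Suc (card ?C + card ?C)"
    using card_Un_le[of "(\<lambda>w. {u, w}) ` ?C" "(\<lambda>w. {w, v}) ` ?C"]
      card_image_le[OF cn(1), of "\<lambda>w. {u, w}"] card_image_le[OF cn(1), of "\<lambda>w. {w, v}"] by linarith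
  finally show "card (\<Union>p\<in>settling_paths G 2 u v. path_edges p \<inter> N) \<le> 2 * d + 2"
    using cn(2) by simp
  have "(\<Union>p\<in>settling_paths G 2 u v. set p) \<subseteq> (\<Union>p\<in>?S. set p)" using sub by blast
  also have "\<dots> \<subseteq> {u, v} \<union> ?C" by auto
  finally have "card (\<Union>p\<in>settling_paths G 2 u v. set p) \<le> card ({u, v} \<union> ?C)"
    using cn by (intro card_mono) auto
  also have "\<dots> \<le> card {u, v} + card ?C" by (rule card_Un_le)
  also have "\<dots> \<le> 2 + card ?C" by (simp add: card_insert_if)
  finally show "card (\<Union>p\<in>settling_paths G 2 u v. set p) \<le> 2 * d + 2" using cn(2) by simp
qed

lemma bundle_params_le:
  assumes unit: "unit_graph G" and lf: "loopfree G"
    and cn: "\<And>u v. {u, v} \<in> edges G \<Longrightarrow> finite {w. {u, w} \<in> edges G \<and> {w, v} \<in> edges G} \<and>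
      card {w. {u, w} \<in> edges G \<and> {w, v} \<in> edges G} \<le> d"
  shows "bundle_breadth G 2 \<le> 2 * d + 2" "bundle_size G 2 \<le> 2 * d + 2"
    "local_nbhd_size G 2 \<le> 2 * d + 2"
proof -
  have crit: "{u, v} \<in> edges G" if "{u, v} \<in> critical_pairs G 2" for u v
    using that by (auto simp: critical_pairs_def doubleton_eq_iff insert_commute)
  note b = settling_bounds[OF unit lf crit, OF _ conjunct1[OF cn[OF crit]] conjunct2[OF cn[OF crit]]]
  show "bundle_breadth G 2 \<le> 2 * d + 2"
    unfolding bundle_breadth_def by (rule Max_insert_0_le) (use b(1) in blast)
  show "bundle_size G 2 \<le> 2 * d + 2"
    unfolding bundle_size_def by (rule Max_insert_0_le) (use b(2) in blast)
  show "local_nbhd_size G 2 \<le> 2 * d + 2"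
    unfolding local_nbhd_size_def by (rule Max_insert_0_le) (use b(3) in blast)
qed

section \<open>The graph of a formula\<close>

text \<open>A literal is the number of its vertex. Variable \<open>k\<close> owns the vertices from
  \<open>6 * k + 1\<close> to \<open>6 * k + 6\<close>, among them \<open>6 * k + 1\<close> for the
  variable and \<open>6 * k + 2\<close> for its negation.\<close>

fun lit_true :: "(nat \<Rightarrow> bool) \<Rightarrow> nat \<Rightarrow> bool" where
  "lit_true x l = (if l mod 6 = 1 then x (l div 6) else \<not> x (l div 6))"

declare lit_true.simps [simp del]

lemma lit_true_simps [simp]:
  "lit_true x (6 * k + 1) = x k" "lit_true x (Suc (6 * k)) = x k"
  "lit_true x (6 * k + 2) = (\<not> x k)" "lit_true x (Suc (Suc (6 * k))) = (\<not> x k)"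
proof -
  have "Suc (6 * k) mod 6 = 1" "Suc (6 * k) div 6 = k"
    "Suc (Suc (6 * k)) mod 6 = 2" "Suc (Suc (6 * k)) div 6 = k" by presburger+
  then show "lit_true x (6 * k + 1) = x k" "lit_true x (Suc (6 * k)) = x k"
    "lit_true x (6 * k + 2) = (\<not> x k)" "lit_true x (Suc (Suc (6 * k))) = (\<not> x k)"
    by (simp_all add: lit_true.simps)
qed

definition literals :: "nat \<Rightarrow> nat set" where
  "literals V = (\<Union>k<V. {6 * k + 1, 6 * k + 2})"

text \<open>The first link joins the two literals of a variable, so that the hub reaches the false
  literal through the true one. The other two join both literals to the vertex of the clause that is
  always true.\<close>

definition var_links :: "nat \<Rightarrow> (nat \<times> nat \<times> nat) set" where
  "var_links V = (\<Union>k<V. {(6 * k + 1, 6 * k + 2, 6 * k + 3), (6 * k + 1, 6 * k + 4, 6 * k + 5),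
     (6 * k + 2, 6 * k + 4, 6 * k + 6)})"

text \<open>
  Vertex 0 is adjacent to the literals \<open>6k+1\<close>, \<open>6k+2\<close>, to the vertices \<open>6k+4\<close> that stand for
  the clauses \<open>x \<or> \<not>x\<close>, and to the clause vertices in \<open>Cl\<close>. A link \<open>(l, a, c)\<close> is a triangle;
  its apex \<open>c\<close> has no further neighbours, so every 2-spanner contains two edges of the triangle.
\<close>

locale formula_graph =
  fixes V :: nat and Cl :: "nat set" and CL :: "(nat \<times> nat \<times> nat) set"
  assumes finite_Cl: "finite Cl" and finite_CL: "finite CL"
    and Cl_gt: "u \<in> Cl \<Longrightarrow> 6 * V < u"
    and CL_lit: "(l, a, c) \<in> CL \<Longrightarrow> l \<in> literals V"
    and CL_cl: "(l, a, c) \<in> CL \<Longrightarrow> a \<in> Cl"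
    and CL_gt: "(l, a, c) \<in> CL \<Longrightarrow> a < c"
    and CL_nin: "(l, a, c) \<in> CL \<Longrightarrow> c \<notin> Cl"
    and CL_apex: "(l, a, c) \<in> CL \<Longrightarrow> (l', a', c) \<in> CL \<Longrightarrow> l = l' \<and> a = a'"
    and CL_inj: "(l, a, c) \<in> CL \<Longrightarrow> (l, a, c') \<in> CL \<Longrightarrow> c = c'"
begin

section \<open>Edges and links of the graph\<close>

definition "Lk = var_links V \<union> CL"
definition "A = (\<Union>k<V. {6 * k + 1, 6 * k + 2, 6 * k + 4}) \<union> Cl"
text \<open>Edges are directed from the smaller to the larger end (\<open>ed_less\<close>), the
  order demanded of the entries of an instance.\<close>

definition "ed u v \<longleftrightarrow> (u = 0 \<and> v \<in> A) \<or> (\<exists>c. (u, v, c) \<in> Lk) \<or> (\<exists>a. (u, a, v) \<in> Lk) \<or>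
  (\<exists>l. (l, u, v) \<in> Lk)"
definition "E = {{u, v} | u v. ed u v}"

lemma CL_bounds: "(l, a, c) \<in> CL \<Longrightarrow> l \<le> 6 * V \<and> 0 < l \<and> 6 * V < a \<and> 6 * V < c"
  using CL_lit[of l a c] CL_gt[of l a c] Cl_gt[of a] CL_cl[of l a c] by (auto simp: literals_def)

lemma block_iff:
  assumes "0 < i" "i < 6" shows "(\<exists>k<V. l = 6 * k + i) \<longleftrightarrow> l < 6 * V \<and> l mod 6 = i"
proof
  assume "l < 6 * V \<and> l mod 6 = i"
  then have "l div 6 < V \<and> l = 6 * (l div 6) + i"
    using mult_div_mod_eq[of 6 l] less_mult_imp_div_less[of l V 6] by (simp add: mult.commute)
  then show "\<exists>k<V. l = 6 * k + i" by blast
qed (use assms in auto)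

lemma literals_mod6: "l \<in> literals V \<longleftrightarrow> l < 6 * V \<and> (l mod 6 = 1 \<or> l mod 6 = 2)"
  using block_iff[of 1 l] block_iff[of 2 l] unfolding literals_def by auto

lemma A_cases: "a \<in> A \<longleftrightarrow> (a < 6 * V \<and> (a mod 6 = 1 \<or> a mod 6 = 2 \<or> a mod 6 = 4)) \<or> a \<in> Cl"
  using block_iff[of 1 a] block_iff[of 2 a] block_iff[of 4 a] unfolding A_def by auto

lemma var_links_cases: "(l, a, c) \<in> var_links V \<longleftrightarrow>
  (\<exists>k<V. (l = 6 * k + 1 \<and> a = 6 * k + 2 \<and> c = 6 * k + 3) \<or>
    (l = 6 * k + 1 \<and> a = 6 * k + 4 \<and> c = 6 * k + 5) \<or>
    (l = 6 * k + 2 \<and> a = 6 * k + 4 \<and> c = 6 * k + 6))"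
  unfolding var_links_def by auto

text \<open>Residues modulo 6 distinguish the three links of a block: the apex determines its link,
  and the other two vertices determine the apex.\<close>

lemma var_links_mod:
  assumes "(l, a, c) \<in> var_links V"
  shows "(c mod 6 = 3 \<and> l = c - 2 \<and> a = c - 1) \<or> (c mod 6 = 5 \<and> l = c - 4 \<and> a = c - 1) \<or>
      (c mod 6 = 0 \<and> l = c - 4 \<and> a = c - 2)"
    and "(l mod 6 = 1 \<and> a = l + 1 \<and> c = l + 2) \<or> (l mod 6 = 1 \<and> a = l + 3 \<and> c = l + 4) \<or>
      (l mod 6 = 2 \<and> a = l + 2 \<and> c = l + 4)"
proof -
  from assms obtain k where k: "(l = 6 * k + 1 \<and> a = 6 * k + 2 \<and> c = 6 * k + 3) \<or>
      (l = 6 * k + 1 \<and> a = 6 * k + 4 \<and> c = 6 * k + 5) \<or>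
      (l = 6 * k + 2 \<and> a = 6 * k + 4 \<and> c = 6 * k + 6)"
    unfolding var_links_cases by blast
  have m: "(6 * k + i) mod 6 = i mod 6" for i by simp
  show "(c mod 6 = 3 \<and> l = c - 2 \<and> a = c - 1) \<or> (c mod 6 = 5 \<and> l = c - 4 \<and> a = c - 1) \<or>
      (c mod 6 = 0 \<and> l = c - 4 \<and> a = c - 2)"
    using k m[of 3] m[of 5] m[of 6] by auto
  show "(l mod 6 = 1 \<and> a = l + 1 \<and> c = l + 2) \<or> (l mod 6 = 1 \<and> a = l + 3 \<and> c = l + 4) \<or>
      (l mod 6 = 2 \<and> a = l + 2 \<and> c = l + 4)"
    using k m[of 1] m[of 2] by auto
qed

lemma Lk_props:
  assumes "(l, a, c) \<in> Lk"
  shows "0 < l" "l < a" "a < c" "l \<in> literals V" "l \<in> A" "a \<in> A" "c \<notin> A"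
proof -
  have "0 < l \<and> l < a \<and> a < c \<and> l \<in> literals V \<and> l \<in> A \<and> a \<in> A \<and> c \<notin> A"
  proof (cases "(l, a, c) \<in> CL")
    case True
    then show ?thesis
      using CL_bounds[OF True] CL_lit[OF True] CL_cl[OF True] CL_gt[OF True] CL_nin[OF True]
      by (auto simp: A_cases literals_mod6)
  next
    case False
    then obtain k where k: "k < V" "(l = 6 * k + 1 \<and> a = 6 * k + 2 \<and> c = 6 * k + 3) \<or>
        (l = 6 * k + 1 \<and> a = 6 * k + 4 \<and> c = 6 * k + 5) \<or>
        (l = 6 * k + 2 \<and> a = 6 * k + 4 \<and> c = 6 * k + 6)"
      using assms by (auto simp: Lk_def var_links_cases)
    then have le: "c \<le> 6 * V" "l < 6 * V" "a < 6 * V" by auto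
    have "c \<notin> Cl" using Cl_gt[of c] le by auto
    moreover have m: "(6 * k + i) mod 6 = i mod 6" for i by simp
    have "c mod 6 = 3 \<or> c mod 6 = 5 \<or> c mod 6 = 0" "l mod 6 = 1 \<or> l mod 6 = 2"
      "a mod 6 = 2 \<or> a mod 6 = 4" "0 < l" "l < a" "a < c"
      using k m[of 1] m[of 2] m[of 3] m[of 4] m[of 5] m[of 6] by auto
    ultimately show ?thesis using le by (auto simp: A_cases literals_mod6)
  qed
  then show "0 < l" "l < a" "a < c" "l \<in> literals V" "l \<in> A" "a \<in> A" "c \<notin> A" by auto
qed

lemma Lk_apex:
  assumes "(l, a, c) \<in> Lk" "(l', a', c) \<in> Lk" shows "l = l' \<and> a = a'"
proof -
  have "\<not> ((l, a, c) \<in> CL \<and> (l', a', c) \<in> var_links V)" for l a l' a'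
    using CL_bounds[of l a c] by (auto simp: var_links_cases)
  moreover have "l = l' \<and> a = a'" if "(l, a, c) \<in> var_links V" "(l', a', c) \<in> var_links V"
    using var_links_mod(1)[OF that(1)] var_links_mod(1)[OF that(2)] by auto
  ultimately show ?thesis using assms CL_apex unfolding Lk_def by blast
qed

lemma Lk_inj:
  assumes "(l, a, c) \<in> Lk" "(l, a, c') \<in> Lk" shows "c = c'"
proof -
  have "\<not> ((l, a, c) \<in> CL \<and> (l, a, c') \<in> var_links V)" for c c'
    using CL_bounds[of l a c] by (auto simp: var_links_cases)
  moreover have "c = c'" if "(l, a, c) \<in> var_links V" "(l, a, c') \<in> var_links V"
    using var_links_mod(2)[OF that(1)] var_links_mod(2)[OF that(2)] by auto
  ultimately show ?thesis using assms CL_inj unfolding Lk_def by blast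
qed

lemma finite_Lk: "finite Lk" and finite_A: "finite A"
  unfolding Lk_def A_def var_links_def using finite_Cl finite_CL by auto

lemma zero_notin_A: "0 \<notin> A"
  unfolding A_def using Cl_gt by fastforce

lemma ed_less: "ed u v \<Longrightarrow> u < v"
proof -
  have "u < v" if "(u, a, v) \<in> Lk" for a using Lk_props(2,3)[OF that] by simp
  moreover have "0 < v" if "v \<in> A" using zero_notin_A that by (metis gr0I)
  ultimately show "ed u v \<Longrightarrow> u < v" unfolding ed_def using Lk_props(2,3) by blast
qed

lemma in_E: "{u, v} \<in> E \<longleftrightarrow> ed u v \<or> ed v u"
  unfolding E_def by (auto simp: doubleton_eq_iff)

lemma E_zero: "{0, v} \<in> E \<longleftrightarrow> v \<in> A"
proof -
  have "\<not> ed v 0" using ed_less by blast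
  moreover have "(0, a, c) \<notin> Lk" "(l, 0, c) \<notin> Lk" for l a c
    using Lk_props(1,2)[of 0 a c] Lk_props(1,2)[of l 0 c] by auto
  ultimately show ?thesis unfolding in_E by (auto simp: ed_def)
qed

lemma E_apex: assumes "(l, a, c) \<in> Lk" shows "{w, c} \<in> E \<longleftrightarrow> w = l \<or> w = a"
proof -
  note p = Lk_props[OF assms]
  have "c \<noteq> 0" using p(1-3) by simp
  moreover have "(c, a, l) \<notin> Lk" "(l, c, a) \<notin> Lk" for l a using p(7) Lk_props(5,6) by blast+
  ultimately have c: "c \<noteq> 0" "\<And>l a. (c, a, l) \<notin> Lk" "\<And>l a. (l, c, a) \<notin> Lk" by auto
  have "\<not> ed c w" using c by (auto simp: ed_def)
  moreover have "ed w c \<longleftrightarrow> w = l \<or> w = a"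
    using c p Lk_apex[OF assms] assms unfolding ed_def by blast
  ultimately show ?thesis by (simp add: in_E)
qed

lemma E_inner: assumes "u \<in> A" "v \<in> A" shows "{u, v} \<in> E \<longleftrightarrow> (\<exists>c. (u, v, c) \<in> Lk \<or> (v, u, c) \<in> Lk)"
  unfolding in_E ed_def using Lk_props(7) assms zero_notin_A by blast

lemma E_link: assumes "(l, a, c) \<in> Lk" shows "{l, a} \<in> E" "{l, c} \<in> E" "{a, c} \<in> E"
  using assms unfolding in_E ed_def by blast+

definition "tri = (\<lambda>(l, a, c). {{l, a}, {l, c}, {a, c :: nat}})"
definition "var_group k = {{0, 6 * k + 1}, {0, 6 * k + 2}, {0, 6 * k + 4 :: nat}}"

text \<open>Apexes lie outside \<open>A\<close>, so an edge with an apex reveals it and thereby its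
  link; an edge without apex reveals the link by \<open>Lk_inj\<close>. Disjointness makes the
  bounds of \<open>two_in_tri\<close> add up.\<close>

lemma tri_disjoint:
  assumes "t \<in> Lk" "t' \<in> Lk" "t \<noteq> t'" shows "tri t \<inter> tri t' = {}"
proof -
  obtain l a c l' a' c' where t: "t = (l, a, c)" "t' = (l', a', c')" by (cases t; cases t')
  note p = Lk_props[OF assms(1)[unfolded t]] and p' = Lk_props[OF assms(2)[unfolded t]]
  have ne: "c \<noteq> c'" using Lk_apex assms t by auto
  have ne': "\<not> (l = l' \<and> a = a')" using Lk_inj assms t by auto
  show ?thesis
    using p p' ne ne' unfolding t tri_def by (auto simp: doubleton_eq_iff)
qed

section \<open>From a 2-spanner within the budget to a satisfying assignment\<close>

context
  fixes F assumes F: "F \<subseteq> E" and sp: "\<And>u v. {u, v} \<in> E \<Longrightarrow> spanned2 F u v"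
begin

lemma finite_E: "finite E"
proof -
  let ?S = "{0} \<union> A \<union> (snd \<circ> snd) ` Lk"
  have c: "c \<in> ?S" if "(l, a, c) \<in> Lk" for l a c using that by force
  have "u \<in> ?S \<and> v \<in> ?S" if "ed u v" for u v
    using that c Lk_props(5,6) unfolding ed_def by blast
  then have "E \<subseteq> Pow ?S" unfolding E_def by blast
  then show ?thesis by (rule finite_subset) (use finite_Lk finite_A in auto)
qed

text \<open>If one of the two edges at the apex is missing, its only detour consists of the other
  two edges of the triangle.\<close>

lemma two_in_tri: assumes "t \<in> Lk" shows "2 \<le> card (F \<inter> tri t)"
proof -
  obtain l a c where t: "t = (l, a, c)" by (cases t)
  note p = Lk_props[OF assms[unfolded t]] and link = E_link[OF assms[unfolded t]]
  have ap: "w = l \<or> w = a" if "{w, c} \<in> F" for w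
    using that F E_apex[OF assms[unfolded t]] by blast
  have nl: "{w, w} \<notin> F" for w using F ed_less[of w w] in_E[of w w] by auto
  have 1: "{l, c} \<in> F \<or> ({l, a} \<in> F \<and> {a, c} \<in> F)"
    using sp[OF link(2)] ap nl unfolding spanned2_def by metis
  have 2: "{a, c} \<in> F \<or> ({l, a} \<in> F \<and> {l, c} \<in> F)"
    using sp[OF link(3)] ap nl unfolding spanned2_def by (metis insert_commute)
  obtain e e' where "e \<noteq> e'" "{e, e'} \<subseteq> F \<inter> tri t"
  proof (cases "{l, a} \<in> F")
    case True
    then have "{l, c} \<in> F \<or> {a, c} \<in> F" using 1 by blast
    then show ?thesis using True p that[of "{l, a}" "{l, c}"] that[of "{l, a}" "{a, c}"]
      by (auto simp: t tri_def doubleton_eq_iff)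
  next
    case False
    then show ?thesis using 1 2 p that[of "{l, c}" "{a, c}"]
      by (auto simp: t tri_def doubleton_eq_iff)
  qed
  moreover have "finite (F \<inter> tri t)" by (auto simp: t tri_def)
  ultimately show ?thesis using card_mono[of "F \<inter> tri t" "{e, e'}"] by auto
qed

lemma U_adj: assumes "k < V" "w \<in> A" "{w, 6 * k + 4} \<in> E" shows "w = 6 * k + 1 \<or> w = 6 * k + 2"
proof -
  have in_A: "6 * k + 4 \<in> A" using assms(1) by (auto simp: A_def)
  have "6 * k + 4 \<notin> literals V" unfolding literals_mod6 by presburger
  then obtain c where c: "(w, 6 * k + 4, c) \<in> Lk"
    using assms E_inner[OF assms(2) in_A] Lk_props(4) by blast
  moreover have "(w, 6 * k + 4, c) \<notin> CL" using CL_bounds[of w "6 * k + 4" c] assms(1) by auto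
  ultimately have "(w, 6 * k + 4, c) \<in> var_links V" by (simp add: Lk_def)
  then obtain j where "(w = 6 * j + 1 \<and> 6 * k + 4 = 6 * j + 2) \<or>
      (w = 6 * j + 1 \<and> 6 * k + 4 = 6 * j + 4) \<or> (w = 6 * j + 2 \<and> 6 * k + 4 = 6 * j + 4)"
    unfolding var_links_cases by blast
  moreover have "6 * k + 4 \<noteq> 6 * j + 2" by presburger
  ultimately show ?thesis by auto
qed

text \<open>The edge from the hub to \<open>6 * k + 4\<close> is either present or bypassed through
  a literal of variable \<open>k\<close> (\<open>U_adj\<close>); both ways use an edge of the
  group.\<close>

lemma one_in_var_group: assumes "k < V" shows "1 \<le> card (F \<inter> var_group k)"
proof -
  have in_A: "6 * k + 4 \<in> A" using assms by (auto simp: A_def)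
  then have "{0, 6 * k + 4} \<in> E" by (simp add: E_zero)
  from sp[OF this] have "F \<inter> var_group k \<noteq> {}"
  proof (unfold spanned2_def, elim disjE exE conjE)
    fix w assume w: "{0, w} \<in> F" "{w, 6 * k + 4} \<in> F"
    then have "w \<in> A" using F E_zero by blast
    then have "w = 6 * k + 1 \<or> w = 6 * k + 2" using U_adj[OF assms] w F by blast
    with w show ?thesis by (auto simp: var_group_def)
  qed (auto simp: var_group_def)
  moreover have "finite (F \<inter> var_group k)" by (auto simp: var_group_def)
  ultimately show ?thesis by (simp add: Suc_leI card_gt_0_iff)
qed

definition "F0 = {e \<in> F. 0 \<in> e}"

lemma var_group_disjoint: "k \<noteq> k' \<Longrightarrow> (F \<inter> var_group k) \<inter> (F \<inter> var_group k') = {}"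
proof -
  assume "k \<noteq> k'"
  have "v div 6 = n" if "{0, v} \<in> var_group n" for v n
    using that by (auto simp: var_group_def doubleton_eq_iff)
  moreover have "\<exists>v. e = {0, v}" if "e \<in> var_group n" for e n
    using that by (auto simp: var_group_def)
  ultimately show ?thesis using \<open>k \<noteq> k'\<close> by blast
qed

text \<open>The triangles avoid the hub and require two edges each, so at most \<open>V\<close>
  edges remain at the hub. The \<open>V\<close> disjoint groups need one each. Hence there are no
  other hub edges, and no group has two.\<close>

lemma tight_structure:
  assumes "card F \<le> 2 * card Lk + V"
  shows "F0 = (\<Union>k<V. F \<inter> var_group k)" "\<And>k. k < V \<Longrightarrow> card (F \<inter> var_group k) = 1"
proof -
  have finF: "finite F" using F finite_E finite_subset by blast
  let ?FL = "\<Union>t\<in>Lk. F \<inter> tri t"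
  have "card ?FL = (\<Sum>t\<in>Lk. card (F \<inter> tri t))"
    using tri_disjoint finite_Lk finF by (intro card_UN_disjoint) (blast intro: finite_Int)+
  also have "\<dots> \<ge> (\<Sum>t\<in>Lk. 2)" by (rule sum_mono) (rule two_in_tri)
  finally have FL: "2 * card Lk \<le> card ?FL" by simp
  have "?FL \<inter> F0 = {}"
  proof -
    have "0 \<notin> e" if "t \<in> Lk" "e \<in> tri t" for t e
      using that Lk_props(1,2,3) by (cases t) (fastforce simp: tri_def)
    then show ?thesis by (auto simp: F0_def)
  qed
  then have "card ?FL + card F0 = card (?FL \<union> F0)"
    by (intro card_Un_disjoint[symmetric]) (use finF in \<open>auto simp: F0_def finite_Lk\<close>)
  also have "\<dots> \<le> card F" by (rule card_mono[OF finF]) (auto simp: F0_def)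
  finally have F0V: "card F0 \<le> V" using FL assms by linarith
  let ?G = "\<Union>k<V. F \<inter> var_group k"
  have cG: "card ?G = (\<Sum>k<V. card (F \<inter> var_group k))"
    using finF var_group_disjoint by (intro card_UN_disjoint) (blast intro: finite_Int)+
  moreover have "(\<Sum>k<V. card (F \<inter> var_group k)) \<ge> (\<Sum>k<V. 1)"
    by (rule sum_mono) (use one_in_var_group in auto)
  ultimately have GV: "V \<le> card ?G" by simp
  have finF0: "finite F0" using finF by (simp add: F0_def)
  have sub: "?G \<subseteq> F0" by (auto simp: F0_def var_group_def)
  then have "?G = F0" by (rule card_seteq[OF finF0]) (use F0V GV in linarith)
  then show eq: "F0 = ?G" by simp
  show "card (F \<inter> var_group k) = 1" if "k < V" for k
  proof (rule ccontr)
    assume "card (F \<inter> var_group k) \<noteq> 1"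
    then have "1 < card (F \<inter> var_group k)" using one_in_var_group[OF that] by linarith
    then have "(\<Sum>k<V. 1) < (\<Sum>k<V. card (F \<inter> var_group k))"
      using one_in_var_group that by (intro sum_strict_mono_ex1) auto
    with cG eq F0V show False by simp
  qed
qed

text \<open>No edge is left for joining the hub directly to a clause, so the detour to a clause
  passes through a literal with a hub edge. A group may instead spend its edge on
  \<open>6 * k + 4\<close>; then no detour to a clause uses variable \<open>k\<close>, and any value
  is fine.\<close>

lemma spanner_imp_sat:
  assumes "card F \<le> 2 * card Lk + V" "u \<in> Cl"
  shows "\<exists>l c. (l, u, c) \<in> CL \<and> lit_true (\<lambda>k. {0, 6 * k + 1} \<in> F) l"
proof -
  note T = tight_structure[OF assms(1)]
  have "{0, u} \<in> E" using assms(2) by (simp add: E_zero A_def)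
  have F0_cases: "\<exists>k<V. w = 6 * k + 1 \<or> w = 6 * k + 2 \<or> w = 6 * k + 4" if "{0, w} \<in> F" for w
  proof -
    have "{0, w} \<in> F0" using that by (simp add: F0_def)
    then obtain k where "k < V" "{0, w} \<in> var_group k" using T(1) by auto
    then show ?thesis by (auto simp: var_group_def doubleton_eq_iff)
  qed
  have "{0, u} \<notin> F" using F0_cases[of u] Cl_gt[OF assms(2)] by auto
  then obtain w where w: "{0, w} \<in> F" "{w, u} \<in> F"
    using sp[OF \<open>{0, u} \<in> E\<close>] unfolding spanned2_def by blast
  then have "w \<in> A" using F E_zero by blast
  have "u \<in> A" using assms(2) by (simp add: A_def)
  have nlit: "u \<notin> literals V" using Cl_gt[OF assms(2)] by (auto simp: literals_mod6)
  have "{w, u} \<in> E" using w F by blast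
  then obtain c where c: "(w, u, c) \<in> Lk"
    using E_inner[OF \<open>w \<in> A\<close> \<open>u \<in> A\<close>] nlit Lk_props(4) by blast
  have "(w, u, c) \<notin> var_links V" using Cl_gt[OF assms(2)] by (auto simp: var_links_cases)
  with c have CL: "(w, u, c) \<in> CL" by (simp add: Lk_def)
  from CL_lit[OF CL] obtain k where k: "k < V" "w = 6 * k + 1 \<or> w = 6 * k + 2"
    unfolding literals_def by blast
  \<comment> \<open>If the negative literal has the hub edge, then the positive one has none, and
    the assignment makes the variable false.\<close>
  have "\<not> ({0, 6 * k + 1} \<in> F \<and> {0, 6 * k + 2} \<in> F)"
  proof
    assume "{0, 6 * k + 1} \<in> F \<and> {0, 6 * k + 2} \<in> F"
    then have "{{0, 6 * k + 1}, {0, 6 * k + 2}} \<subseteq> F \<inter> var_group k" by (auto simp: var_group_def)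
    then have "card {{0, 6 * k + 1}, {0, 6 * k + 2}} \<le> card (F \<inter> var_group k)"
      by (intro card_mono) (auto simp: var_group_def)
    with T(2)[OF k(1)] show False by (simp add: card_insert_if doubleton_eq_iff)
  qed
  then have "lit_true (\<lambda>k. {0, 6 * k + 1} \<in> F) w"
    using k(2) w(1) lit_true_simps(1,3)[of "\<lambda>k. {0, 6 * k + 1} \<in> F" k] by blast
  with CL show ?thesis by blast
qed

end

text \<open>Hub edges to clauses are spanned through a true literal, hub edges to false literals
  through the link between the two literals of the variable.\<close>

lemma sat_imp_spanner:
  assumes "\<And>u. u \<in> Cl \<Longrightarrow> \<exists>l c. (l, u, c) \<in> CL \<and> lit_true x l"
  shows "\<exists>F\<subseteq>E. (\<forall>u v. {u, v} \<in> E \<longrightarrow> spanned2 F u v) \<and> card F \<le> 2 * card Lk + V"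
proof -
  define lt where "lt k = (if x k then 6 * k + 1 else 6 * k + 2)" for k :: nat
  \<comment> \<open>From each triangle the two edges at the literal are kept, since the edge from
    the literal to the clause is needed for detours from the hub.\<close>
  define F where "F = (\<lambda>k. {0, lt k}) ` {..<V} \<union> (\<lambda>(l, a, c). {l, a}) ` Lk \<union> (\<lambda>(l, a, c). {l, c}) ` Lk"
  have lt_A: "lt k \<in> A" if "k < V" for k using that by (auto simp: lt_def A_def)
  have link: "{l, a} \<in> F" "{l, c} \<in> F" "{a, l} \<in> F" if "(l, a, c) \<in> Lk" for l a c
  proof -
    show 1: "{l, a} \<in> F" "{l, c} \<in> F" unfolding F_def using that by (auto intro!: image_eqI)
    then show "{a, l} \<in> F" by (simp add: insert_commute)
  qed
  have lit: "{0, l} \<in> F" if lV: "l \<in> literals V" and "lit_true x l" for l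
  proof -
    obtain k where k: "k < V" "l = 6 * k + 1 \<or> l = 6 * k + 2"
      using lV unfolding literals_def by blast
    then have "l = lt k" using \<open>lit_true x l\<close> by (auto simp: lt_def)
    then show ?thesis using k(1) by (auto simp: F_def)
  qed
  have "F \<subseteq> E"
    unfolding F_def using lt_A E_zero by (auto intro: E_link)
  moreover have "spanned2 F u v" if uv: "ed u v" for u v
  proof -
    consider "u = 0" "v \<in> A" | c where "(u, v, c) \<in> Lk" | a where "(u, a, v) \<in> Lk" | l where "(l, u, v) \<in> Lk"
      using uv by (auto simp: ed_def)
    then show ?thesis
    proof cases
      case 1
      have "\<exists>l c. (l, v, c) \<in> Lk \<and> lit_true x l" if "v \<in> Cl"
        using assms[OF that] by (auto simp: Lk_def)
      moreover have "\<exists>l c. (l, v, c) \<in> Lk \<and> lit_true x l" if "k < V" "v = 6 * k + 4" for k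
        using that by (cases "x k") (force simp: Lk_def var_links_def)+
      moreover have ?thesis if "k < V" "v = 6 * k + 1 \<or> v = 6 * k + 2" for k
      proof -
        have "(6 * k + 1, 6 * k + 2, 6 * k + 3) \<in> Lk" using that by (auto simp: Lk_def var_links_def)
        then have "{6 * k + 1, 6 * k + 2} \<in> F" "{6 * k + 2, 6 * k + 1} \<in> F" using link by blast+
        moreover have "{0, lt k} \<in> F" using that by (auto simp: F_def)
        ultimately show ?thesis using that(2) 1(1) unfolding lt_def spanned2_def
          by (cases "x k") auto
      qed
      moreover have ?thesis if "\<exists>l c. (l, v, c) \<in> Lk \<and> lit_true x l"
        using that link lit Lk_props(4) 1(1) unfolding spanned2_def by blast
      ultimately show ?thesis using 1(2) unfolding A_def by blast
    next
      case 2 then show ?thesis using link by (auto simp: spanned2_def)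
    next
      case 3 then show ?thesis using link by (auto simp: spanned2_def)
    next
      case 4 then show ?thesis using link unfolding spanned2_def by blast
    qed
  qed
  then have "\<forall>u v. {u, v} \<in> E \<longrightarrow> spanned2 F u v" by (metis in_E spanned2_commute)
  moreover have "card F \<le> 2 * card Lk + V"
  proof -
    have "card F \<le> card ((\<lambda>k. {0, lt k}) ` {..<V}) + card ((\<lambda>(l, a, c). {l, a}) ` Lk)
        + card ((\<lambda>(l, a, c). {l, c}) ` Lk)"
      unfolding F_def by (meson add_le_mono1 card_Un_le order_trans)
    also have "\<dots> \<le> card {..<V} + card Lk + card Lk"
      by (intro add_mono card_image_le) (auto simp: finite_Lk)
    finally show ?thesis by simp
  qed
  ultimately show ?thesis by blast
qed

text \<open>Common neighbours are counted at the larger end of the edge, which is never the hub. It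
  is either an apex, with two neighbours, or a vertex of \<open>A\<close>, whose neighbours are the
  hub and two vertices for each of its links.\<close>

lemma common_neighbours:
  assumes e: "{u, v} \<in> E" and "2 \<le> d"
    and deg: "\<And>a. a \<in> A \<Longrightarrow> 1 + 2 * card {(l, c). (l, a, c) \<in> Lk} + 2 * card {(b, c). (a, b, c) \<in> Lk} \<le> d"
  shows "finite {w. {u, w} \<in> E \<and> {w, v} \<in> E} \<and> card {w. {u, w} \<in> E \<and> {w, v} \<in> E} \<le> d"
proof -
  have nb: "finite {w. {w, a} \<in> E} \<and> card {w. {w, a} \<in> E} \<le> d" if "a \<in> A" for a
  proof -
    let ?I = "{(l, c). (l, a, c) \<in> Lk}" and ?O = "{(b, c). (a, b, c) \<in> Lk}"
    have "?I \<subseteq> (\<lambda>(l, a, c). (l, c)) ` Lk" "?O \<subseteq> (\<lambda>(l, a, c). (a, c)) ` Lk" by force+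
    then have fin: "finite ?I" "finite ?O" using finite_Lk finite_subset by blast+
    let ?N = "{0} \<union> (fst ` ?I \<union> snd ` ?I) \<union> (fst ` ?O \<union> snd ` ?O)"
    have "{w. {w, a} \<in> E} \<subseteq> ?N"
    proof
      fix w assume "w \<in> {w. {w, a} \<in> E}"
      then consider "ed w a" | "ed a w" by (auto simp: in_E)
      then show "w \<in> ?N"
      proof cases
        case 1
        then have "w = 0 \<or> (\<exists>c. (w, a, c) \<in> Lk)" using Lk_props(7) \<open>a \<in> A\<close> unfolding ed_def by blast
        then show ?thesis by force
      next
        case 2
        moreover have "a \<noteq> 0" using \<open>a \<in> A\<close> zero_notin_A by metis
        ultimately have "(\<exists>c. (a, w, c) \<in> Lk) \<or> (\<exists>b. (a, b, w) \<in> Lk) \<or> (\<exists>l. (l, a, w) \<in> Lk)"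
          by (auto simp: ed_def)
        then show ?thesis by force
      qed
    qed
    moreover have "card ?N \<le> d"
    proof -
      have "card ?N \<le> card {0::nat} + (card (fst ` ?I) + card (snd ` ?I)) + (card (fst ` ?O) + card (snd ` ?O))"
        using card_Un_le[of "{0} \<union> (fst ` ?I \<union> snd ` ?I)" "fst ` ?O \<union> snd ` ?O"]
          card_Un_le[of "{0}" "fst ` ?I \<union> snd ` ?I"] card_Un_le[of "fst ` ?I" "snd ` ?I"]
          card_Un_le[of "fst ` ?O" "snd ` ?O"] by linarith
      also have "\<dots> \<le> 1 + (card ?I + card ?I) + (card ?O + card ?O)"
        using card_image_le[OF fin(1), of fst] card_image_le[OF fin(1), of snd]
          card_image_le[OF fin(2), of fst] card_image_le[OF fin(2), of snd] by simp
      finally show ?thesis using deg[OF that] by simp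
    qed
    moreover have "finite ?N" using fin by simp
    ultimately show ?thesis by (meson card_mono finite_subset order_trans)
  qed
  have nb': "finite {w. {w, v} \<in> E} \<and> card {w. {w, v} \<in> E} \<le> d" if uv: "u < v" "{u, v} \<in> E" for u v
  proof (cases "v \<in> A")
    case False
    obtain l a where la: "(l, a, v) \<in> Lk"
    proof -
      have "ed u v" using uv ed_less[of v u] by (auto simp: in_E)
      then have "(\<exists>a. (u, a, v) \<in> Lk) \<or> (\<exists>l. (l, u, v) \<in> Lk)"
        using False Lk_props(6) unfolding ed_def by blast
      then show ?thesis using that by blast
    qed
    then have "{w. {w, v} \<in> E} = {l, a}" using E_apex by blast
    then show ?thesis using \<open>2 \<le> d\<close> by (simp add: card_insert_if)
  qed (rule nb)
  have "u \<noteq> v" using e ed_less in_E by blast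
  then consider "u < v" | "v < u" by linarith
  then show ?thesis
  proof cases
    case 1
    have "{w. {u, w} \<in> E \<and> {w, v} \<in> E} \<subseteq> {w. {w, v} \<in> E}" by auto
    then show ?thesis using nb'[OF 1 e] by (meson card_mono finite_subset order_trans)
  next
    case 2
    have "{w. {u, w} \<in> E \<and> {w, v} \<in> E} \<subseteq> {w. {w, u} \<in> E}" by (auto simp: insert_commute)
    moreover have "{v, u} \<in> E" using e by (simp add: insert_commute)
    ultimately show ?thesis using nb'[OF 2] by (meson card_mono finite_subset order_trans)
  qed
qed

end

section \<open>Spanner instances from formulas\<close>

text \<open>
  A formula is given by the list of its clauses, with literals named by their vertices. The clause \<open>S\<close>
  becomes a star: its clause vertex \<open>m\<close> and one apex \<open>m + 1\<close>, \<open>m + 2\<close> ... for each literal in \<open>S\<close>. The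
  vertices of the variables are made by stars as well, namely \<open>[]\<close>, \<open>[6k+1]\<close> and \<open>[6k+1, 6k+2]\<close>.
\<close>

fun link_edges :: "nat \<Rightarrow> nat \<Rightarrow> nat list \<Rightarrow> (nat \<times> nat) list" where
  "link_edges a c [] = []"
| "link_edges a c (l # S) = (l, a) # (l, c) # (a, c) # link_edges a (Suc c) S"

definition star_edges :: "nat \<Rightarrow> nat list \<Rightarrow> (nat \<times> nat) list" where
  "star_edges m S = (0, m) # link_edges m (Suc m) S"

fun stars_edges :: "nat \<Rightarrow> nat list list \<Rightarrow> (nat \<times> nat) list" where
  "stars_edges m [] = []"
| "stars_edges m (S # Ss) = star_edges m S @ stars_edges (m + Suc (length S)) Ss"

definition stars_size :: "nat list list \<Rightarrow> nat" where
  "stars_size Ss = (\<Sum>S\<leftarrow>Ss. Suc (length S))"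

text \<open>A link costs two edges. The empty star, which occurs exactly once per variable, pays for
  the hub edge to the chosen literal. Thus the weight bound can be accumulated star by star.\<close>

definition budget :: "nat list list \<Rightarrow> nat" where
  "budget Ss = (\<Sum>S\<leftarrow>Ss. if S = [] then 1 else 2 * length S)"

definition stars_instance :: "nat list list \<Rightarrow> spanner_input" where
  "stars_instance Ss = \<lparr>nverts = 1 + stars_size Ss,
     edge_list = map (\<lambda>e. (e, (1, 1))) (stars_edges 1 Ss), stretch = 2, wbound = budget Ss\<rparr>"

fun placed :: "nat \<Rightarrow> nat list list \<Rightarrow> (nat \<times> nat list) list" where
  "placed m [] = []"
| "placed m (S # Ss) = (m, S) # placed (m + Suc (length S)) Ss"

definition star_links :: "nat \<Rightarrow> nat \<Rightarrow> nat list \<Rightarrow> (nat \<times> nat \<times> nat) set" where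
  "star_links a c S = (\<lambda>j. (S ! j, a, c + j)) ` {..<length S}"

definition stars_links :: "nat \<Rightarrow> nat list list \<Rightarrow> (nat \<times> nat \<times> nat) set" where
  "stars_links m Ss = (\<Union>(a, S)\<in>set (placed m Ss). star_links a (Suc a) S)"

definition occ :: "nat \<Rightarrow> nat list list \<Rightarrow> nat" where
  "occ l Ss = (\<Sum>S\<leftarrow>Ss. count_list S l)"

definition varstars :: "nat \<Rightarrow> nat list list" where
  "varstars V = concat (map (\<lambda>k. [[], [6 * k + 1], [6 * k + 1, 6 * k + 2]]) [0..<V])"

section \<open>Vertices and links of consecutive stars\<close>

lemma stars_size_simps [simp]:
  "stars_size [] = 0" "stars_size (S # Ss) = Suc (length S) + stars_size Ss"
  "stars_size (Ss @ Ts) = stars_size Ss + stars_size Ts"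
  by (auto simp: stars_size_def)

lemma budget_simps [simp]:
  "budget [] = 0" "budget (S # Ss) = (if S = [] then 1 else 2 * length S) + budget Ss"
  "budget (Ss @ Ts) = budget Ss + budget Ts"
  by (auto simp: budget_def)

lemma occ_simps [simp]:
  "occ l [] = 0" "occ l (S # Ss) = count_list S l + occ l Ss"
  "occ l (Ss @ Ts) = occ l Ss + occ l Ts"
  by (auto simp: occ_def)

lemma stars_edges_append:
  "stars_edges m (Ss @ Ts) = stars_edges m Ss @ stars_edges (m + stars_size Ss) Ts"
  by (induction Ss arbitrary: m) (auto simp: add_ac)

lemma placed_append: "placed m (Ss @ Ts) = placed m Ss @ placed (m + stars_size Ss) Ts"
  by (induction Ss arbitrary: m) (auto simp: add_ac)

lemma stars_links_append:
  "stars_links m (Ss @ Ts) = stars_links m Ss \<union> stars_links (m + stars_size Ss) Ts"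
  by (simp add: stars_links_def placed_append)

lemma stars_links_simps [simp]:
  "stars_links m [] = {}"
  "stars_links m (S # Ss) = star_links m (Suc m) S \<union> stars_links (m + Suc (length S)) Ss"
  by (auto simp: stars_links_def)

lemma star_links_simps [simp]:
  "star_links a c [] = {}"
  "star_links a c (l # S) = insert (l, a, c) (star_links a (Suc c) S)"
proof -
  have "{..<length (l # S)} = insert 0 (Suc ` {..<length S})"
    by (simp add: lessThan_Suc_eq_insert_0)
  then show "star_links a c (l # S) = insert (l, a, c) (star_links a (Suc c) S)"
    unfolding star_links_def by (simp add: image_image)
qed (simp add: star_links_def)

definition link_edge_set :: "(nat \<times> nat \<times> nat) set \<Rightarrow> (nat \<times> nat) set" where
  "link_edge_set L = {(u, v). (\<exists>c. (u, v, c) \<in> L) \<or> (\<exists>a. (u, a, v) \<in> L) \<or> (\<exists>l. (l, u, v) \<in> L)}"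

lemma set_link_edges: "set (link_edges a c S) = link_edge_set (star_links a c S)"
proof (induction S arbitrary: c)
  case (Cons l S)
  show ?case unfolding link_edges.simps list.set Cons by (auto simp: link_edge_set_def)
qed (simp add: link_edge_set_def)

lemma set_stars_edges:
  "set (stars_edges m Ss) = (\<lambda>(a, S). (0, a)) ` set (placed m Ss) \<union> link_edge_set (stars_links m Ss)"
proof (induction Ss arbitrary: m)
  case (Cons S Ss)
  have "link_edge_set (L \<union> L') = link_edge_set L \<union> link_edge_set L'" for L L'
    by (auto simp: link_edge_set_def)
  then show ?case by (auto simp: Cons star_edges_def set_link_edges)
qed (simp add: link_edge_set_def)

lemma star_links_bounds: "(l, a', c') \<in> star_links a c S \<Longrightarrow> a' = a \<and> c \<le> c' \<and> c' < c + length S \<and> l \<in> set S"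
  by (auto simp: star_links_def)

lemma placed_bounds: "(a, S) \<in> set (placed m Ss) \<Longrightarrow> m \<le> a \<and> a + length S < m + stars_size Ss \<and> S \<in> set Ss"
  by (induction Ss arbitrary: m) fastforce+

lemma stars_links_iff:
  "(l, a, c) \<in> stars_links m Ss \<longleftrightarrow> (\<exists>S j. (a, S) \<in> set (placed m Ss) \<and> j < length S \<and> l = S ! j \<and> c = Suc a + j)"
  unfolding stars_links_def star_links_def by auto

lemma stars_links_bounds:
  assumes "(l, a, c) \<in> stars_links m Ss"
  shows "m \<le> a" "a < c" "c < m + stars_size Ss"
  using assms placed_bounds[of a _ m Ss] unfolding stars_links_iff by fastforce+

text \<open>Different stars occupy disjoint intervals of vertices, and each interval is nonempty, as
  it contains its clause vertex.\<close>

lemma placed_disjoint: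
  "(a, S) \<in> set (placed m Ss) \<Longrightarrow> (b, T) \<in> set (placed m Ss) \<Longrightarrow>
    i \<le> length S \<Longrightarrow> j \<le> length T \<Longrightarrow> a + i = b + j \<Longrightarrow> a = b \<and> S = T"
proof (induction Ss arbitrary: m)
  case (Cons U Ss)
  from Cons.prems(1,2) consider "a = m" "S = U" "b = m" "T = U"
    | "a = m" "S = U" "(b, T) \<in> set (placed (m + Suc (length U)) Ss)"
    | "b = m" "T = U" "(a, S) \<in> set (placed (m + Suc (length U)) Ss)"
    | "(a, S) \<in> set (placed (m + Suc (length U)) Ss)" "(b, T) \<in> set (placed (m + Suc (length U)) Ss)"
    by auto
  then show ?case
  proof cases
    case 2
    then show ?thesis using placed_bounds[of b T "m + Suc (length U)" Ss] Cons.prems by simp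
  next
    case 3
    then show ?thesis using placed_bounds[of a S "m + Suc (length U)" Ss] Cons.prems by simp
  next
    case 4
    then show ?thesis using Cons.IH[OF 4] Cons.prems by blast
  qed simp
qed simp

lemma placed_cover: "m \<le> v \<Longrightarrow> v < m + stars_size Ss \<Longrightarrow> \<exists>a S j. (a, S) \<in> set (placed m Ss) \<and> j \<le> length S \<and> v = a + j"
proof (induction Ss arbitrary: m)
  case (Cons S Ss)
  show ?case
  proof (cases "v < m + Suc (length S)")
    case True
    then show ?thesis using Cons.prems by (intro exI[of _ m] exI[of _ S] exI[of _ "v - m"]) auto
  next
    case False
    then have "m + Suc (length S) \<le> v" "v < m + Suc (length S) + stars_size Ss"
      using Cons.prems by auto
    then show ?thesis using Cons.IH[of "m + Suc (length S)"] by (metis list.set_intros(2) placed.simps(2))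
  qed
qed simp

lemma link_edges_range:
  "(u, v) \<in> set (link_edges a c S) \<Longrightarrow> (v = a \<and> u \<in> set S) \<or> (c \<le> v \<and> v < c + length S \<and> (u = a \<or> u \<in> set S))"
  by (auto simp: set_link_edges link_edge_set_def dest: star_links_bounds)

lemma distinct_link_edges:
  "distinct S \<Longrightarrow> \<forall>l\<in>set S. l < a \<Longrightarrow> a < c \<Longrightarrow> distinct (link_edges a c S)"
proof (induction S arbitrary: c)
  case (Cons l S)
  then have "distinct (link_edges a (Suc c) S)" by simp
  moreover have "(l, a) \<notin> set (link_edges a (Suc c) S)"
    using link_edges_range[of l a a "Suc c" S] Cons.prems by force
  moreover have "(u, c) \<notin> set (link_edges a (Suc c) S)" for u
    using link_edges_range[of u c a "Suc c" S] Cons.prems(3) by linarith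
  moreover have "l \<noteq> a" "a \<noteq> c" "l \<noteq> c" using Cons.prems by auto
  ultimately show ?case by simp
qed simp

text \<open>The larger end of an edge lies in the interval of the star to which the edge belongs, so
  only edges of the same star could coincide.\<close>

lemma distinct_stars_edges:
  "\<forall>(a, S)\<in>set (placed m Ss). distinct S \<and> (\<forall>l\<in>set S. 0 < l \<and> l < a) \<Longrightarrow> distinct (stars_edges m Ss)"
proof (induction Ss arbitrary: m)
  case (Cons S Ss)
  have S: "distinct S" "\<forall>l\<in>set S. 0 < l \<and> l < m" using Cons.prems by auto
  have "(0, m) \<notin> set (link_edges m (Suc m) S)"
    using link_edges_range[of 0 m m "Suc m" S] S by auto
  then have "distinct (star_edges m S)"
    using S by (auto simp: star_edges_def intro!: distinct_link_edges)
  moreover have "m + Suc (length S) \<le> v" if "(u, v) \<in> set (stars_edges (m + Suc (length S)) Ss)" for u v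
    using that placed_bounds[of _ _ "m + Suc (length S)" Ss] stars_links_bounds[of _ _ _ "m + Suc (length S)" Ss]
    unfolding set_stars_edges link_edge_set_def by fastforce
  moreover have "v < m + Suc (length S)" if "(u, v) \<in> set (star_edges m S)" for u v
    using that link_edges_range[of u v m "Suc m" S] by (auto simp: star_edges_def)
  ultimately show ?case using Cons by fastforce
qed simp

lemma card_star_links: "card (star_links a c S) = length S"
  unfolding star_links_def by (subst card_image) (auto simp: inj_on_def)

lemma finite_stars_links [simp]: "finite (stars_links m Ss)"
  by (auto simp: stars_links_def star_links_def)

lemma card_stars_links: "card (stars_links m Ss) = (\<Sum>S\<leftarrow>Ss. length S)"
proof (induction Ss arbitrary: m)
  case (Cons S Ss)
  have "star_links m (Suc m) S \<inter> stars_links (m + Suc (length S)) Ss = {}"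
    using star_links_bounds stars_links_bounds by fastforce
  moreover have "finite (star_links m (Suc m) S)" by (simp add: star_links_def)
  ultimately show ?case using Cons by (simp add: card_Un_disjoint card_star_links)
qed simp

lemma card_out_links: "card {(b, c). (l, b, c) \<in> stars_links m Ss} \<le> occ l Ss"
proof -
  have star: "finite {p. (l, p) \<in> star_links a c' S} \<and>
      card {p. (l, p) \<in> star_links a c' S} \<le> count_list S l" for a c' S
  proof (induction S arbitrary: c')
    case (Cons k S)
    have "{p. (l, p) \<in> star_links a c' (k # S)} =
        (if l = k then {(a, c')} else {}) \<union> {p. (l, p) \<in> star_links a (Suc c') S}" by auto
    then show ?case using Cons[of "Suc c'"] by (auto simp: card_insert_if)
  qed simp
  have "card {p. (l, p) \<in> stars_links m Ss} \<le> occ l Ss"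
  proof (induction Ss arbitrary: m)
    case (Cons S Ss)
    let ?A = "{p. (l, p) \<in> star_links m (Suc m) S}"
    let ?B = "{p. (l, p) \<in> stars_links (m + Suc (length S)) Ss}"
    have "{p. (l, p) \<in> stars_links m (S # Ss)} = ?A \<union> ?B" by auto
    then show ?case
      using card_Un_le[of ?A ?B] star[of m "Suc m" S] Cons[of "m + Suc (length S)"]
      by (simp only: occ_simps) linarith
  qed simp
  moreover have "{(b, c). (l, b, c) \<in> stars_links m Ss} = {p. (l, p) \<in> stars_links m Ss}" by auto
  ultimately show ?thesis by simp
qed

lemma card_in_links:
  assumes "\<forall>S\<in>set Ss. length S \<le> w"
  shows "card {(l, c). (l, a, c) \<in> stars_links m Ss} \<le> w"
proof (cases "\<exists>S. (a, S) \<in> set (placed m Ss)")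
  case True
  then obtain S where S: "(a, S) \<in> set (placed m Ss)" by blast
  have "{(l, c). (l, a, c) \<in> stars_links m Ss} \<subseteq> (\<lambda>j. (S ! j, Suc a + j)) ` {..<length S}"
    using placed_disjoint[OF S, of a _ 0 0] by (auto simp: stars_links_iff)
  then have "card {(l, c). (l, a, c) \<in> stars_links m Ss} \<le> card ((\<lambda>j. (S ! j, Suc a + j)) ` {..<length S})"
    by (intro card_mono) auto
  also have "\<dots> \<le> length S" using card_image_le[of "{..<length S}"] by simp
  also have "\<dots> \<le> w" using assms placed_bounds[OF S] by auto
  finally show ?thesis .
next
  case False
  then have "{(l, c). (l, a, c) \<in> stars_links m Ss} = {}" by (auto simp: stars_links_iff)
  then show ?thesis by simp
qed

section \<open>The stars of the variables\<close>

lemma varstars_Suc: "varstars (Suc V) = varstars V @ [[], [6 * V + 1], [6 * V + 1, 6 * V + 2]]"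
  by (simp add: varstars_def)

lemma varstars_0 [simp]: "varstars 0 = []" by (simp add: varstars_def)

lemma stars_size_varstars [simp]: "stars_size (varstars V) = 6 * V"
  by (induction V) (auto simp: varstars_Suc)

lemma budget_varstars: "budget (varstars V) = 2 * (\<Sum>S\<leftarrow>varstars V. length S) + V"
  by (induction V) (auto simp: varstars_Suc)

lemma placed_varstars:
  "set (placed (Suc 0) (varstars V)) =
    (\<Union>k<V. {(6 * k + 1, []), (6 * k + 2, [6 * k + 1]), (6 * k + 4, [6 * k + 1, 6 * k + 2])})"
  (is "_ = (\<Union>k<V. ?f k)")
proof (induction V)
  case (Suc V)
  have "set (placed (Suc (6 * V)) [[], [6 * V + 1], [6 * V + 1, 6 * V + 2]]) = ?f V"
    by (simp add: numeral_eq_Suc)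
  moreover have "(\<Union>k<Suc V. ?f k) = (\<Union>k<V. ?f k) \<union> ?f V"
    unfolding lessThan_Suc by blast
  ultimately show ?case unfolding varstars_Suc placed_append set_append Suc by simp
qed simp

lemma stars_links_varstars: "stars_links (Suc 0) (varstars V) = var_links V"
proof (induction V)
  case (Suc V)
  have "var_links (Suc V) = var_links V \<union> {(6 * V + 1, 6 * V + 2, 6 * V + 3),
      (6 * V + 1, 6 * V + 4, 6 * V + 5), (6 * V + 2, 6 * V + 4, 6 * V + 6)}"
    unfolding var_links_def lessThan_Suc by blast
  moreover have "stars_links (Suc (6 * V)) [[], [6 * V + 1], [6 * V + 1, 6 * V + 2]] =
      {(6 * V + 1, 6 * V + 2, 6 * V + 3), (6 * V + 1, 6 * V + 4, 6 * V + 5), (6 * V + 2, 6 * V + 4, 6 * V + 6)}"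
    by (simp add: numeral_eq_Suc insert_commute)
  ultimately show ?case unfolding varstars_Suc stars_links_append Suc by simp
qed (simp add: var_links_def)

lemma occ_varstars: "occ l (varstars V) \<le> (if l < 6 * V + 1 then 2 else 0)"
  by (induction V) (auto simp: varstars_Suc split: if_splits)

lemma map_of_map_keys_const: "map_of (map (\<lambda>e. (e, c)) xs) = (\<lambda>e. if e \<in> set xs then Some c else None)"
  by (induction xs) auto

section \<open>The spanner instance of a list of clauses\<close>

locale clause_list =
  fixes V :: nat and Cs :: "nat list list"
  assumes clauses: "S \<in> set Cs \<Longrightarrow> S \<noteq> [] \<and> distinct S \<and> set S \<subseteq> literals V"
begin

definition "stars = varstars V @ Cs"
abbreviation "I \<equiv> stars_instance stars"
definition "Cl = fst ` set (placed (Suc (6 * V)) Cs)"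
definition "CL = stars_links (Suc (6 * V)) Cs"

lemma literals_bounds: "l \<in> literals V \<Longrightarrow> 0 < l \<and> l < 6 * V"
  by (auto simp: literals_def)

sublocale formula_graph V Cl CL
proof
  show "finite Cl" "finite CL" by (auto simp: Cl_def CL_def)
  show "6 * V < u" if "u \<in> Cl" for u
    using that placed_bounds by (fastforce simp: Cl_def)
  fix l a c assume L: "(l, a, c) \<in> CL"
  then obtain S j where S: "(a, S) \<in> set (placed (Suc (6 * V)) Cs)" "j < length S" "l = S ! j" "c = Suc a + j"
    by (auto simp: CL_def stars_links_iff)
  then show "l \<in> literals V" "a \<in> Cl" "a < c"
    using clauses[of S] placed_bounds[OF S(1)] by (auto simp: Cl_def image_iff intro!: bexI[of _ "(a, S)"])
  show "c \<notin> Cl"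
    using placed_disjoint[OF S(1), of _ _ "Suc j" 0] S(2,4) by (fastforce simp: Cl_def)
  show "l = l' \<and> a = a'" if "(l', a', c) \<in> CL" for l' a'
  proof -
    from that obtain S' j' where S': "(a', S') \<in> set (placed (Suc (6 * V)) Cs)" "j' < length S'"
      "l' = S' ! j'" "c = Suc a' + j'"
      by (auto simp: CL_def stars_links_iff)
    then have "a = a' \<and> S = S'" using placed_disjoint[OF S(1) S'(1), of "Suc j" "Suc j'"] S by simp
    then show ?thesis using S S' by auto
  qed
  show "c = c'" if "(l, a, c') \<in> CL" for c'
  proof -
    from that obtain S' j' where S': "(a, S') \<in> set (placed (Suc (6 * V)) Cs)" "j' < length S'"
      "l = S' ! j'" "c' = Suc a + j'"
      by (auto simp: CL_def stars_links_iff)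
    then have "S = S'" using placed_disjoint[OF S(1) S'(1), of 0 0] by simp
    moreover have "distinct S" using clauses[of S] placed_bounds[OF S(1)] by auto
    ultimately show ?thesis using S S' nth_eq_iff_index_eq by metis
  qed
qed

lemma Lk_eq: "stars_links (Suc 0) stars = Lk"
  by (simp add: stars_def stars_links_append Lk_def stars_links_varstars flip: CL_def)

lemma A_eq: "fst ` set (placed (Suc 0) stars) = A"
  unfolding stars_def placed_append set_append image_Un placed_varstars A_def stars_size_varstars
  by (simp add: image_UN flip: Cl_def)

lemma set_edges: "(u, v) \<in> set (stars_edges (Suc 0) stars) \<longleftrightarrow> ed u v"
proof -
  have "(u, v) \<in> (\<lambda>(a, S). (0, a)) ` set (placed (Suc 0) stars) \<longleftrightarrow> u = 0 \<and> v \<in> A"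
    unfolding A_eq[symmetric] by force
  then show ?thesis unfolding set_stars_edges Lk_eq by (simp add: ed_def link_edge_set_def)
qed

lemma edges_graph: "edges (graph_of I) = E"
proof -
  have "(u, v) \<in> fst ` set (edge_list I) \<longleftrightarrow> ed u v" for u v
    by (simp add: stars_instance_def image_image flip: set_edges)
  then show ?thesis by (simp add: E_def graph_of_def)
qed

lemma verts_graph: "verts (graph_of I) = {..stars_size stars}"
  by (auto simp: graph_of_def stars_instance_def)

lemma edge_labels:
  assumes "e \<in> E" shows "weight (graph_of I) e = 1" "len (graph_of I) e = 1"
proof -
  obtain u v where uv: "e = {u, v}" "ed u v" using assms by (auto simp: E_def)
  then have "Min e = u" "Max e = v" using ed_less[of u v] by (auto simp: min_def max_def)
  moreover have "map_of (edge_list I) (u, v) = Some (1, 1)"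
    using uv(2) set_edges[of u v] by (auto simp: stars_instance_def map_of_map_keys_const)
  ultimately show "weight (graph_of I) e = 1" "len (graph_of I) e = 1"
    by (simp_all add: graph_of_def)
qed

lemma ed_bound: assumes "ed u v" shows "v \<le> stars_size stars"
proof -
  have "(u, v) \<in> set (stars_edges (Suc 0) stars)" using assms set_edges by blast
  then show ?thesis
    using placed_bounds[of _ _ "Suc 0" stars] stars_links_bounds[of _ _ _ "Suc 0" stars]
    unfolding set_stars_edges link_edge_set_def by fastforce
qed

lemma loopfree: "loopfree (graph_of I)"
  unfolding loopfree_def edges_graph verts_graph E_def using ed_less ed_bound
  by (auto; metis less_irrefl less_imp_le order_trans)

lemma unit: "unit_graph (graph_of I)"
  by (simp add: unit_graph_def edges_graph edge_labels)

lemma path_from_zero: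
  assumes "v \<le> stars_size stars"
  shows "\<exists>p. p \<noteq> [] \<and> hd p = 0 \<and> last p = v \<and> path_edges p \<subseteq> E"
proof (cases "v = 0")
  case True
  then show ?thesis by (intro exI[of _ "[0]"]) simp
next
  case False
  then obtain a S j where a: "(a, S) \<in> set (placed (Suc 0) stars)" "j \<le> length S" "v = a + j"
    using placed_cover[of "Suc 0" v stars] assms by auto
  then have aA: "a \<in> A" unfolding A_eq[symmetric] by force
  show ?thesis
  proof (cases j)
    case 0
    then show ?thesis using a aA by (intro exI[of _ "[0, a]"]) (simp add: E_zero)
  next
    case (Suc i)
    then have "(S ! i, a, v) \<in> Lk" using a unfolding Lk_eq[symmetric] stars_links_iff by auto
    then show ?thesis using aA E_link by (intro exI[of _ "[0, a, v]"]) (auto simp: E_zero)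
  qed
qed

lemma path_edges_rev: "path_edges (rev p) = path_edges p"
proof (induction p)
  case (Cons x p)
  then show ?case
    by (cases "p = []") (auto simp: path_edges_append path_edges_Cons last_rev insert_commute)
qed simp

lemma set_path_verts:
  assumes "path_edges p \<subseteq> E" "p \<noteq> []" "hd p \<le> stars_size stars"
  shows "set p \<subseteq> verts (graph_of I)"
  using assms
proof (induction p rule: induct_list012)
  case (3 x y p)
  then have "y \<in> verts (graph_of I)" using loopfreeD[OF loopfree, of x y] by (simp add: edges_graph)
  then show ?case using 3 by (simp add: verts_graph)
qed (auto simp: verts_graph)

text \<open>Every vertex is at most two steps away from the hub; the walk through the hub is
  shortened to a simple path.\<close>

lemma connected: "connected_graph (graph_of I)"
  unfolding connected_graph_def
proof (intro conjI ballI)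
  fix u v assume "u \<in> verts (graph_of I)" "v \<in> verts (graph_of I)"
  then have uv: "u \<le> stars_size stars" "v \<le> stars_size stars" by (auto simp: verts_graph)
  obtain p where p: "p \<noteq> []" "hd p = 0" "last p = u" "path_edges p \<subseteq> E" using path_from_zero[OF uv(1)] by blast
  obtain q where q: "q \<noteq> []" "hd q = 0" "last q = v" "path_edges q \<subseteq> E" using path_from_zero[OF uv(2)] by blast
  define r where "r = rev p @ tl q"
  have r: "r \<noteq> []" "hd r = u" using p by (auto simp: r_def hd_append hd_rev)
  have "last r = v"
  proof (cases "tl q = []")
    case True
    then have "q = [0]" using q by (metis hd_Cons_tl)
    then show ?thesis using p q True by (simp add: r_def last_rev)
  next
    case False
    then show ?thesis using q by (simp add: r_def last_tl)
  qed
  note r = r this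
  have "path_edges r \<subseteq> E"
  proof (cases "tl q = []")
    case False
    then obtain y ys where "q = 0 # y # ys" using q by (metis hd_Cons_tl)
    then show ?thesis using p q by (auto simp: r_def path_edges_append path_edges_rev last_rev)
  qed (use p in \<open>auto simp: r_def path_edges_rev\<close>)
  from walk_imp_path[OF r(1) this] obtain r' where r': "r' \<noteq> []" "hd r' = u" "last r' = v" "distinct r'"
      "path_edges r' \<subseteq> E" using r by auto
  then have "simple_path (graph_of I) u v r'"
    using set_path_verts[of r'] uv by (auto simp: simple_path_def edges_graph)
  then show "\<exists>p. simple_path (graph_of I) u v p" by blast
qed (auto simp: verts_graph)

lemma placed_ok: "\<forall>(a, S)\<in>set (placed (Suc 0) stars). distinct S \<and> (\<forall>l\<in>set S. 0 < l \<and> l < a)"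
proof -
  have "distinct S \<and> (\<forall>l\<in>set S. 0 < l \<and> l < a)" if "(a, S) \<in> set (placed (Suc (6 * V)) Cs)" for a S
    using placed_bounds[OF that] clauses[of S] literals_bounds by fastforce
  moreover have "distinct S \<and> (\<forall>l\<in>set S. 0 < l \<and> l < a)" if "(a, S) \<in> set (placed (Suc 0) (varstars V))" for a S
    using that unfolding placed_varstars by auto
  ultimately show ?thesis by (auto simp: stars_def placed_append)
qed

theorem instance_ok: "I \<in> spanner_instances" "basic_instance I" "stretch I = 2"
proof -
  have "map fst (edge_list I) = stars_edges (Suc 0) stars" by (simp add: stars_instance_def comp_def)
  moreover have "u < v \<and> v < nverts I \<and> l \<ge> 1" if "((u, v), (w, l)) \<in> set (edge_list I)" for u v w l
  proof -
    have "ed u v" "l = 1" using that set_edges[of u v] by (auto simp: stars_instance_def)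
    then show ?thesis using ed_less ed_bound by (fastforce simp: stars_instance_def)
  qed
  ultimately show "I \<in> spanner_instances"
    using distinct_stars_edges[OF placed_ok] connected
    by (fastforce simp: spanner_instances_def stars_instance_def)
  show "basic_instance I" by (simp add: basic_instance_def edges_graph edge_labels)
qed (simp add: stars_instance_def)

text \<open>Clauses are nonempty, so only the empty stars of the variables contribute the summand
  \<open>V\<close>.\<close>

lemma budget_eq: "budget stars = 2 * card Lk + V"
proof -
  have "budget Cs = 2 * (\<Sum>S\<leftarrow>Cs. length S)"
    using clauses by (induction Cs) auto
  then show ?thesis unfolding Lk_eq[symmetric] card_stars_links by (simp add: stars_def budget_varstars)
qed

theorem yes_iff: "I \<in> spanner_yes \<longleftrightarrow> (\<exists>x. \<forall>S\<in>set Cs. \<exists>l\<in>set S. lit_true x l)"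
proof -
  have W: "(\<Sum>e\<in>F. weight (graph_of I) e) = card F" if "F \<subseteq> E" for F
    using that edge_labels by (simp add: subset_iff)
  have sp: "is_spanner (graph_of I) (stretch I) F \<longleftrightarrow> F \<subseteq> E \<and> (\<forall>u v. {u, v} \<in> E \<longrightarrow> spanned2 F u v)" for F
    unfolding instance_ok(3) is_spanner_iff_spanned2[OF unit loopfree] edges_graph ..
  have wb: "wbound I = budget stars" by (simp add: stars_instance_def)
  have "I \<in> spanner_yes \<longleftrightarrow> (\<exists>F\<subseteq>E. (\<forall>u v. {u, v} \<in> E \<longrightarrow> spanned2 F u v) \<and> card F \<le> 2 * card Lk + V)"
  proof -
    have "is_spanner (graph_of I) (stretch I) F \<and> (\<Sum>e\<in>F. weight (graph_of I) e) \<le> wbound I \<longleftrightarrow>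
        F \<subseteq> E \<and> (\<forall>u v. {u, v} \<in> E \<longrightarrow> spanned2 F u v) \<and> card F \<le> 2 * card Lk + V" for F
      unfolding sp wb budget_eq by (cases "F \<subseteq> E") (simp_all only: W simp_thms)
    then show ?thesis using instance_ok(1) by (simp add: spanner_yes_def)
  qed
  also have "\<dots> \<longleftrightarrow> (\<exists>x. \<forall>S\<in>set Cs. \<exists>l\<in>set S. lit_true x l)"
  proof
    assume "\<exists>F\<subseteq>E. (\<forall>u v. {u, v} \<in> E \<longrightarrow> spanned2 F u v) \<and> card F \<le> 2 * card Lk + V"
    then obtain F where F: "F \<subseteq> E" "\<And>u v. {u, v} \<in> E \<Longrightarrow> spanned2 F u v" "card F \<le> 2 * card Lk + V" by blast
    have "\<exists>l\<in>set S. lit_true (\<lambda>k. {0, 6 * k + 1} \<in> F) l" if "S \<in> set Cs" for S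
    proof -
      have "S \<in> snd ` set (placed m Cs)" for m
        using that by (induction Cs arbitrary: m) auto
      then obtain a where a: "(a, S) \<in> set (placed (Suc (6 * V)) Cs)" by force
      then have "a \<in> Cl" by (force simp: Cl_def)
      from spanner_imp_sat[OF F this] obtain l c where l: "(l, a, c) \<in> CL" "lit_true (\<lambda>k. {0, 6 * k + 1} \<in> F) l"
        by blast
      then have "l \<in> set S"
        using placed_disjoint[OF a, of a _ 0 0] by (auto simp: CL_def stars_links_iff)
      with l show ?thesis by blast
    qed
    then show "\<exists>x. \<forall>S\<in>set Cs. \<exists>l\<in>set S. lit_true x l" by blast
  next
    assume "\<exists>x. \<forall>S\<in>set Cs. \<exists>l\<in>set S. lit_true x l"
    then obtain x where x: "\<And>S. S \<in> set Cs \<Longrightarrow> \<exists>l\<in>set S. lit_true x l" by blast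
    have "\<exists>l c. (l, u, c) \<in> CL \<and> lit_true x l" if "u \<in> Cl" for u
    proof -
      obtain S where S: "(u, S) \<in> set (placed (Suc (6 * V)) Cs)" using \<open>u \<in> Cl\<close> by (auto simp: Cl_def)
      then obtain j where "j < length S" "lit_true x (S ! j)"
        using x[of S] placed_bounds[OF S] by (auto simp: in_set_conv_nth)
      then show ?thesis using S unfolding CL_def stars_links_iff by blast
    qed
    from sat_imp_spanner[OF this]
    show "\<exists>F\<subseteq>E. (\<forall>u v. {u, v} \<in> E \<longrightarrow> spanned2 F u v) \<and> card F \<le> 2 * card Lk + V" by blast
  qed
  finally show ?thesis .
qed

text \<open>A vertex of \<open>A\<close> has the hub and two neighbours per link. It is the clause
  end of at most \<open>w + 2\<close> links and the literal end of at most \<open>k + 2\<close>: the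
  stars of the variables have length at most 2 and contain each literal at most twice. So
  \<open>d\<close> is 1 + 2 * (w + 2) + 2 * (k + 2).\<close>

theorem params_le:
  assumes w: "\<And>S. S \<in> set Cs \<Longrightarrow> length S \<le> w" and k: "\<And>l. occ l Cs \<le> k"
  defines "d \<equiv> 9 + 2 * w + 2 * k"
  shows "breadth_param I \<le> 2 * d + 2" "size_param I \<le> 2 * d + 2" "nbhd_param I \<le> 2 * d + 2"
proof -
  have len: "length S \<le> w + 2" if "S \<in> set stars" for S
  proof (cases "S \<in> set Cs")
    case True
    then show ?thesis using w[of S] by simp
  next
    case False
    then have "S \<in> set (varstars V)" using that by (simp add: stars_def)
    then show ?thesis by (auto simp: varstars_def split: if_splits)
  qed
  have deg: "1 + 2 * card {(l, c). (l, a, c) \<in> Lk} + 2 * card {(b, c). (a, b, c) \<in> Lk} \<le> d" for a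
  proof -
    have "card {(l, c). (l, a, c) \<in> Lk} \<le> w + 2"
      unfolding Lk_eq[symmetric] by (rule card_in_links) (use len in blast)
    moreover have "card {(b, c). (a, b, c) \<in> Lk} \<le> occ a stars"
      unfolding Lk_eq[symmetric] by (rule card_out_links)
    moreover have "occ a stars \<le> 2 + k" using occ_varstars[of a V] k[of a] by (simp add: stars_def split: if_splits)
    ultimately show ?thesis by (simp add: d_def)
  qed
  have "2 \<le> d" by (simp add: d_def)
  have cn: "finite {w. {u, w} \<in> edges (graph_of I) \<and> {w, v} \<in> edges (graph_of I)} \<and>
      card {w. {u, w} \<in> edges (graph_of I) \<and> {w, v} \<in> edges (graph_of I)} \<le> d"
    if "{u, v} \<in> edges (graph_of I)" for u v
    using common_neighbours[of u v d] that \<open>2 \<le> d\<close> deg by (simp add: edges_graph)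
  show "breadth_param I \<le> 2 * d + 2" "size_param I \<le> 2 * d + 2" "nbhd_param I \<le> 2 * d + 2"
    unfolding breadth_param_def size_param_def nbhd_param_def instance_ok(3)
    using bundle_params_le[OF unit loopfree cn] by auto
qed

end

section \<open>Counter programs\<close>

text \<open>
  A program works on counters, a two-way input head and a write-only output. Compiled to a Turing
  machine, each counter becomes a tape whose head position is the value of the counter; only
  cell 0 of such a tape is marked.
\<close>

datatype com = Skip | Inc nat | Out bool | InL | InR | Seq com com (infixr \<open>;;\<close> 60)
  | IfZ nat com com | For nat com | CaseIn com com com | Scan nat

record st =
  reg :: "nat \<Rightarrow> nat"
  ipos :: int
  outp :: "bool list"

abbreviation upd_reg :: "st \<Rightarrow> nat \<Rightarrow> nat \<Rightarrow> st" where
  "upd_reg s v n \<equiv> s\<lparr>reg := (reg s)(v := n)\<rparr>"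

text \<open>
  \<open>B\<close> bounds the counters, which makes the running time polynomial in \<open>B\<close>. The body of
  a loop over \<open>v\<close> sees the decremented counter and has to leave it unchanged.
\<close>

inductive exec :: "bool list \<Rightarrow> nat \<Rightarrow> com \<Rightarrow> st \<Rightarrow> nat \<Rightarrow> st \<Rightarrow> bool" for x B where
  Skip: "exec x B Skip s 0 s"
| Inc: "reg s v < B \<Longrightarrow> exec x B (Inc v) s 1 (upd_reg s v (Suc (reg s v)))"
| Out: "exec x B (Out b) s 1 (s\<lparr>outp := outp s @ [b]\<rparr>)"
| InL: "exec x B InL s 1 (s\<lparr>ipos := ipos s - 1\<rparr>)"
| InR: "exec x B InR s 1 (s\<lparr>ipos := ipos s + 1\<rparr>)"
| Seq: "exec x B c s t s' \<Longrightarrow> exec x B d s' t' s'' \<Longrightarrow> exec x B (c ;; d) s (t + t') s''"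
| IfZ_zero: "reg s v = 0 \<Longrightarrow> exec x B c s t s' \<Longrightarrow> exec x B (IfZ v c d) s (t + 2) s'"
| IfZ_pos: "reg s v \<noteq> 0 \<Longrightarrow> exec x B d s t s' \<Longrightarrow> exec x B (IfZ v c d) s (t + 1) s'"
| For_zero: "reg s v = 0 \<Longrightarrow> exec x B (For v c) s 1 s"
| For_Suc: "reg s v = Suc n \<Longrightarrow> exec x B c (upd_reg s v n) t s' \<Longrightarrow> reg s' v = n \<Longrightarrow>
    exec x B (For v c) s' t' s'' \<Longrightarrow> exec x B (For v c) s (t + 2 + t') s''"
| CaseIn_0: "inscription x (ipos s) = 0 \<Longrightarrow> exec x B c0 s t s' \<Longrightarrow> exec x B (CaseIn c0 c1 c2) s (t + 2) s'"
| CaseIn_1: "inscription x (ipos s) = 1 \<Longrightarrow> exec x B c1 s t s' \<Longrightarrow> exec x B (CaseIn c0 c1 c2) s (t + 2) s'"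
| CaseIn_2: "inscription x (ipos s) = 2 \<Longrightarrow> exec x B c2 s t s' \<Longrightarrow> exec x B (CaseIn c0 c1 c2) s (t + 1) s'"
| Scan: "(\<And>i. i < n \<Longrightarrow> inscription x (ipos s + int i) \<noteq> 0) \<Longrightarrow> inscription x (ipos s + int n) = 0 \<Longrightarrow>
    reg s v + n \<le> B \<Longrightarrow>
    exec x B (Scan v) s (2 * n + 1) (s\<lparr>reg := (reg s)(v := reg s v + n), ipos := ipos s + int n\<rparr>)"

fun time_poly :: "com \<Rightarrow> nat poly" where
  "time_poly Skip = 0"
| "time_poly (c ;; d) = time_poly c + time_poly d"
| "time_poly (IfZ v c d) = 2 + time_poly c + time_poly d"
| "time_poly (For v c) = [:0, 1:] * (time_poly c + 2) + 1"
| "time_poly (CaseIn c d e) = 2 + time_poly c + time_poly d + time_poly e"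
| "time_poly (Scan v) = 2 * [:0, 1:] + 1"
| "time_poly _ = 1"

text \<open>A loop is unfolded with a decreasing counter, so the induction needs a bound in terms of
  the current value of the counter; the polynomial in \<open>B\<close> follows from it.\<close>

lemma exec_time:
  assumes "exec x B c s t s'" "\<And>v. reg s v \<le> B"
  shows "t \<le> poly (time_poly c) B" "reg s' v \<le> B"
proof -
  have "(\<forall>v. reg s v \<le> B) \<longrightarrow> (t \<le> poly (time_poly c) B \<and> (\<forall>v. reg s' v \<le> B) \<and>
      (\<forall>v d. c = For v d \<longrightarrow> t \<le> reg s v * (poly (time_poly d) B + 2) + 1))"
    using assms(1)
  proof (induction rule: exec.induct)
    case (For_Suc s v n c t s' t' s'')
    show ?case
    proof
      assume a: "\<forall>v. reg s v \<le> B"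
      then have n: "Suc n \<le> B" using For_Suc by metis
      have 1: "t \<le> poly (time_poly c) B" "\<forall>v. reg s' v \<le> B" using For_Suc a n by auto
      then have 2: "\<forall>v. reg s'' v \<le> B" "t' \<le> n * (poly (time_poly c) B + 2) + 1" using For_Suc by auto
      have 3: "t + 2 + t' \<le> Suc n * (poly (time_poly c) B + 2) + 1" using 1 2 by simp
      also have "\<dots> \<le> B * (poly (time_poly c) B + 2) + 1" using n mult_le_mono1 add_le_mono1 by blast
      finally show "t + 2 + t' \<le> poly (time_poly (For v c)) B \<and> (\<forall>v. reg s'' v \<le> B) \<and>
        (\<forall>va d. For v c = For va d \<longrightarrow> t + 2 + t' \<le> reg s va * (poly (time_poly d) B + 2) + 1)"
        using 2 3 For_Suc.hyps(1) by auto
    qed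
  qed auto
  with assms(2) show "t \<le> poly (time_poly c) B" "reg s' v \<le> B" by auto
qed

fun clen :: "com \<Rightarrow> nat" where
  "clen Skip = 0"
| "clen (c ;; d) = clen c + clen d"
| "clen (IfZ v c d) = 2 + clen c + clen d"
| "clen (For v c) = 2 + clen c"
| "clen (CaseIn c d e) = 3 + clen c + clen d + clen e"
| "clen (Scan v) = 2"
| "clen _ = 1"

fun vars_below :: "nat \<Rightarrow> com \<Rightarrow> bool" where
  "vars_below n (Inc v) = (v < n)"
| "vars_below n (c ;; d) = (vars_below n c \<and> vars_below n d)"
| "vars_below n (IfZ v c d) = (v < n \<and> vars_below n c \<and> vars_below n d)"
| "vars_below n (For v c) = (v < n \<and> vars_below n c)"
| "vars_below n (CaseIn c d e) = (vars_below n c \<and> vars_below n d \<and> vars_below n e)"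
| "vars_below n (Scan v) = (v < n)"
| "vars_below n _ = True"

section \<open>Compilation to a Turing machine\<close>

definition keep :: "nat list \<Rightarrow> (nat \<times> move) list" where
  "keep rs = map (\<lambda>r. (r, Stay)) rs"

definition on_tape :: "nat list \<Rightarrow> nat \<Rightarrow> nat \<times> move \<Rightarrow> (nat \<times> move) list" where
  "on_tape rs j a = (keep rs)[j := a]"

text \<open>\<open>instr n c p q\<close> is the instruction at address \<open>q\<close> of the code of \<open>c\<close> placed at address \<open>p\<close>.\<close>

fun instr :: "nat \<Rightarrow> com \<Rightarrow> nat \<Rightarrow> nat \<Rightarrow> nat list \<Rightarrow> nat \<times> (nat \<times> move) list" where
  "instr n Skip p q rs = (p, keep rs)"
| "instr n (Inc v) p q rs = (Suc p, on_tape rs (Suc v) (rs ! Suc v, MoveR))"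
| "instr n (Out b) p q rs = (Suc p, on_tape rs (Suc n) (bit_sym b, MoveR))"
| "instr n InL p q rs = (Suc p, on_tape rs 0 (rs ! 0, MoveL))"
| "instr n InR p q rs = (Suc p, on_tape rs 0 (rs ! 0, MoveR))"
| "instr n (c ;; d) p q rs = (if q < p + clen c then instr n c p q rs else instr n d (p + clen c) q rs)"
| "instr n (IfZ v c d) p q rs =
    (if q = p then (if rs ! Suc v = 1 then p + 1 else p + 2 + clen c, keep rs)
     else if q < p + 1 + clen c then instr n c (p + 1) q rs
     else if q = p + 1 + clen c then (p + 2 + clen c + clen d, keep rs)
     else instr n d (p + 2 + clen c) q rs)"
| "instr n (For v c) p q rs =
    (if q = p then (if rs ! Suc v = 1 then (p + 2 + clen c, keep rs)
        else (p + 1, on_tape rs (Suc v) (rs ! Suc v, MoveL)))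
     else if q < p + 1 + clen c then instr n c (p + 1) q rs
     else (p, keep rs))"
| "instr n (CaseIn c d e) p q rs =
    (if q = p then (if rs ! 0 = 0 then p + 1 else if rs ! 0 = 1 then p + 2 + clen c
        else p + 3 + clen c + clen d, keep rs)
     else if q < p + 1 + clen c then instr n c (p + 1) q rs
     else if q = p + 1 + clen c then (p + 3 + clen c + clen d + clen e, keep rs)
     else if q < p + 2 + clen c + clen d then instr n d (p + 2 + clen c) q rs
     else if q = p + 2 + clen c + clen d then (p + 3 + clen c + clen d + clen e, keep rs)
     else instr n e (p + 3 + clen c + clen d) q rs)"
| "instr n (Scan v) p q rs =
    (if q = p then (if rs ! 0 = 0 then (p + 2, keep rs) else (p + 1, on_tape rs 0 (rs ! 0, MoveR)))
     else (p, on_tape rs (Suc v) (rs ! Suc v, MoveR)))"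

definition counter_tape :: "nat \<Rightarrow> tape" where
  "counter_tape k = ((\<lambda>i. if i = 0 then 1 else 0), int k)"

definition tapes :: "bool list \<Rightarrow> nat \<Rightarrow> st \<Rightarrow> tape list" where
  "tapes x n s = (inscription x, ipos s) # map (\<lambda>v. counter_tape (reg s v)) [0..<n] @
     [(inscription (outp s), int (length (outp s)))]"

text \<open>State 0 only marks cell 0 of every counter tape. The code starts at address 1, and the
  address behind its end is the halting state.\<close>

definition machine :: "nat \<Rightarrow> com \<Rightarrow> tm" where
  "machine n c = \<lparr>ntapes = n + 2, nsyms = 3, nstates = Suc (clen c),
     delta = (\<lambda>q rs. if q = 0 then (1, map (\<lambda>j. (if 1 \<le> j \<and> j \<le> n then 1 else rs ! j, Stay)) [0..<n + 2])
        else instr n c 1 q rs)\<rparr>"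

abbreviation reads :: "tape list \<Rightarrow> nat list" where
  "reads tps \<equiv> map (\<lambda>tp. fst tp (snd tp)) tps"

lemma act_keep [simp]: "map2 act tps (keep (reads tps)) = tps"
  by (rule nth_equalityI) (auto simp: keep_def act_def)

lemma act_on_tape [simp]:
  "j < length tps \<Longrightarrow> map2 act tps (on_tape (reads tps) j a) = tps[j := act (tps ! j) a]"
  by (rule nth_equalityI) (auto simp: keep_def act_def on_tape_def nth_list_update)

lemma length_tapes [simp]: "length (tapes x n s) = n + 2"
  by (simp add: tapes_def)

lemma counter_read: "fst (counter_tape k) (snd (counter_tape k)) = (if k = 0 then Suc 0 else 0)"
  by (simp add: counter_tape_def)

lemma tapes_upd_reg:
  "v < n \<Longrightarrow> tapes x n (upd_reg s v k) = (tapes x n s)[Suc v := counter_tape k]"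
  by (rule nth_equalityI) (auto simp: tapes_def nth_append nth_Cons nth_list_update split: nat.splits)

lemma act_counter:
  "act (counter_tape k) (if k = 0 then Suc 0 else 0, MoveR) = counter_tape (Suc k)"
  "act (counter_tape 0) (Suc 0, MoveR) = counter_tape (Suc 0)"
  "0 < k \<Longrightarrow> act (counter_tape k) (0, MoveR) = counter_tape (Suc k)"
  "act (counter_tape (Suc k)) (0, MoveL) = counter_tape k"
  by (auto simp: act_def counter_tape_def)

lemma act_head: "act (f, i) (f i, m) = (f, shift m i)"
  by (simp add: act_def)

lemma tapes_nth: "v < n \<Longrightarrow> tapes x n s ! Suc v = counter_tape (reg s v)"
  "tapes x n s ! 0 = (inscription x, ipos s)"
  "tapes x n s ! Suc n = (inscription (outp s), int (length (outp s)))"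
  by (auto simp: tapes_def nth_append)

lemma tapes_out:
  "tapes x n (s\<lparr>outp := outp s @ [b]\<rparr>) =
    (tapes x n s)[Suc n := act (tapes x n s ! Suc n) (bit_sym b, MoveR)]"
proof -
  have "inscription (outp s @ [b]) = (inscription (outp s))(int (length (outp s)) := bit_sym b)"
    by (auto simp: inscription_def nth_append fun_eq_iff)
  then show ?thesis
    by (auto simp: tapes_def list_update_append act_def nth_append)
qed

lemma tapes_ipos:
  "tapes x n (s\<lparr>ipos := i\<rparr>) = (tapes x n s)[0 := (inscription x, i)]"
  by (simp add: tapes_def)

context
  fixes n :: nat and M :: tm
begin

text \<open>Only the addresses of \<open>c\<close> are prescribed, so subprograms inherit the
  property. The bound by \<open>nstates M\<close> keeps all instructions away from the halting
  state, in which the machine would stop.\<close>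

definition has_code :: "com \<Rightarrow> nat \<Rightarrow> bool" where
  "has_code c p \<longleftrightarrow> vars_below n c \<and> p + clen c \<le> nstates M \<and>
    (\<forall>q rs. p \<le> q \<and> q < p + clen c \<longrightarrow> delta M q rs = instr n c p q rs)"

lemma step:
  assumes "has_code c p" "p \<le> q" "q < p + clen c"
  shows "tm_step M (q, tps) =
    (fst (instr n c p q (reads tps)), map2 act tps (snd (instr n c p q (reads tps))))"
  using assms by (auto simp: tm_step_def has_code_def split: prod.splits)

lemma has_code_Seq: "has_code (c ;; d) p \<Longrightarrow> has_code c p \<and> has_code d (p + clen c)"
  by (auto simp: has_code_def)

lemma has_code_IfZ: "has_code (IfZ v c d) p \<Longrightarrow> v < n \<and> has_code c (p + 1) \<and> has_code d (p + 2 + clen c)"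
  by (auto simp: has_code_def)

lemma has_code_For: "has_code (For v c) p \<Longrightarrow> v < n \<and> has_code c (p + 1)"
  by (auto simp: has_code_def)

lemma has_code_CaseIn: "has_code (CaseIn c d e) p \<Longrightarrow>
    has_code c (p + 1) \<and> has_code d (p + 2 + clen c) \<and> has_code e (p + 3 + clen c + clen d)"
  by (auto simp: has_code_def)

text \<open>The times in \<open>exec\<close> are exact step counts of the compiled code, including
  the jumps at the ends of branches, so the simulation is an equation.\<close>

lemma exec_simulation:
  "exec x B c s t s' \<Longrightarrow> has_code c p \<Longrightarrow>
    (tm_step M ^^ t) (p, tapes x n s) = (p + clen c, tapes x n s')"
proof (induction arbitrary: p rule: exec.induct)
  case (Inc s v)
  then have "v < n" by (simp add: has_code_def)
  then show ?case using step[OF Inc(2), of p "tapes x n s"]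
    by (simp add: tapes_upd_reg tapes_nth counter_read act_counter)
next
  case (Out b s)
  then show ?case using step[OF Out(1), of p "tapes x n s"] by (simp add: tapes_out)
next
  case (InL s)
  then show ?case using step[OF InL(1), of p "tapes x n s"] by (simp add: tapes_ipos tapes_nth act_head)
next
  case (InR s)
  then show ?case using step[OF InR(1), of p "tapes x n s"] by (simp add: tapes_ipos tapes_nth act_head)
next
  case (Seq c s t s' d t' s'')
  note h = has_code_Seq[OF Seq.prems]
  show ?case using Seq.IH(1)[of p] Seq.IH(2)[of "p + clen c"] h
    by (simp add: add.commute[of t] funpow_add add_ac)
next
  case (IfZ_zero s v c t s' d)
  note h = has_code_IfZ[OF IfZ_zero.prems]
  have 1: "tm_step M (p, tapes x n s) = (p + 1, tapes x n s)"
    using step[OF IfZ_zero.prems, of p "tapes x n s"] h IfZ_zero.hyps by (simp add: tapes_nth counter_read)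
  have 2: "tm_step M (p + 1 + clen c, tapes x n s') = (p + clen (IfZ v c d), tapes x n s')"
    using step[OF IfZ_zero.prems, of "p + 1 + clen c" "tapes x n s'"] by simp
  have "(tm_step M ^^ (t + 2)) (p, tapes x n s) = tm_step M ((tm_step M ^^ t) (tm_step M (p, tapes x n s)))"
    by (simp add: funpow_swap1)
  then show ?case using 1 2 IfZ_zero.IH[of "p + 1"] h by simp
next
  case (IfZ_pos s v d t s' c)
  note h = has_code_IfZ[OF IfZ_pos.prems]
  have 1: "tm_step M (p, tapes x n s) = (p + 2 + clen c, tapes x n s)"
    using step[OF IfZ_pos.prems, of p "tapes x n s"] h IfZ_pos.hyps by (simp add: tapes_nth counter_read)
  have "(tm_step M ^^ (t + 1)) (p, tapes x n s) = (tm_step M ^^ t) (tm_step M (p, tapes x n s))"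
    by (simp add: funpow_swap1)
  then show ?case using 1 IfZ_pos.IH[of "p + 2 + clen c"] h by simp
next
  case (For_zero s v c)
  note h = has_code_For[OF For_zero.prems]
  show ?case using step[OF For_zero.prems, of p "tapes x n s"] h For_zero.hyps by (simp add: tapes_nth counter_read)
next
  case (For_Suc s v k c t s' t' s'')
  note h = has_code_For[OF For_Suc.prems]
  have 1: "tm_step M (p, tapes x n s) = (p + 1, tapes x n (upd_reg s v k))"
    using step[OF For_Suc.prems, of p "tapes x n s"] h For_Suc.hyps(1)
    by (simp add: tapes_nth counter_read tapes_upd_reg act_counter)
  have 2: "tm_step M (p + 1 + clen c, tapes x n s') = (p, tapes x n s')"
    using step[OF For_Suc.prems, of "p + 1 + clen c" "tapes x n s'"] by simp
  have "(tm_step M ^^ (t + 2 + t')) (p, tapes x n s) =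
      (tm_step M ^^ t') (tm_step M ((tm_step M ^^ t) (tm_step M (p, tapes x n s))))"
  proof -
    have "t + 2 + t' = t' + (1 + (t + 1))" by simp
    then show ?thesis by (simp only: funpow_add comp_apply) (simp add: funpow_swap1)
  qed
  then show ?case using 1 2 For_Suc.IH(1)[of "p + 1"] For_Suc.IH(2)[OF For_Suc.prems] h by simp
next
  case (CaseIn_0 s c t s' d e)
  note h = has_code_CaseIn[OF CaseIn_0.prems]
  have 1: "tm_step M (p, tapes x n s) = (p + 1, tapes x n s)"
    using step[OF CaseIn_0.prems, of p "tapes x n s"] h CaseIn_0.hyps by (simp add: tapes_nth counter_read)
  have 2: "tm_step M (p + 1 + clen c, tapes x n s') = (p + clen (CaseIn c d e), tapes x n s')"
    using step[OF CaseIn_0.prems, of "p + 1 + clen c" "tapes x n s'"] by simp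
  have "(tm_step M ^^ (t + 2)) (p, tapes x n s) = tm_step M ((tm_step M ^^ t) (tm_step M (p, tapes x n s)))"
    by (simp add: funpow_swap1)
  then show ?case using 1 2 CaseIn_0.IH[of "p + 1"] h by simp
next
  case (CaseIn_1 s d t s' c e)
  note h = has_code_CaseIn[OF CaseIn_1.prems]
  have 1: "tm_step M (p, tapes x n s) = (p + 2 + clen c, tapes x n s)"
    using step[OF CaseIn_1.prems, of p "tapes x n s"] h CaseIn_1.hyps by (simp add: tapes_nth counter_read)
  have 2: "tm_step M (p + 2 + clen c + clen d, tapes x n s') = (p + clen (CaseIn c d e), tapes x n s')"
    using step[OF CaseIn_1.prems, of "p + 2 + clen c + clen d" "tapes x n s'"] by simp
  have "(tm_step M ^^ (t + 2)) (p, tapes x n s) = tm_step M ((tm_step M ^^ t) (tm_step M (p, tapes x n s)))"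
    by (simp add: funpow_swap1)
  then show ?case using 1 2 CaseIn_1.IH[of "p + 2 + clen c"] h by simp
next
  case (CaseIn_2 s e t s' c d)
  note h = has_code_CaseIn[OF CaseIn_2.prems]
  have 1: "tm_step M (p, tapes x n s) = (p + 3 + clen c + clen d, tapes x n s)"
    using step[OF CaseIn_2.prems, of p "tapes x n s"] h CaseIn_2.hyps by (simp add: tapes_nth counter_read)
  have "(tm_step M ^^ (t + 1)) (p, tapes x n s) = (tm_step M ^^ t) (tm_step M (p, tapes x n s))"
    by (simp add: funpow_swap1)
  then show ?case using 1 CaseIn_2.IH[of "p + 3 + clen c + clen d"] h by simp
next
  case (Scan k s v)
  have v: "v < n" using Scan.prems by (simp add: has_code_def)
  \<comment> \<open>The state after \<open>i\<close> rounds of the scan; a round consists of one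
    step of the input head and one of the counter.\<close>
  define \<sigma> where "\<sigma> i = s\<lparr>reg := (reg s)(v := reg s v + i), ipos := ipos s + int i\<rparr>" for i
  have loop: "(tm_step M ^^ (2 * i)) (p, tapes x n s) = (p, tapes x n (\<sigma> i))" if "i \<le> k" for i
    using that
  proof (induction i)
    case 0
    then show ?case by (simp add: \<sigma>_def)
  next
    case (Suc i)
    then have "inscription x (ipos (\<sigma> i)) \<noteq> 0" using Scan.hyps(1)[of i] by (simp add: \<sigma>_def)
    then have "tm_step M (p, tapes x n (\<sigma> i)) = (p + 1, tapes x n (\<sigma> i\<lparr>ipos := ipos (\<sigma> i) + 1\<rparr>))"
      using step[OF Scan.prems, of p "tapes x n (\<sigma> i)"] by (simp add: tapes_nth counter_read tapes_ipos act_head)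
    moreover have "tm_step M (p + 1, tapes x n s') = (p, tapes x n (upd_reg s' v (Suc (reg s' v))))" for s'
      using step[OF Scan.prems, of "p + 1" "tapes x n s'"] v
      by (simp add: tapes_upd_reg tapes_nth counter_read act_counter)
    moreover have "upd_reg (\<sigma> i\<lparr>ipos := ipos (\<sigma> i) + 1\<rparr>) v
        (Suc (reg (\<sigma> i\<lparr>ipos := ipos (\<sigma> i) + 1\<rparr>) v)) = \<sigma> (Suc i)"
      by (simp add: \<sigma>_def)
    ultimately show ?case using Suc by simp
  qed
  have "inscription x (ipos (\<sigma> k)) = 0" using Scan.hyps(2) by (simp add: \<sigma>_def)
  then have "tm_step M (p, tapes x n (\<sigma> k)) = (p + 2, tapes x n (\<sigma> k))"
    using step[OF Scan.prems, of p "tapes x n (\<sigma> k)"] by (simp add: tapes_nth counter_read)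
  with loop[of k] show ?case by (simp add: \<sigma>_def)
qed simp

end

definition instr_ok :: "nat \<Rightarrow> nat \<Rightarrow> nat \<times> (nat \<times> move) list \<Rightarrow> bool" where
  "instr_ok n e r \<longleftrightarrow> fst r \<le> e \<and> length (snd r) = n + 2 \<and> fst ` set (snd r) \<subseteq> {..<3}"

lemma instr_ok_mono: "instr_ok n e r \<Longrightarrow> e \<le> e' \<Longrightarrow> instr_ok n e' r"
  by (auto simp: instr_ok_def)

lemma instr_wf:
  assumes rs: "length rs = n + 2" "set rs \<subseteq> {..<3}"
  shows "p \<le> q \<Longrightarrow> q < p + clen c \<Longrightarrow> vars_below n c \<Longrightarrow> instr_ok n (p + clen c) (instr n c p q rs)"
proof (induction c arbitrary: p)
  have keep: "instr_ok n e (i, keep rs)" if "i \<le> e" for i e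
    using that rs by (auto simp: keep_def instr_ok_def)
  have on: "instr_ok n e (i, on_tape rs j a)" if "i \<le> e" "fst a < 3" for i e j a
  proof -
    have "fst ` set (keep rs) \<subseteq> {..<3}" using rs by (auto simp: keep_def)
    then have "fst ` set ((keep rs)[j := a]) \<subseteq> {..<3}"
      using set_update_subset_insert[of "keep rs" j a] that(2) by blast
    then show ?thesis using that rs by (auto simp: instr_ok_def on_tape_def keep_def)
  qed
  have nth: "rs ! j < 3" if "j < n + 2" for j
    using that rs by (metis lessThan_iff nth_mem subsetD)
  {
    case (Inc v)
    then show ?case by (simp add: on nth)
  next
    case (Out b)
    then show ?case by (simp add: on bit_sym_def)
  next
    case InL
    then show ?case by (simp add: on nth)
  next
    case InR
    then show ?case by (simp add: on nth)
  next
    case (Seq c d)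
    show ?case
    proof (cases "q < p + clen c")
      case True
      then show ?thesis using Seq.IH(1)[of p] Seq.prems by (auto elim: instr_ok_mono)
    next
      case False
      then show ?thesis using Seq.IH(2)[of "p + clen c"] Seq.prems by (simp add: add_ac)
    qed
  next
    case (IfZ v c d)
    consider "q = p" | "p < q" "q < p + 1 + clen c" | "q = p + 1 + clen c" | "p + 1 + clen c < q"
      using IfZ.prems(1) by linarith
    then show ?case
    proof cases
      case 2
      then show ?thesis using IfZ.IH(1)[of "p + 1"] IfZ.prems by (auto elim: instr_ok_mono)
    next
      case 4
      then show ?thesis using IfZ.IH(2)[of "p + 2 + clen c"] IfZ.prems by (simp add: add_ac)
    qed (simp_all add: keep)
  next
    case (For v c)
    consider "q = p" | "p < q" "q < p + 1 + clen c" | "p < q" "q = p + 1 + clen c"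
      using For.prems by fastforce
    then show ?case
    proof cases
      case 1
      then show ?thesis using For.prems by (simp add: keep on nth)
    next
      case 2
      then show ?thesis using For.IH(1)[of "p + 1"] For.prems by (auto elim: instr_ok_mono)
    qed (simp add: keep)
  next
    case (CaseIn c d e)
    consider "q = p" | "p < q" "q < p + 1 + clen c" | "q = p + 1 + clen c"
      | "p + 1 + clen c < q" "q < p + 2 + clen c + clen d" | "q = p + 2 + clen c + clen d"
      | "p + 2 + clen c + clen d < q" using CaseIn.prems(1) by linarith
    then show ?case
    proof cases
      case 2
      then show ?thesis using CaseIn.IH(1)[of "p + 1"] CaseIn.prems by (auto elim: instr_ok_mono)
    next
      case 4
      then show ?thesis using CaseIn.IH(2)[of "p + 2 + clen c"] CaseIn.prems by (auto elim: instr_ok_mono)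
    next
      case 6
      then show ?thesis using CaseIn.IH(3)[of "p + 3 + clen c + clen d"] CaseIn.prems by (simp add: add_ac)
    qed (simp_all add: keep)
  next
    case (Scan v)
    then show ?case by (simp add: keep on nth)
  }
qed simp

lemma machine_wf: assumes "vars_below n c" shows "tm_wf (machine n c)"
proof -
  have "case delta (machine n c) q rs of (q', acts) \<Rightarrow>
      q' \<le> Suc (clen c) \<and> length acts = n + 2 \<and> fst ` set acts \<subseteq> {..<3}"
    if "q < Suc (clen c)" and rs: "length rs = n + 2" "set rs \<subseteq> {..<3}" for q rs
  proof (cases "q = 0")
    case True
    have "rs ! j < 3" if "j < n + 2" for j
      using that rs by (metis lessThan_iff nth_mem subsetD)
    then show ?thesis using True by (auto simp: machine_def)
  next
    case False
    then have "instr_ok n (1 + clen c) (instr n c 1 q rs)"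
      using instr_wf[OF rs, of 1 q c] that(1) assms by simp
    then show ?thesis using False by (simp add: machine_def instr_ok_def case_prod_beta)
  qed
  then show ?thesis by (auto simp: tm_wf_def machine_def)
qed

definition init_st :: st where
  "init_st = \<lparr>reg = (\<lambda>_. 0), ipos = 0, outp = []\<rparr>"

theorem polytime_functionI:
  assumes vars: "vars_below n c"
    and run: "\<And>x. \<exists>t s. exec x (poly b (length x)) c init_st t s \<and> outp s = f x"
  shows "polytime_function f"
proof -
  let ?M = "machine n c"
  \<comment> \<open>The additional step is the marking of the counter tapes.\<close>
  have "tm_outputs_within ?M [x] (poly (pcompose (time_poly c) b + 1) (length x)) (f x)" for x
  proof -
    obtain t s where ts: "exec x (poly b (length x)) c init_st t s" "outp s = f x" using run by blast
    have "t \<le> poly (time_poly c) (poly b (length x))"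
      by (rule exec_time(1)[OF ts(1)]) (simp add: init_st_def)
    then have t: "Suc t \<le> poly (pcompose (time_poly c) b + 1) (length x)" by (simp add: poly_pcompose)
    have code: "has_code n ?M c 1"
      using vars by (auto simp: has_code_def machine_def)
    have init: "tm_step ?M (tm_init ?M [x]) = (1, tapes x n init_st)"
    proof -
      define tps where "tps = snd (tm_init ?M [x])"
      define acts where "acts = map (\<lambda>j. (if 1 \<le> j \<and> j \<le> n then 1 else reads tps ! j, Stay)) [0..<n + 2]"
      have len: "length tps = n + 2" by (simp add: tps_def tm_init_def machine_def)
      have tp: "tps ! j = (if j = 0 then (inscription x, 0) else (inscription [], 0))" if "j < n + 2" for j
        using that by (simp add: tps_def tm_init_def machine_def del: upt_Suc)
      have acts: "acts ! j = (if 1 \<le> j \<and> j \<le> n then 1 else fst (tps ! j) (snd (tps ! j)), Stay)"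
        if "j < n + 2" for j
        using that len by (simp add: acts_def del: upt_Suc)
      have "map2 act tps acts = tapes x n init_st"
      proof (rule nth_equalityI)
        show "length (map2 act tps acts) = length (tapes x n init_st)" by (simp add: len acts_def)
        fix j assume "j < length (map2 act tps acts)"
        then have j: "j < n + 2" by (simp add: len acts_def)
        then have "map2 act tps acts ! j = act (tps ! j) (acts ! j)"
          by (simp add: len acts_def del: upt_Suc)
        also have "\<dots> = tapes x n init_st ! j"
        proof -
          consider "j = 0" | v where "j = Suc v" "v < n" | "j = Suc n" using j by (cases j) force+
          then show ?thesis
            by cases (use j in \<open>auto simp: tp acts tapes_nth act_def counter_tape_def init_st_def inscription_def\<close>)
        qed
        finally show "map2 act tps acts ! j = tapes x n init_st ! j" .
      qed
      moreover have "tm_init ?M [x] = (0, tps)" by (simp add: tps_def tm_init_def)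
      moreover have "tm_step ?M (0, tps) = (1, map2 act tps acts)"
        by (simp add: tm_step_def machine_def acts_def del: upt_Suc)
      ultimately show ?thesis by simp
    qed
    have "(tm_step ?M ^^ Suc t) (tm_init ?M [x]) = (nstates ?M, tapes x n s)"
      using exec_simulation[OF ts(1) code] init by (simp add: funpow_swap1 machine_def)
    moreover have "fst (last (tapes x n s)) = inscription (f x)" using ts(2) by (simp add: tapes_def)
    ultimately show ?thesis
      unfolding tm_outputs_within_def using t by (auto simp: machine_def)
  qed
  then show ?thesis unfolding polytime_function_def using machine_wf[OF vars] by blast
qed

section \<open>Program verification without running times\<close>

definition set_reg :: "st \<Rightarrow> nat \<Rightarrow> nat \<Rightarrow> st" where
  "set_reg s v n = upd_reg s v n"

definition put :: "st \<Rightarrow> bool list \<Rightarrow> st" where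
  "put s bs = s\<lparr>outp := outp s @ bs\<rparr>"

definition move_in :: "st \<Rightarrow> int \<Rightarrow> st" where
  "move_in s d = s\<lparr>ipos := ipos s + d\<rparr>"

lemma st_simps [simp]:
  "reg (set_reg s v n) u = (if u = v then n else reg s u)" "ipos (set_reg s v n) = ipos s"
  "outp (set_reg s v n) = outp s"
  "reg (put s bs) = reg s" "ipos (put s bs) = ipos s" "outp (put s bs) = outp s @ bs"
  "reg (move_in s d) = reg s" "ipos (move_in s d) = ipos s + d" "outp (move_in s d) = outp s"
  by (auto simp: set_reg_def put_def move_in_def)

text \<open>States built with \<open>set_reg\<close>, \<open>put\<close> and \<open>move_in\<close>
  are compared by their components, which spares all reordering of record updates.\<close>

lemma st_eqI:
  fixes s t :: st
  shows "(\<And>v. reg s v = reg t v) \<Longrightarrow> ipos s = ipos t \<Longrightarrow> outp s = outp t \<Longrightarrow> s = t"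
  by (intro st.equality) auto

text \<open>The time may be forgotten, since \<open>exec_time\<close> recovers a polynomial bound
  from the bound \<open>B\<close> on the counters.\<close>

definition runs :: "bool list \<Rightarrow> nat \<Rightarrow> com \<Rightarrow> st \<Rightarrow> st \<Rightarrow> bool" where
  "runs x B c s s' \<longleftrightarrow> (\<exists>t. exec x B c s t s')"

lemma runs_Skip: "runs x B Skip s s"
  and runs_Inc: "reg s v < B \<Longrightarrow> runs x B (Inc v) s (set_reg s v (Suc (reg s v)))"
  and runs_Out: "runs x B (Out b) s (put s [b])"
  and runs_InR: "runs x B InR s (move_in s 1)"
  and runs_Seq: "runs x B c s s' \<Longrightarrow> runs x B d s' s'' \<Longrightarrow> runs x B (c ;; d) s s''"
  and runs_IfZ_zero: "reg s v = 0 \<Longrightarrow> runs x B c s s' \<Longrightarrow> runs x B (IfZ v c d) s s'"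
  and runs_IfZ_pos: "reg s v \<noteq> 0 \<Longrightarrow> runs x B d s s' \<Longrightarrow> runs x B (IfZ v c d) s s'"
  unfolding runs_def set_reg_def put_def move_in_def by (blast intro: exec.intros)+

lemma runs_InL: "runs x B InL s (move_in s (- 1))"
  unfolding runs_def move_in_def using exec.InL[of x B s] by auto

lemma runs_eqI:
  assumes "runs x B c s t" "\<And>v. reg t v = reg t' v" "ipos t = ipos t'" "outp t = outp t'"
  shows "runs x B c s t'"
  using assms(1) st_eqI[OF assms(2-4)] by simp

lemma runs_CaseIn:
  assumes "runs x B (if inscription x (ipos s) = 0 then c0 else if inscription x (ipos s) = 1 then c1 else c2) s s'"
  shows "runs x B (CaseIn c0 c1 c2) s s'"
proof -
  have "inscription x (ipos s) \<in> {0, 1, 2}" by (auto simp: inscription_def bit_sym_def)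
  then show ?thesis using assms unfolding runs_def
    by (elim insertE emptyE) (auto intro: exec.CaseIn_0 exec.CaseIn_1[unfolded One_nat_def] exec.CaseIn_2)
qed

text \<open>\<open>\<sigma> i\<close> is the state before round \<open>i\<close>, with
  \<open>n - i\<close> rounds to go; the body starts after the decrement.\<close>

lemma runs_For:
  assumes "\<And>i. i < n \<Longrightarrow> runs x B c (set_reg (\<sigma> i) v (n - Suc i)) (\<sigma> (Suc i))"
    and "\<And>i. i \<le> n \<Longrightarrow> reg (\<sigma> i) v = n - i"
  shows "runs x B (For v c) (\<sigma> 0) (\<sigma> n)"
proof -
  have "runs x B (For v c) (\<sigma> (n - k)) (\<sigma> n)" if "k \<le> n" for k
    using that
  proof (induction k)
    case 0
    then show ?case using assms(2)[of n] unfolding runs_def by (auto intro: exec.intros)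
  next
    case (Suc k)
    let ?i = "n - Suc k"
    have i: "?i < n" "Suc ?i = n - k" "n - Suc ?i = k" using Suc.prems by auto
    then obtain t where t: "exec x B c (upd_reg (\<sigma> ?i) v k) t (\<sigma> (n - k))"
      using assms(1)[of ?i] unfolding runs_def set_reg_def by auto
    obtain t' where t': "exec x B (For v c) (\<sigma> (n - k)) t' (\<sigma> n)"
      using Suc unfolding runs_def by auto
    have "reg (\<sigma> ?i) v = Suc k" "reg (\<sigma> (n - k)) v = k"
      using assms(2)[of ?i] assms(2)[of "n - k"] Suc.prems i by auto
    with t t' show ?case unfolding runs_def by (blast intro: exec.For_Suc)
  qed
  from this[of n] show ?thesis by simp
qed

definition clear :: "nat \<Rightarrow> com" where "clear v = For v Skip"

lemma runs_clear: "runs x B (clear v) s (set_reg s v 0)"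
proof -
  have "runs x B (clear v) (set_reg s v (reg s v - 0)) (set_reg s v (reg s v - reg s v))"
    unfolding clear_def
  proof (rule runs_For[where \<sigma> = "\<lambda>i. set_reg s v (reg s v - i)"])
    show "runs x B Skip (set_reg (set_reg s v (reg s v - i)) v (reg s v - Suc i)) (set_reg s v (reg s v - Suc i))" for i
      by (rule runs_eqI[OF runs_Skip]) auto
  qed auto
  moreover have "set_reg s v (reg s v) = s" by (rule st_eqI) auto
  ultimately show ?thesis by simp
qed

fun incs :: "nat \<Rightarrow> nat \<Rightarrow> com" where
  "incs v 0 = Skip"
| "incs v (Suc k) = Inc v ;; incs v k"

lemma runs_incs: "reg s v + k \<le> B \<Longrightarrow> runs x B (incs v k) s (set_reg s v (reg s v + k))"
proof (induction k arbitrary: s)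
  case 0
  show ?case by (simp, rule runs_eqI[OF runs_Skip]) auto
next
  case (Suc k)
  let ?s = "set_reg s v (Suc (reg s v))"
  have "runs x B (incs v k) ?s (set_reg ?s v (reg ?s v + k))"
    using Suc.prems by (intro Suc.IH) simp
  with runs_Inc[of s v B x] Suc.prems have "runs x B (incs v (Suc k)) s (set_reg ?s v (reg ?s v + k))"
    by (auto intro: runs_Seq)
  then show ?case by (rule runs_eqI) auto
qed

fun outs :: "bool list \<Rightarrow> com" where
  "outs [] = Skip"
| "outs (b # bs) = Out b ;; outs bs"

lemma runs_outs: "runs x B (outs bs) s (put s bs)"
proof (induction bs arbitrary: s)
  case Nil
  show ?case by (simp, rule runs_eqI[OF runs_Skip]) auto
next
  case (Cons b bs)
  have "runs x B (outs (b # bs)) s (put (put s [b]) bs)"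
    unfolding outs.simps by (rule runs_Seq[OF runs_Out Cons])
  then show ?case by (rule runs_eqI) auto
qed

text \<open>\<open>For\<close> consumes its counter. Here \<open>w\<close> counts the rounds and is
  finally poured back into \<open>v\<close>, so that the bound \<open>v\<close> can be used
  again.\<close>

definition Loop :: "nat \<Rightarrow> nat \<Rightarrow> com \<Rightarrow> com" where
  "Loop v w c = For v (Inc w ;; c) ;; For w (Inc v)"

text \<open>The states \<open>\<sigma> i\<close> ignore that \<open>v\<close> and \<open>w\<close>
  change during the loop; in exchange the body has to work for all values of these two
  registers.\<close>

lemma runs_Loop:
  assumes vw: "v \<noteq> w" and B: "n \<le> B"
    and val: "\<And>i. i \<le> n \<Longrightarrow> reg (\<sigma> i) v = n \<and> reg (\<sigma> i) w = 0"
    and body: "\<And>i a b. i < n \<Longrightarrow> runs x B c (set_reg (set_reg (\<sigma> i) v a) w b) (set_reg (set_reg (\<sigma> (Suc i)) v a) w b)"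
  shows "runs x B (Loop v w c) (\<sigma> 0) (\<sigma> n)"
proof -
  define \<tau> where "\<tau> i = set_reg (set_reg (\<sigma> i) v (n - i)) w i" for i
  have "runs x B (For v (Inc w ;; c)) (\<tau> 0) (\<tau> n)"
  proof (rule runs_For)
    fix i assume i: "i < n"
    have "runs x B (Inc w) (set_reg (\<tau> i) v (n - Suc i)) (set_reg (set_reg (\<sigma> i) v (n - Suc i)) w (Suc i))"
      by (rule runs_eqI[OF runs_Inc]) (use vw i B in \<open>auto simp: \<tau>_def\<close>)
    moreover have "runs x B c (set_reg (set_reg (\<sigma> i) v (n - Suc i)) w (Suc i)) (\<tau> (Suc i))"
      unfolding \<tau>_def by (rule body[OF i])
    ultimately show "runs x B (Inc w ;; c) (set_reg (\<tau> i) v (n - Suc i)) (\<tau> (Suc i))"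
      by (rule runs_Seq)
  qed (use vw in \<open>auto simp: \<tau>_def\<close>)
  moreover have "\<tau> 0 = \<sigma> 0"
    using val[of 0] by (intro st_eqI) (auto simp: \<tau>_def)
  moreover have "runs x B (For w (Inc v)) (\<tau> n) (\<sigma> n)"
  proof -
    define \<rho> where "\<rho> i = set_reg (set_reg (\<sigma> n) v i) w (n - i)" for i
    have "runs x B (For w (Inc v)) (\<rho> 0) (\<rho> n)"
    proof (rule runs_For)
      fix i assume i: "i < n"
      show "runs x B (Inc v) (set_reg (\<rho> i) w (n - Suc i)) (\<rho> (Suc i))"
        by (rule runs_eqI[OF runs_Inc]) (use vw i B in \<open>auto simp: \<rho>_def\<close>)
    qed (use vw in \<open>auto simp: \<rho>_def\<close>)
    moreover have "\<rho> n = \<sigma> n" using val[of n] by (intro st_eqI) (auto simp: \<rho>_def)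
    moreover have "\<rho> 0 = \<tau> n" by (simp add: \<rho>_def \<tau>_def)
    ultimately show ?thesis by simp
  qed
  ultimately show ?thesis unfolding Loop_def by (auto intro: runs_Seq)
qed

lemma runs_add:
  assumes "v \<noteq> w" "u \<noteq> v" "u \<noteq> w" "reg s w = 0" "reg s u + k * reg s v \<le> B" "reg s v \<le> B"
  shows "runs x B (Loop v w (incs u k)) s (set_reg s u (reg s u + k * reg s v))"
proof -
  have "runs x B (Loop v w (incs u k)) (set_reg s u (reg s u + k * 0)) (set_reg s u (reg s u + k * reg s v))"
  proof (rule runs_Loop[where \<sigma> = "\<lambda>i. set_reg s u (reg s u + k * i)"])
    fix i a b assume i: "i < reg s v"
    let ?s = "set_reg (set_reg (set_reg s u (reg s u + k * i)) v a) w b"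
    have "k * Suc i \<le> k * reg s v" using i by (intro mult_le_mono2) simp
    then have "reg ?s u + k \<le> B" using assms by simp
    from runs_incs[OF this] show "runs x B (incs u k) ?s (set_reg (set_reg (set_reg s u (reg s u + k * Suc i)) v a) w b)"
      by (rule runs_eqI) (use assms in auto)
  qed (use assms in auto)
  moreover have "set_reg s u (reg s u + k * 0) = s" by (rule st_eqI) auto
  ultimately show ?thesis by simp
qed

section \<open>Output of numbers and edges\<close>

text \<open>
  \<open>rM\<close> is the next free vertex and \<open>rB\<close> the weight bound so far; \<open>rX\<close> is a base address and \<open>rD\<close> the
  distance between rows of the grid. The registers from 10 on are zero between commands.
\<close>

definition "rX = (0 :: nat)"
definition "rD = (1 :: nat)"
definition "rM = (2 :: nat)"
definition "rB = (3 :: nat)"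
definition "rU = (10 :: nat)"
definition "rH = (11 :: nat)"
definition "rQ = (12 :: nat)"
definition "rY = (13 :: nat)"

lemmas regs = rX_def rD_def rM_def rB_def rU_def rH_def rQ_def rY_def

text \<open>While \<open>rU\<close> is counted down, \<open>rQ\<close> toggles between 0 and 1 and
  \<open>rH\<close> grows at every second step. So they end up as remainder and quotient modulo
  2.\<close>

definition halve :: com where
  "halve = For rU (IfZ rQ (Inc rQ) (clear rQ ;; Inc rH)) ;;
     IfZ rQ (Out False) (Out True ;; clear rQ) ;; For rH (Inc rU)"

lemma runs_halve:
  assumes n: "reg s rU = n" "n \<le> B" and z: "reg s rH = 0" "reg s rQ = 0"
  shows "runs x B halve s (put (set_reg s rU (n div 2)) [odd n])"
proof -
  define \<sigma> where "\<sigma> i = set_reg (set_reg (set_reg s rU (n - i)) rQ (i mod 2)) rH (i div 2)" for i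
  have "runs x B (For rU (IfZ rQ (Inc rQ) (clear rQ ;; Inc rH))) (\<sigma> 0) (\<sigma> n)"
  proof (rule runs_For)
    fix i assume i: "i < n"
    let ?t = "set_reg (\<sigma> i) rU (n - Suc i)"
    show "runs x B (IfZ rQ (Inc rQ) (clear rQ ;; Inc rH)) ?t (\<sigma> (Suc i))"
    proof (cases "even i")
      case True
      then have q: "i mod 2 = 0" "Suc i mod 2 = 1" "Suc i div 2 = i div 2" by auto
      have "runs x B (Inc rQ) ?t (\<sigma> (Suc i))"
        by (rule runs_eqI[OF runs_Inc]) (use i n q in \<open>auto simp: \<sigma>_def regs\<close>)
      then show ?thesis using q by (intro runs_IfZ_zero) (auto simp: \<sigma>_def regs)
    next
      case False
      then have q: "i mod 2 = 1" "Suc i mod 2 = 0" "Suc i div 2 = Suc (i div 2)" by presburger+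
      have "runs x B (Inc rH) (set_reg ?t rQ 0) (\<sigma> (Suc i))"
        by (rule runs_eqI[OF runs_Inc]) (use i n q in \<open>auto simp: \<sigma>_def regs\<close>)
      then have "runs x B (clear rQ ;; Inc rH) ?t (\<sigma> (Suc i))"
        by (rule runs_Seq[OF runs_clear])
      then show ?thesis using q by (intro runs_IfZ_pos) (auto simp: \<sigma>_def regs)
    qed
  qed (auto simp: \<sigma>_def regs)
  moreover have "\<sigma> 0 = s" by (rule st_eqI) (use n z in \<open>auto simp: \<sigma>_def\<close>)
  moreover define s2 where "s2 = put (set_reg (set_reg s rU 0) rH (n div 2)) [odd n]"
  have "runs x B (IfZ rQ (Out False) (Out True ;; clear rQ)) (\<sigma> n) s2"
  proof (cases "even n")
    case True
    have "runs x B (Out False) (\<sigma> n) s2"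
      by (rule runs_eqI[OF runs_Out]) (use True z in \<open>auto simp: \<sigma>_def s2_def regs\<close>)
    then show ?thesis using True by (intro runs_IfZ_zero) (auto simp: \<sigma>_def regs)
  next
    case False
    have "runs x B (Out True ;; clear rQ) (\<sigma> n) s2"
      by (rule runs_eqI[OF runs_Seq[OF runs_Out runs_clear]]) (use False z in \<open>auto simp: \<sigma>_def s2_def regs\<close>)
    then show ?thesis using False by (intro runs_IfZ_pos) (auto simp: \<sigma>_def regs odd_iff_mod_2_eq_one)
  qed
  moreover have "runs x B (For rH (Inc rU)) s2 (put (set_reg s rU (n div 2)) [odd n])"
  proof -
    define \<rho> where "\<rho> i = set_reg (set_reg s2 rH (n div 2 - i)) rU i" for i
    have "runs x B (For rH (Inc rU)) (\<rho> 0) (\<rho> (n div 2))"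
    proof (rule runs_For)
      fix i assume i: "i < n div 2"
      show "runs x B (Inc rU) (set_reg (\<rho> i) rH (n div 2 - Suc i)) (\<rho> (Suc i))"
        by (rule runs_eqI[OF runs_Inc]) (use i n in \<open>auto simp: \<rho>_def regs\<close>)
    qed (auto simp: \<rho>_def regs)
    moreover have "\<rho> 0 = s2" by (rule st_eqI) (auto simp: \<rho>_def s2_def regs)
    moreover have "\<rho> (n div 2) = put (set_reg s rU (n div 2)) [odd n]"
      by (rule st_eqI) (use z in \<open>auto simp: \<rho>_def s2_def regs\<close>)
    ultimately show ?thesis by simp
  qed
  ultimately show ?thesis unfolding halve_def by (auto intro: runs_Seq)
qed

text \<open>There is no loop with an open end, so a copy of the number bounds the rounds of halving.
  As \<open>n div 2 ^ n\<close> is 0, \<open>n\<close> rounds suffice, and the rounds after reaching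
  0 do nothing.\<close>

definition emit_rU :: com where
  "emit_rU = Loop rU rH (incs rY 1) ;; For rY (IfZ rU Skip (Out True ;; halve)) ;; Out False"

text \<open>What \<open>emit_rU\<close> has written after some rounds; \<open>digits_enc\<close> is
  the invariant that the code of the remaining quotient completes it to the code of
  \<open>n\<close>.\<close>

fun digits :: "nat \<Rightarrow> nat \<Rightarrow> bool list" where
  "digits n 0 = []"
| "digits n (Suc i) = digits n i @ (if n div 2 ^ i = 0 then [] else [True, odd (n div 2 ^ i)])"

lemma div_pow2_Suc: "n div 2 ^ i div 2 = n div (2 :: nat) ^ Suc i"
  by (metis div_mult2_eq power_Suc2)

lemma digits_enc: "digits n i @ enc_nat (n div 2 ^ i) = enc_nat n"
proof (induction i)
  case (Suc i)
  then show ?case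
    using enc_nat.simps[of "n div 2 ^ i"] enc_nat.simps[of 0] div_pow2_Suc[of n i]
    by (cases "n div 2 ^ i = 0") (auto simp del: power_Suc)
qed simp

lemma runs_emit_rU:
  assumes n: "reg s rU = n" "n \<le> B" and z: "reg s rH = 0" "reg s rQ = 0" "reg s rY = 0"
  shows "runs x B emit_rU s (put (set_reg s rU 0) (enc_nat n))"
proof -
  define s1 where "s1 = set_reg s rY n"
  have "runs x B (Loop rU rH (incs rY 1)) s s1"
    by (rule runs_eqI[OF runs_add]) (use n z in \<open>auto simp: regs s1_def\<close>)
  moreover define \<sigma> where "\<sigma> i = put (set_reg (set_reg s rU (n div 2 ^ i)) rY (n - i)) (digits n i)" for i
  have "runs x B (For rY (IfZ rU Skip (Out True ;; halve))) (\<sigma> 0) (\<sigma> n)"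
  proof (rule runs_For)
    fix i assume i: "i < n"
    let ?s = "set_reg (\<sigma> i) rY (n - Suc i)"
    show "runs x B (IfZ rU Skip (Out True ;; halve)) ?s (\<sigma> (Suc i))"
    proof (cases "n div 2 ^ i = 0")
      case True
      then have "n div 2 ^ Suc i = 0" using div_pow2_Suc[of n i] by simp
      then have "runs x B Skip ?s (\<sigma> (Suc i))"
        by (intro runs_eqI[OF runs_Skip]) (use True in \<open>auto simp: \<sigma>_def regs simp del: power_Suc\<close>)
      then show ?thesis using True by (intro runs_IfZ_zero) (auto simp: \<sigma>_def regs)
    next
      case False
      have "n div 2 ^ i \<le> B" using n(2) div_le_dividend le_trans by blast
      then have "runs x B halve (put ?s [True])
          (put (set_reg (put ?s [True]) rU (n div 2 ^ i div 2)) [odd (n div 2 ^ i)])"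
        using z by (intro runs_halve) (auto simp: \<sigma>_def regs)
      from runs_Seq[OF runs_Out this] have "runs x B (Out True ;; halve) ?s (\<sigma> (Suc i))"
        unfolding div_pow2_Suc
        by (rule runs_eqI) (use False in \<open>auto simp: \<sigma>_def regs simp del: power_Suc\<close>)
      then show ?thesis using False by (intro runs_IfZ_pos) (auto simp: \<sigma>_def regs)
    qed
  qed (auto simp: \<sigma>_def regs)
  moreover have "\<sigma> 0 = s1" by (rule st_eqI) (use n in \<open>auto simp: \<sigma>_def s1_def regs\<close>)
  moreover have "runs x B (Out False) (\<sigma> n) (put (set_reg s rU 0) (enc_nat n))"
  proof -
    have "n div 2 ^ n = 0" by simp
    then have "digits n n @ [False] = enc_nat n" using digits_enc[of n n] by (simp add: enc_nat.simps[of 0])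
    then show ?thesis
      by (intro runs_eqI[OF runs_Out]) (use z in \<open>auto simp: \<sigma>_def regs\<close>)
  qed
  ultimately show ?thesis unfolding emit_rU_def by (auto intro: runs_Seq)
qed

fun emit_num :: "nat list \<Rightarrow> nat \<Rightarrow> com" where
  "emit_num [] k = incs rU k ;; emit_rU"
| "emit_num (r # rs) k = Loop r rH (incs rU 1) ;; emit_num rs k"

definition num_val :: "st \<Rightarrow> nat list \<times> nat \<Rightarrow> nat" where
  "num_val s a = sum_list (map (reg s) (fst a)) + snd a"

lemma runs_emit_num:
  assumes "reg s rU + num_val s (rs, k) \<le> B" "reg s rH = 0" "reg s rQ = 0" "reg s rY = 0"
    "rU \<notin> set rs" "rH \<notin> set rs"
  shows "runs x B (emit_num rs k) s (put (set_reg s rU 0) (enc_nat (reg s rU + num_val s (rs, k))))"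
  using assms
proof (induction rs arbitrary: s)
  case Nil
  let ?s = "set_reg s rU (reg s rU + k)"
  have "runs x B (incs rU k) s ?s" using Nil by (intro runs_incs) (simp add: num_val_def)
  moreover have "runs x B emit_rU ?s (put (set_reg ?s rU 0) (enc_nat (reg s rU + k)))"
    using Nil by (intro runs_emit_rU) (auto simp: num_val_def regs)
  ultimately have "runs x B (emit_num [] k) s (put (set_reg ?s rU 0) (enc_nat (reg s rU + k)))"
    by (auto intro: runs_Seq)
  then show ?case by (rule runs_eqI) (auto simp: num_val_def)
next
  case (Cons r rs)
  let ?s = "set_reg s rU (reg s rU + 1 * reg s r)"
  have 1: "runs x B (Loop r rH (incs rU 1)) s ?s"
    using Cons.prems by (intro runs_add) (auto simp: num_val_def regs)
  have "map (reg ?s) rs = map (reg s) rs" using Cons.prems by auto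
  then have eq: "num_val ?s (rs, k) = num_val s (rs, k)" unfolding num_val_def by (simp only: fst_conv snd_conv)
  have "runs x B (emit_num rs k) ?s (put (set_reg ?s rU 0) (enc_nat (reg ?s rU + num_val ?s (rs, k))))"
    using Cons.prems eq by (intro Cons.IH) (auto simp: num_val_def regs)
  with 1 have "runs x B (emit_num (r # rs) k) s
      (put (set_reg ?s rU 0) (enc_nat (reg ?s rU + num_val ?s (rs, k))))"
    by (auto intro: runs_Seq)
  then show ?case unfolding eq by (rule runs_eqI) (auto simp: num_val_def add_ac)
qed

definition enc_edges :: "(nat \<times> nat) list \<Rightarrow> bool list" where
  "enc_edges es = concat (map (\<lambda>e. True # enc_edge (e, (1, 1))) es)"

lemma enc_edges_simps [simp]:
  "enc_edges [] = []" "enc_edges (e # es) = True # enc_edge (e, (1, 1)) @ enc_edges es"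
  "enc_edges (es @ fs) = enc_edges es @ enc_edges fs"
  by (auto simp: enc_edges_def)

lemma enc_list_edges: "enc_list enc_edge (map (\<lambda>e. (e, (1, 1))) es) = enc_edges es @ [False]"
  by (induction es) auto

definition emit_edge :: "nat list \<times> nat \<Rightarrow> nat list \<times> nat \<Rightarrow> com" where
  "emit_edge a b = Out True ;; emit_num (fst a) (snd a) ;; emit_num (fst b) (snd b) ;;
     outs (enc_nat 1 @ enc_nat 1)"

definition scratch_zero :: "st \<Rightarrow> bool" where
  "scratch_zero s \<longleftrightarrow> reg s rU = 0 \<and> reg s rH = 0 \<and> reg s rQ = 0 \<and> reg s rY = 0"

definition num_ok :: "nat \<Rightarrow> st \<Rightarrow> nat list \<times> nat \<Rightarrow> bool" where
  "num_ok B s a \<longleftrightarrow> num_val s a \<le> B \<and> rU \<notin> set (fst a) \<and> rH \<notin> set (fst a)"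

lemma put_simps [simp]:
  "num_val (put s bs) a = num_val s a" "num_ok B (put s bs) a = num_ok B s a"
  "scratch_zero (put s bs) = scratch_zero s"
  by (auto simp: num_val_def num_ok_def scratch_zero_def)

lemma runs_emit_edge:
  assumes "scratch_zero s" "num_ok B s a" "num_ok B s b"
  shows "runs x B (emit_edge a b) s (put s (enc_edges [(num_val s a, num_val s b)]))"
proof -
  have num: "runs x B (emit_num (fst a) (snd a)) t (put t (enc_nat (num_val t a)))"
    if "scratch_zero t" "num_ok B t a" for t a
    by (rule runs_eqI[OF runs_emit_num]) (use that in \<open>auto simp: scratch_zero_def num_ok_def\<close>)
  have "runs x B (emit_edge a b) s
      (put (put (put (put s [True]) (enc_nat (num_val s a))) (enc_nat (num_val s b))) (enc_nat 1 @ enc_nat 1))"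
    unfolding emit_edge_def
    using num[of "put s [True]" a] num[of "put (put s [True]) (enc_nat (num_val s a))" b] assms
    by (auto intro!: runs_Seq[OF runs_Out runs_Seq[OF _ runs_Seq[OF _ runs_outs]]])
  then show ?thesis by (rule runs_eqI) (auto simp: enc_edge_def)
qed

section \<open>Emitting families of stars\<close>

text \<open>An entry \<open>(k, c)\<close> of a template refers to the vertex \<open>X + k D + c\<close>.\<close>

definition inst :: "nat \<Rightarrow> nat \<Rightarrow> (nat \<times> nat) list \<Rightarrow> nat list" where
  "inst X D T = map (\<lambda>(k, c). X + k * D + c) T"

lemma inst_simps [simp]:
  "inst X D [] = []" "inst X D (e # T) = (X + fst e * D + snd e) # inst X D T"
  "length (inst X D T) = length T"
  by (auto simp: inst_def split: prod.splits)

lemma inst_eq_Nil [simp]: "inst X D T = [] \<longleftrightarrow> T = []"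
  by (cases T) auto

text \<open>The common shape of the effects of all emitting commands. Composition of such effects is
  concatenation of the lists of stars (\<open>eff_eff\<close>), which reduces verification to list
  equations.\<close>

definition eff :: "nat list list \<Rightarrow> nat \<Rightarrow> int \<Rightarrow> st \<Rightarrow> st" where
  "eff Ss dx dp s = move_in (put (set_reg (set_reg (set_reg s rX (reg s rX + dx))
     rM (reg s rM + stars_size Ss)) rB (reg s rB + budget Ss)) (enc_edges (stars_edges (reg s rM) Ss))) dp"

lemma eff_simps [simp]:
  "reg (eff Ss dx dp s) v = (if v = rX then reg s rX + dx else if v = rM then reg s rM + stars_size Ss
     else if v = rB then reg s rB + budget Ss else reg s v)"
  "ipos (eff Ss dx dp s) = ipos s + dp"
  "outp (eff Ss dx dp s) = outp s @ enc_edges (stars_edges (reg s rM) Ss)"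
  by (auto simp: eff_def regs)

lemma eff_eff: "eff Ts dx' dp' (eff Ss dx dp s) = eff (Ss @ Ts) (dx + dx') (dp + dp') s"
  by (rule st_eqI) (auto simp: regs stars_edges_append)

lemma eff_set_reg: "v \<notin> {rX, rM, rB} \<Longrightarrow> eff Ss dx dp (set_reg s v a) = set_reg (eff Ss dx dp s) v a"
  by (rule st_eqI) (auto simp: regs)

lemma eff_Nil [simp]: "eff [] 0 0 s = s"
  by (rule st_eqI) auto

definition fits :: "nat \<Rightarrow> nat list list \<Rightarrow> st \<Rightarrow> bool" where
  "fits B Ss s \<longleftrightarrow> reg s rM + stars_size Ss \<le> B \<and> reg s rB + budget Ss \<le> B \<and> (\<forall>S\<in>set Ss. \<forall>l\<in>set S. l \<le> B)"

lemma fits_append: "fits B (Ss @ Ts) s \<longleftrightarrow> fits B Ss s \<and> fits B Ts (eff Ss dx dp s)"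
  by (auto simp: fits_def regs)

lemma fits_Cons: "fits B (S # Ts) s \<longleftrightarrow> fits B [S] s \<and> fits B Ts (eff [S] dx dp s)"
  using fits_append[of B "[S]" Ts s] by simp

lemma fits_concat:
  assumes "fits B (concat (map f [0..<n])) s" "i < n"
  shows "fits B (f i) (eff (concat (map f [0..<i])) dx dp s)"
proof -
  obtain k where "n = i + Suc k" using assms(2) less_iff_Suc_add by auto
  then have "[0..<n] = [0..<i] @ i # [Suc i..<n]"
    using upt_add_eq_append[of 0 i "Suc k"] by (simp add: upt_conv_Cons del: upt_Suc)
  then have "concat (map f [0..<n]) = concat (map f [0..<i]) @ f i @ concat (map f [Suc i..<n])" by simp
  then show ?thesis using assms(1) fits_append by metis
qed

lemma fits_set_reg [simp]: "v \<notin> {rM, rB} \<Longrightarrow> fits B Ss (set_reg s v a) = fits B Ss s"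
  by (auto simp: fits_def)

definition ready :: "nat \<Rightarrow> st \<Rightarrow> bool" where
  "ready D s \<longleftrightarrow> scratch_zero s \<and> reg s rD = D"

lemma ready_eff [simp]: "ready D (eff Ss dx dp s) = ready D s"
  by (auto simp: ready_def scratch_zero_def regs)

lemma ready_set_reg [simp]: "v \<notin> {rU, rH, rQ, rY, rD} \<Longrightarrow> ready D (set_reg s v a) = ready D s"
  by (auto simp: ready_def scratch_zero_def)

lemma runs_eff_Seq:
  assumes "runs x B c s (eff Ss dx dp s)" "runs x B d (eff Ss dx dp s) (eff Ts dx' dp' (eff Ss dx dp s))"
  shows "runs x B (c ;; d) s (eff (Ss @ Ts) (dx + dx') (dp + dp') s)"
  using runs_Seq[OF assms] by (simp add: eff_eff)

definition ref :: "nat \<times> nat \<Rightarrow> nat list \<times> nat" where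
  "ref e = (rX # replicate (fst e) rD, snd e)"

lemma num_val_ref: "num_val s (ref e) = reg s rX + fst e * reg s rD + snd e"
  by (simp add: num_val_def ref_def map_replicate_const sum_list_replicate)

fun emit_links :: "nat \<Rightarrow> (nat \<times> nat) list \<Rightarrow> com" where
  "emit_links j [] = Skip"
| "emit_links j (e # T) = emit_edge (ref e) ([rM], 0) ;; emit_edge (ref e) ([rM], j) ;;
     emit_edge ([rM], 0) ([rM], j) ;; emit_links (Suc j) T"

lemma runs_emit_links:
  assumes "ready D s" "\<forall>l\<in>set (inst (reg s rX) D T). l \<le> B" "reg s rM + j + length T \<le> Suc B"
  shows "runs x B (emit_links j T) s (put s (enc_edges (link_edges (reg s rM) (reg s rM + j) (inst (reg s rX) D T))))"
  using assms
proof (induction T arbitrary: s j)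
  case Nil
  show ?case by (simp, rule runs_eqI[OF runs_Skip]) auto
next
  case (Cons e T)
  let ?l = "num_val s (ref e)" and ?m = "reg s rM"
  let ?s1 = "put s (enc_edges [(?l, ?m)])"
  let ?s2 = "put ?s1 (enc_edges [(?l, ?m + j)])"
  let ?s3 = "put ?s2 (enc_edges [(?m, ?m + j)])"
  have l: "?l = reg s rX + fst e * D + snd e" using Cons.prems by (simp add: num_val_ref ready_def)
  have sz: "scratch_zero s" using Cons.prems by (simp add: ready_def)
  have ok: "num_ok B s (ref e)" "num_ok B s ([rM], 0)" "num_ok B s ([rM], j)"
    using Cons.prems l unfolding num_ok_def by (auto simp: ref_def regs num_val_def)
  have v: "num_val s ([rM], i) = ?m + i" for i by (simp add: num_val_def)
  have "runs x B (emit_links (Suc j) T) ?s3 (put ?s3 (enc_edges (link_edges ?m (?m + Suc j) (inst (reg s rX) D T))))"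
    using Cons.IH[of ?s3 "Suc j"] Cons.prems by (simp add: ready_def)
  moreover have "runs x B (emit_edge (ref e) ([rM], 0)) s ?s1"
    using runs_emit_edge[OF sz ok(1,2)] v[of 0] by simp
  moreover have "runs x B (emit_edge (ref e) ([rM], j)) ?s1 ?s2"
    using runs_emit_edge[of ?s1 B "ref e" "([rM], j)" x] sz ok v[of j] by simp
  moreover have "runs x B (emit_edge ([rM], 0) ([rM], j)) ?s2 ?s3"
    using runs_emit_edge[of ?s2 B "([rM], 0)" "([rM], j)" x] sz ok v[of j] v[of 0] by simp
  ultimately have "runs x B (emit_links j (e # T)) s
      (put ?s3 (enc_edges (link_edges ?m (?m + Suc j) (inst (reg s rX) D T))))"
    by (auto intro: runs_Seq)
  then show ?case by (rule runs_eqI) (auto simp: l)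
qed

definition emit_star :: "(nat \<times> nat) list \<Rightarrow> com" where
  "emit_star T = emit_edge ([], 0) ([rM], 0) ;; emit_links 1 T ;; incs rM (Suc (length T)) ;;
     incs rB (if T = [] then 1 else 2 * length T)"

lemma runs_emit_star:
  assumes "ready D s" "fits B [inst (reg s rX) D T] s"
  shows "runs x B (emit_star T) s (eff [inst (reg s rX) D T] 0 0 s)"
proof -
  let ?m = "reg s rM" and ?S = "inst (reg s rX) D T" and ?b = "if T = [] then 1 else 2 * length T"
  have fit: "?m + Suc (length T) \<le> B" "reg s rB + ?b \<le> B" "\<forall>l\<in>set ?S. l \<le> B"
    using assms(2) by (auto simp: fits_def split: if_splits)
  let ?s1 = "put s (enc_edges [(0, ?m)])"
  let ?s2 = "put ?s1 (enc_edges (link_edges ?m (Suc ?m) ?S))"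
  let ?s3 = "set_reg ?s2 rM (?m + Suc (length T))"
  have v: "num_val s ([], 0) = 0" "num_val s ([rM], 0) = ?m" by (auto simp: num_val_def)
  have 1: "runs x B (emit_edge ([], 0) ([rM], 0)) s ?s1"
    using runs_emit_edge[of s B "([], 0)" "([rM], 0)" x] assms(1) fit v
    by (simp add: ready_def num_ok_def regs)
  have 2: "runs x B (emit_links 1 T) ?s1 ?s2"
    using runs_emit_links[of D ?s1 T B 1 x] assms(1) fit by (simp add: ready_def)
  have 3: "runs x B (incs rM (Suc (length T))) ?s2 ?s3"
    by (rule runs_eqI[OF runs_incs]) (use fit in auto)
  have 4: "runs x B (incs rB ?b) ?s3 (set_reg ?s3 rB (reg s rB + ?b))"
    by (rule runs_eqI[OF runs_incs]) (use fit in \<open>auto simp: regs\<close>)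
  have "runs x B (emit_star T) s (set_reg ?s3 rB (reg s rB + ?b))"
    unfolding emit_star_def by (rule runs_Seq[OF 1 runs_Seq[OF 2 runs_Seq[OF 3 4]]])
  then show ?thesis by (rule runs_eqI) (auto simp: regs star_edges_def)
qed

fun emit_stars :: "(nat \<times> nat) list list \<Rightarrow> com" where
  "emit_stars [] = Skip"
| "emit_stars (T # Ts) = emit_star T ;; emit_stars Ts"

lemma runs_emit_stars:
  assumes "ready D s" "fits B (map (inst (reg s rX) D) Ts) s"
  shows "runs x B (emit_stars Ts) s (eff (map (inst (reg s rX) D) Ts) 0 0 s)"
  using assms
proof (induction Ts arbitrary: s)
  case Nil
  show ?case by (simp add: runs_Skip)
next
  case (Cons T Ts)
  let ?S = "inst (reg s rX) D T"
  have fit: "fits B [?S] s" "fits B (map (inst (reg s rX) D) Ts) (eff [?S] 0 0 s)"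
    using Cons.prems(2) fits_Cons[of B ?S "map (inst (reg s rX) D) Ts" s 0 0] by auto
  have "runs x B (emit_stars Ts) (eff [?S] 0 0 s) (eff (map (inst (reg s rX) D) Ts) 0 0 (eff [?S] 0 0 s))"
    using Cons.IH[of "eff [?S] 0 0 s"] Cons.prems fit by simp
  from runs_eff_Seq[OF runs_emit_star[OF Cons.prems(1) fit(1)] this] show ?case by simp
qed

text \<open>Round \<open>i\<close> starts after the stars of the rounds before it. The body may rely
  on all registers except the two counters of the loop and those that emission changes.\<close>

lemma runs_Loop_eff:
  assumes v: "v \<notin> {rX, rM, rB, rU, rH, rQ, rY, rD}" "w \<notin> {rX, rM, rB, rU, rH, rQ, rY, rD}" "v \<noteq> w"
    and s: "ready D s" "reg s w = 0" "reg s v = n" "n \<le> B" "fits B (concat (map f [0..<n])) s"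
    and body: "\<And>i t. i < n \<Longrightarrow> ready D t \<Longrightarrow> (\<And>u. u \<notin> {rX, rM, rB, v, w} \<Longrightarrow> reg t u = reg s u) \<Longrightarrow>
      reg t rX = reg s rX + i * dx \<Longrightarrow> ipos t = ipos s + int i * dp \<Longrightarrow> fits B (f i) t \<Longrightarrow>
      runs x B c t (eff (f i) dx dp t)"
  shows "runs x B (Loop v w c) s (eff (concat (map f [0..<n])) (n * dx) (int n * dp) s)"
proof -
  let ?\<sigma> = "\<lambda>i. eff (concat (map f [0..<i])) (i * dx) (int i * dp) s"
  have "runs x B (Loop v w c) (?\<sigma> 0) (?\<sigma> n)"
  proof (rule runs_Loop)
    fix i a b assume i: "i < n"
    let ?t = "set_reg (set_reg (?\<sigma> i) v a) w b"
    have "runs x B c ?t (eff (f i) dx dp ?t)"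
    proof (rule body[OF i])
      show "fits B (f i) ?t" using fits_concat[OF s(5) i] v by simp
    qed (use v s in auto)
    moreover have "eff (f i) dx dp ?t = set_reg (set_reg (?\<sigma> (Suc i)) v a) w b"
      using v by (simp add: eff_set_reg eff_eff algebra_simps)
    ultimately show "runs x B c ?t (set_reg (set_reg (?\<sigma> (Suc i)) v a) w b)" by simp
  qed (use v s in auto)
  then show ?thesis by simp
qed

definition rL1 :: nat where "rL1 = 14"
definition rL2 :: nat where "rL2 = 15"

definition cells :: "nat \<Rightarrow> (nat \<Rightarrow> (nat \<times> nat) list list) \<Rightarrow> nat \<Rightarrow> nat \<Rightarrow> nat \<Rightarrow> nat list list" where
  "cells D U X k n = concat (map (\<lambda>i. map (inst (X + i * k) D) (U i)) [0..<n])"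

definition seg :: "nat \<Rightarrow> nat \<Rightarrow> com \<Rightarrow> com" where
  "seg k v c = Loop v rL1 (c ;; incs rX k)"

text \<open>The registers of the grid sizes. They are disjoint from the registers used for emission
  and from the auxiliary counters of loops, so they may bound a \<open>Loop\<close>.\<close>

definition loop_reg :: "nat \<Rightarrow> bool" where
  "loop_reg v \<longleftrightarrow> (4 \<le> v \<and> v < 10) \<or> v = 16"

lemma runs_seg:
  assumes v: "loop_reg v"
    and s: "ready D s" "reg s rL1 = 0" "reg s v = n" "n \<le> B" "fits B (cells D U (reg s rX) k n) s" "reg s rX + n * k \<le> B"
    and body: "\<And>i t. i < n \<Longrightarrow> ready D t \<Longrightarrow> reg t rX = reg s rX + i * k \<Longrightarrow> ipos t = ipos s + int i * dp \<Longrightarrow>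
      fits B (map (inst (reg t rX) D) (U i)) t \<Longrightarrow> runs x B c t (eff (map (inst (reg t rX) D) (U i)) 0 dp t)"
  shows "runs x B (seg k v c) s (eff (cells D U (reg s rX) k n) (n * k) (int n * dp) s)"
  unfolding seg_def cells_def
proof (rule runs_Loop_eff)
  fix i t assume i: "i < n" and t: "ready D t" "reg t rX = reg s rX + i * k" "ipos t = ipos s + int i * dp"
    "fits B (map (inst (reg s rX + i * k) D) (U i)) t"
  let ?t = "eff (map (inst (reg s rX + i * k) D) (U i)) 0 dp t"
  have "runs x B c t ?t" using body[OF i t(1-3)] t by simp
  moreover have "Suc i * k \<le> n * k" using i by (intro mult_le_mono1) simp
  then have "runs x B (incs rX k) ?t (eff [] k 0 ?t)"
    by (intro runs_eqI[OF runs_incs]) (use t s in \<open>auto simp: regs\<close>)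
  ultimately show "runs x B (c ;; incs rX k) t (eff (map (inst (reg s rX + i * k) D) (U i)) k dp t)"
    using runs_eff_Seq[of x B c t _ 0 dp] by fastforce
qed (use s v in \<open>auto simp: cells_def loop_reg_def regs rL1_def\<close>)

lemma runs_seg_const:
  assumes "loop_reg v" "ready D s" "reg s rL1 = 0" "reg s v = n" "n \<le> B"
    "fits B (cells D (\<lambda>_. Ts) (reg s rX) k n) s" "reg s rX + n * k \<le> B"
  shows "runs x B (seg k v (emit_stars Ts)) s (eff (cells D (\<lambda>_. Ts) (reg s rX) k n) (n * k) 0 s)"
proof -
  have "runs x B (seg k v (emit_stars Ts)) s (eff (cells D (\<lambda>_. Ts) (reg s rX) k n) (n * k) (int n * 0) s)"
    by (rule runs_seg[where D = D, OF assms(1-7)]) (rule runs_emit_stars)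
  then show ?thesis by simp
qed

lemma runs_moveL:
  assumes "loop_reg v" "reg s rL1 = 0" "reg s v = n" "n \<le> B" 
  shows "runs x B (Loop v rL1 InL) s (eff [] 0 (- int n) s)"
proof -
  have "runs x B (Loop v rL1 InL) (eff [] 0 (- int 0) s) (eff [] 0 (- int n) s)"
  proof (rule runs_Loop[where \<sigma> = "\<lambda>i. eff [] 0 (- int i) s"])
    show "runs x B InL (set_reg (set_reg (eff [] 0 (- int i) s) v a) rL1 b)
        (set_reg (set_reg (eff [] 0 (- int (Suc i)) s) v a) rL1 b)" for i a b
      by (rule runs_eqI[OF runs_InL]) auto
  qed (use assms in \<open>auto simp: loop_reg_def rL1_def regs\<close>)
  then show ?thesis by simp
qed

section \<open>The reduction as a counter program\<close>

text \<open>The encoding starts with the number of vertices, which is known only once all stars have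
  been produced. A silent first run of the same program computes it.\<close>

fun mute :: "com \<Rightarrow> com" where
  "mute (Out b) = Skip"
| "mute (c ;; d) = mute c ;; mute d"
| "mute (IfZ v c d) = IfZ v (mute c) (mute d)"
| "mute (For v c) = For v (mute c)"
| "mute (CaseIn c d e) = CaseIn (mute c) (mute d) (mute e)"
| "mute c = c"

definition set_out :: "st \<Rightarrow> bool list \<Rightarrow> st" where
  "set_out s bs = s\<lparr>outp := bs\<rparr>"

lemma set_out_simps [simp]:
  "reg (set_out s bs) = reg s" "ipos (set_out s bs) = ipos s" "outp (set_out s bs) = bs"
  by (auto simp: set_out_def)

lemma st_commute:
  fixes s :: st
  shows "s\<lparr>reg := f, outp := bs\<rparr> = s\<lparr>outp := bs, reg := f\<rparr>"
    "s\<lparr>ipos := i, outp := bs\<rparr> = s\<lparr>outp := bs, ipos := i\<rparr>"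
    "s\<lparr>reg := f, ipos := i, outp := bs\<rparr> = s\<lparr>outp := bs, reg := f, ipos := i\<rparr>"
  by (rule st.equality; simp)+

lemma exec_mute: "exec x B c s t s' \<Longrightarrow> \<exists>t'. exec x B (mute c) (s\<lparr>outp := bs\<rparr>) t' (s'\<lparr>outp := bs\<rparr>)"
proof (induction rule: exec.induct)
  case (Inc s v)
  then show ?case using exec.Inc[of "s\<lparr>outp := bs\<rparr>" v B x] by (auto simp: st_commute)
next
  case (InL s)
  then show ?case using exec.InL[of x B "s\<lparr>outp := bs\<rparr>"] by (auto simp: st_commute)
next
  case (InR s)
  then show ?case using exec.InR[of x B "s\<lparr>outp := bs\<rparr>"] by (auto simp: st_commute)
next
  case (IfZ_zero s v c t s' d)
  then show ?case using exec.IfZ_zero[of "s\<lparr>outp := bs\<rparr>" v] by fastforce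
next
  case (IfZ_pos s v d t s' c)
  then show ?case using exec.IfZ_pos[of "s\<lparr>outp := bs\<rparr>" v] by fastforce
next
  case (For_zero s v c)
  then show ?case using exec.For_zero[of "s\<lparr>outp := bs\<rparr>" v] by fastforce
next
  case (For_Suc s v n c t s' t' s'')
  then obtain t1 t2 where "exec x B (mute c) (upd_reg (s\<lparr>outp := bs\<rparr>) v n) t1 (s'\<lparr>outp := bs\<rparr>)"
    "exec x B (For v (mute c)) (s'\<lparr>outp := bs\<rparr>) t2 (s''\<lparr>outp := bs\<rparr>)" by (auto simp: st_commute)
  from exec.For_Suc[OF _ this(1) _ this(2)] For_Suc.hyps show ?case by auto
next
  case (CaseIn_0 s c t s' d e)
  then show ?case using exec.CaseIn_0[of x "s\<lparr>outp := bs\<rparr>"] by fastforce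
next
  case (CaseIn_1 s c t s' d e)
  then show ?case using exec.CaseIn_1[of x "s\<lparr>outp := bs\<rparr>"] by fastforce
next
  case (CaseIn_2 s c t s' d e)
  then show ?case using exec.CaseIn_2[of x "s\<lparr>outp := bs\<rparr>"] by fastforce
next
  case (Scan n s v)
  then show ?case using exec.Scan[of n x "s\<lparr>outp := bs\<rparr>" v B] by (auto simp: st_commute)
qed (auto intro: exec.intros)

lemma runs_mute:
  assumes "runs x B c s s'" shows "runs x B (mute c) s (set_out s' (outp s))"
proof -
  obtain t where "exec x B c s t s'" using assms by (auto simp: runs_def)
  from exec_mute[OF this, of "outp s"] show ?thesis by (simp add: runs_def set_out_def)
qed

lemma runs_transfer:
  assumes "u \<noteq> v" "reg s u + reg s v \<le> B"
  shows "runs x B (For v (Inc u)) s (set_reg (set_reg s u (reg s u + reg s v)) v 0)"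
proof -
  define \<sigma> where "\<sigma> i = set_reg (set_reg s u (reg s u + i)) v (reg s v - i)" for i
  have "runs x B (For v (Inc u)) (\<sigma> 0) (\<sigma> (reg s v))"
  proof (rule runs_For)
    show "runs x B (Inc u) (set_reg (\<sigma> i) v (reg s v - Suc i)) (\<sigma> (Suc i))" if "i < reg s v" for i
      by (rule runs_eqI[OF runs_Inc]) (use that assms in \<open>auto simp: \<sigma>_def\<close>)
  qed (use assms in \<open>auto simp: \<sigma>_def\<close>)
  moreover have "\<sigma> 0 = s" by (rule st_eqI) (auto simp: \<sigma>_def)
  ultimately show ?thesis by (simp add: \<sigma>_def)
qed

section \<open>Evaluation of polynomials\<close>

definition "rN = (4 :: nat)"
definition "rP = (5 :: nat)"
definition "rT = (6 :: nat)"
definition "rL = (7 :: nat)"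
definition "rI = (8 :: nat)"
definition "rW = (9 :: nat)"
definition "rO = (16 :: nat)"

lemmas regs' = regs rN_def rP_def rT_def rL_def rI_def rW_def rO_def rL1_def rL2_def

fun horner :: "nat \<Rightarrow> nat list \<Rightarrow> com" where
  "horner d [] = Skip"
| "horner d (a # cs) = horner d cs ;; For d (Loop rN rH (incs rY 1)) ;; For rY (Inc d) ;; incs d a"

lemma poly_Poly_mono: "n \<le> m \<Longrightarrow> poly (Poly cs) (n :: nat) \<le> poly (Poly cs) m"
  by (induction cs) (auto intro!: add_mono mult_mono)

text \<open>The intermediate values have to be bounded as well. At the argument 0 the final value
  says nothing about them, whereas at \<open>Suc n\<close> every inner value is at most the outer
  one.\<close>

lemma runs_horner:
  assumes "d \<notin> {rN, rH, rY}" "reg s d = 0" "reg s rH = 0" "reg s rY = 0" "reg s rN = n" "n \<le> B"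
    "poly (Poly cs) (Suc n) \<le> B"
  shows "runs x B (horner d cs) s (set_reg s d (poly (Poly cs) n))"
  using assms(7)
proof (induction cs)
  case Nil
  show ?case by (simp, rule runs_eqI[OF runs_Skip]) (use assms in auto)
next
  case (Cons a cs)
  let ?m = "poly (Poly cs) n"
  have le: "?m \<le> poly (Poly cs) (Suc n)" "a + (poly (Poly cs) (Suc n) + n * poly (Poly cs) (Suc n)) \<le> B"
    using Cons.prems poly_Poly_mono[of n "Suc n" cs] by auto
  have "n * ?m \<le> n * poly (Poly cs) (Suc n)" using le by simp
  then have b: "?m \<le> B" "a + n * ?m \<le> B" using le by linarith+
  define \<sigma> where "\<sigma> i = set_reg (set_reg s d (?m - i)) rY (i * n)" for i
  let ?s3 = "set_reg (set_reg (\<sigma> ?m) d (reg (\<sigma> ?m) d + reg (\<sigma> ?m) rY)) rY 0"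
  have 1: "runs x B (horner d cs) s (\<sigma> 0)"
    by (rule runs_eqI[OF Cons.IH]) (use le assms in \<open>auto simp: \<sigma>_def\<close>)
  have 2: "runs x B (For d (Loop rN rH (incs rY 1))) (\<sigma> 0) (\<sigma> ?m)"
  proof (rule runs_For)
    fix i assume i: "i < ?m"
    then have "Suc i * n \<le> ?m * n" by (intro mult_le_mono1) simp
    then have "Suc i * n \<le> B" using b(2) by (simp add: mult.commute)
    then show "runs x B (Loop rN rH (incs rY 1)) (set_reg (\<sigma> i) d (?m - Suc i)) (\<sigma> (Suc i))"
      by (intro runs_eqI[OF runs_add]) (use assms i in \<open>auto simp: \<sigma>_def regs'\<close>)
  qed (use assms in \<open>auto simp: \<sigma>_def\<close>)
  have 3: "runs x B (For rY (Inc d)) (\<sigma> ?m) ?s3"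
    by (rule runs_transfer) (use assms b in \<open>auto simp: \<sigma>_def mult.commute\<close>)
  have 4: "runs x B (incs d a) ?s3 (set_reg ?s3 d (reg ?s3 d + a))"
    by (rule runs_incs) (use assms b in \<open>auto simp: \<sigma>_def mult.commute\<close>)
  have "runs x B (horner d (a # cs)) s (set_reg ?s3 d (reg ?s3 d + a))"
    unfolding horner.simps by (rule runs_Seq[OF 1 runs_Seq[OF 2 runs_Seq[OF 3 4]]])
  then show ?case by (rule runs_eqI) (use assms in \<open>auto simp: \<sigma>_def mult.commute\<close>)
qed

section \<open>The program that walks over the grid\<close>

type_synonym template = "(nat \<times> nat) list list"

text \<open>\<open>K\<close> is the number of variables per cell. The templates stand for the
  variables of a cell (\<open>TV\<close>), a step (\<open>TW\<close>), the final row
  (\<open>TF\<close>), the head column (\<open>TH\<close>), other columns (\<open>TN\<close>), a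
  blank certificate cell (\<open>TB\<close>), a certificate cell (\<open>TC\<close>) and an input
  symbol (\<open>TI\<close>).\<close>

locale emitter =
  fixes K :: nat and TV TW TF TH TN TB TC :: template and TI :: "nat \<Rightarrow> template"
    and p q :: "nat poly"
begin

abbreviation "k \<equiv> 6 * K"

definition read_input :: com where
  "read_input = CaseIn (emit_stars (TI 0)) (emit_stars (TI 1)) (emit_stars (TI 2))"

text \<open>Step constraints leave out the last two columns of a row, hence the skip by
  \<open>2 * k\<close>. For the input constraints the head starts \<open>nL x\<close> cells to the
  left of the word, so that column \<open>i\<close> reads position \<open>i - nL x\<close>.
  Afterwards head and base address are restored, which allows running the program twice.\<close>

definition edge_program :: com where
  "edge_program =
    (Loop rT rL2 (seg k rW (emit_stars TV)) ;; seg k rW (emit_stars TV) ;; clear rX) ;;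
    (Loop rT rL2 (seg k rI (emit_stars TW) ;; incs rX (2 * k)) ;; seg k rI (emit_stars TF) ;; clear rX) ;;
    Loop rL rL1 InL ;;
    (seg k rL (read_input ;; emit_stars TN ;; InR) ;; seg k rO (read_input ;; emit_stars TH ;; InR) ;;
     seg k rL (read_input ;; emit_stars TN ;; InR) ;; seg k rP (read_input ;; emit_stars TN ;; InR) ;; clear rX) ;;
    (Loop rL rL1 InL ;; Loop rP rL1 InL ;; Loop rO rL1 InL) ;;
    (seg k rL (emit_stars TB) ;; seg k rP (emit_stars TC) ;; seg k rL (emit_stars TB) ;;
     seg k rO (emit_stars TB) ;; clear rX)"

text \<open>Length bound of certificates, number of steps, width of the halves of the grid, number of
  constrained columns and row length.\<close>

definition "nP x = poly p (length x)" for x :: "bool list"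
definition "nT x = poly q (length x)" for x :: "bool list"
definition "nL x = 2 * nT x"
definition "nI x = 2 * nL x + nP x + 1"
definition "nW x = nI x + 2"
definition "nD x = k * nW x"

definition input_templates :: "bool list \<Rightarrow> nat \<Rightarrow> template" where
  "input_templates x i = TI (inscription x (int i - int (nL x))) @ (if i = nL x then TH else TN)"

definition cert_templates :: "bool list \<Rightarrow> nat \<Rightarrow> template" where
  "cert_templates x i = (if nL x \<le> i \<and> i < nL x + nP x then TC else TB)"

definition grid_rows :: "template \<Rightarrow> bool list \<Rightarrow> nat \<Rightarrow> nat list list" where
  "grid_rows T x n = concat (map (\<lambda>t. cells (nD x) (\<lambda>_. T) (t * (nW x * k)) k n) [0..<nT x])"

definition all_stars :: "bool list \<Rightarrow> nat list list" where
  "all_stars x =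
     grid_rows TV x (nW x) @ cells (nD x) (\<lambda>_. TV) (nT x * (nW x * k)) k (nW x) @
     grid_rows TW x (nI x) @ cells (nD x) (\<lambda>_. TF) (nT x * (nW x * k)) k (nI x) @
     cells (nD x) (input_templates x) 0 k (nI x) @ cells (nD x) (cert_templates x) 0 k (nI x)"

lemma cells_append: "cells D U X k' (a + b) = cells D U X k' a @ cells D (\<lambda>i. U (a + i)) (X + a * k') k' b"
proof -
  have "[0..<a + b] = [0..<a] @ map (\<lambda>i. a + i) [0..<b]"
    by (simp add: upt_add_eq_append[of 0 a b] map_add_upt add.commute)
  then show ?thesis by (simp add: cells_def comp_def algebra_simps)
qed

lemma cells_cong: "X = X' \<Longrightarrow> (\<And>i. i < n \<Longrightarrow> U i = U' i) \<Longrightarrow> cells D U X k' n = cells D U' X' k' n"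
  unfolding cells_def by (intro arg_cong[of _ _ concat] map_cong) auto

context
  fixes x :: "bool list" and B :: nat and s :: st
  assumes s: "ready (nD x) s" "reg s rL1 = 0" "reg s rL2 = 0" "reg s rX = 0" "ipos s = 0"
    "reg s rP = nP x" "reg s rT = nT x" "reg s rL = nL x" "reg s rI = nI x" "reg s rW = nW x" "reg s rO = 1"
    and B: "fits B (all_stars x) s" "(nT x + 1) * (nW x * k) \<le> B" "nW x \<le> B" "nT x \<le> B"
begin

lemma sizes_le: "nI x \<le> B" "nL x \<le> B" "nP x \<le> B" "1 \<le> B"
  using B(3) by (auto simp: nW_def nI_def)

lemma step_clear: "runs x B (clear rX) (eff Ss dx dp s) (eff Ss 0 dp s)"
  by (rule runs_eqI[OF runs_clear]) (use s in \<open>auto simp: regs\<close>)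

lemma step_left:
  assumes "loop_reg v" "reg s v = n" "n \<le> B"
  shows "runs x B (Loop v rL1 InL) (eff Ss dx dp s) (eff Ss dx (dp - int n) s)"
proof -
  have "runs x B (Loop v rL1 InL) (eff Ss dx dp s) (eff [] 0 (- int n) (eff Ss dx dp s))"
    using assms s by (intro runs_moveL) (auto simp: loop_reg_def regs')
  then show ?thesis by (simp add: eff_eff)
qed

lemma step_seg:
  assumes "loop_reg v" "reg s v = n" "n \<le> B" "fits B (Ss @ cells (nD x) (\<lambda>_. Ts) dx k n) s" "dx + n * k \<le> B"
  shows "runs x B (seg k v (emit_stars Ts)) (eff Ss dx dp s) (eff (Ss @ cells (nD x) (\<lambda>_. Ts) dx k n) (dx + n * k) dp s)"
proof -
  have "runs x B (seg k v (emit_stars Ts)) (eff Ss dx dp s)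
      (eff (cells (nD x) (\<lambda>_. Ts) (reg (eff Ss dx dp s) rX) k n) (n * k) 0 (eff Ss dx dp s))"
    using assms s fits_append[of B Ss _ s dx dp]
    by (intro runs_seg_const) (auto simp: loop_reg_def regs')
  then show ?thesis using s by (simp add: eff_eff)
qed

lemma step_input:
  assumes "loop_reg v" "reg s v = n" "n \<le> B" "dx + n * k \<le> B"
    and U: "\<And>i. U i = TI (inscription x (dp + int i)) @ Ts"
    and fit: "fits B (Ss @ cells (nD x) U dx k n) s"
  shows "runs x B (seg k v (read_input ;; emit_stars Ts ;; InR)) (eff Ss dx dp s)
    (eff (Ss @ cells (nD x) U dx k n) (dx + n * k) (dp + int n) s)"
proof -
  let ?s = "eff Ss dx dp s"
  have "runs x B (seg k v (read_input ;; emit_stars Ts ;; InR)) ?s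
      (eff (cells (nD x) U (reg ?s rX) k n) (n * k) (int n * 1) ?s)"
  proof (rule runs_seg)
    fix i t assume t: "i < n" "ready (nD x) t" "ipos t = ipos ?s + int i * 1"
      "fits B (map (inst (reg t rX) (nD x)) (U i)) t"
    let ?i = "map (inst (reg t rX) (nD x))"
    have pos: "ipos t = dp + int i" using t s by simp
    have fit: "fits B (?i (TI (inscription x (ipos t)))) t"
      "fits B (?i Ts) (eff (?i (TI (inscription x (ipos t)))) 0 0 t)"
      using t(4) fits_append[of B "?i (TI (inscription x (ipos t)))" "?i Ts" t 0 0] U pos by auto
    have "inscription x (ipos t) \<in> {0, 1, 2}" by (auto simp: inscription_def bit_sym_def)
    then have 1: "runs x B read_input t (eff (?i (TI (inscription x (ipos t)))) 0 0 t)"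
      unfolding read_input_def using fit(1) t(2)
      by (intro runs_CaseIn) (auto intro: runs_emit_stars)
    let ?t = "eff (?i (TI (inscription x (ipos t)))) 0 0 t"
    have "runs x B (emit_stars Ts) ?t (eff (map (inst (reg ?t rX) (nD x)) Ts) 0 0 ?t)"
      by (rule runs_emit_stars) (use t fit in \<open>auto simp: regs\<close>)
    then have 2: "runs x B (emit_stars Ts) ?t (eff (?i (U i)) 0 0 t)"
      by (simp add: eff_eff U pos regs)
    have 3: "runs x B InR (eff (?i (U i)) 0 0 t) (eff (?i (U i)) 0 1 t)"
      by (rule runs_eqI[OF runs_InR]) auto
    show "runs x B (read_input ;; emit_stars Ts ;; InR) t (eff (?i (U i)) 0 1 t)"
      by (rule runs_Seq[OF 1 runs_Seq[OF 2 3]])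
  next
    show "fits B (cells (nD x) U (reg ?s rX) k n) ?s"
      using fit s fits_append[of B Ss _ s dx dp] by simp
  qed (use assms s in \<open>auto simp: loop_reg_def regs'\<close>)
  then show ?thesis using s by (simp add: eff_eff)
qed

lemma step_rows:
  assumes c: "\<And>i t. i < nT x \<Longrightarrow> ready (nD x) t \<Longrightarrow> (\<And>u. u \<notin> {rX, rM, rB, rT, rL2} \<Longrightarrow> reg t u = reg s u) \<Longrightarrow>
      reg t rX = i * (nW x * k) \<Longrightarrow> fits B (cells (nD x) (\<lambda>_. Ts) (reg t rX) k n) t \<Longrightarrow>
      runs x B c t (eff (cells (nD x) (\<lambda>_. Ts) (reg t rX) k n) (nW x * k) 0 t)"
    and fit: "fits B (Ss @ grid_rows Ts x n) s"
  shows "runs x B (Loop rT rL2 c) (eff Ss 0 dp s) (eff (Ss @ grid_rows Ts x n) (nT x * (nW x * k)) dp s)"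
proof -
  have "runs x B (Loop rT rL2 c) (eff Ss 0 dp s)
      (eff (grid_rows Ts x n) (nT x * (nW x * k)) (int (nT x) * 0) (eff Ss 0 dp s))"
    unfolding grid_rows_def
  proof (rule runs_Loop_eff[where D = "nD x"])
    fix i t assume t: "i < nT x" "ready (nD x) t" "\<And>u. u \<notin> {rX, rM, rB, rT, rL2} \<Longrightarrow> reg t u = reg (eff Ss 0 dp s) u"
      "reg t rX = reg (eff Ss 0 dp s) rX + i * (nW x * k)"
      "fits B (cells (nD x) (\<lambda>_. Ts) (i * (nW x * k)) k n) t"
    have X: "reg t rX = i * (nW x * k)" using t(4) s by simp
    have "runs x B c t (eff (cells (nD x) (\<lambda>_. Ts) (reg t rX) k n) (nW x * k) 0 t)"
      using t X by (intro c) auto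
    then show "runs x B c t (eff (cells (nD x) (\<lambda>_. Ts) (i * (nW x * k)) k n) (nW x * k) 0 t)" by (simp add: X)
  next
    show "fits B (concat (map (\<lambda>t. cells (nD x) (\<lambda>_. Ts) (t * (nW x * k)) k n) [0..<nT x])) (eff Ss 0 dp s)"
      using fit fits_append[of B Ss _ s 0 dp] by (simp add: grid_rows_def)
  qed (use s B in \<open>auto simp: regs'\<close>)
  then show ?thesis by (simp add: eff_eff)
qed

text \<open>The row is cut on both sides of the head column and then into pieces whose lengths are
  the values of registers, as required by \<open>seg\<close>. The single column is a loop over
  \<open>rO\<close>, which holds 1.\<close>

lemma input_cells:
  "cells (nD x) (input_templates x) 0 k (nI x) =
    cells (nD x) (\<lambda>i. TI (inscription x (- int (nL x) + int i)) @ TN) 0 k (nL x) @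
    cells (nD x) (\<lambda>i. TI (inscription x (0 + int i)) @ TH) (nL x * k) k 1 @
    cells (nD x) (\<lambda>i. TI (inscription x (1 + int i)) @ TN) (nL x * k + 1 * k) k (nL x) @
    cells (nD x) (\<lambda>i. TI (inscription x (1 + int (nL x) + int i)) @ TN) (nL x * k + 1 * k + nL x * k) k (nP x)"
proof -
  have "nI x = nL x + (1 + (nL x + nP x))" by (simp add: nI_def)
  then show ?thesis
    by (simp only: cells_append append_assoc)
      (intro arg_cong2[of _ _ _ _ append] cells_cong; simp add: input_templates_def algebra_simps)
qed

lemma cert_cells:
  "cells (nD x) (cert_templates x) 0 k (nI x) =
    cells (nD x) (\<lambda>_. TB) 0 k (nL x) @ cells (nD x) (\<lambda>_. TC) (nL x * k) k (nP x) @
    cells (nD x) (\<lambda>_. TB) (nL x * k + nP x * k) k (nL x) @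
    cells (nD x) (\<lambda>_. TB) (nL x * k + nP x * k + nL x * k) k 1"
proof -
  have "nI x = nL x + (nP x + (nL x + 1))" by (simp add: nI_def)
  then show ?thesis
    by (simp only: cells_append append_assoc)
      (intro arg_cong2[of _ _ _ _ append] cells_cong; simp add: cert_templates_def algebra_simps)
qed

lemma runs_edge_program: "runs x B edge_program s (eff (all_stars x) 0 0 s)"
proof -
  note lr = loop_reg_def regs'
  define d where "d = nT x * (nW x * k)"
  \<comment> \<open>\<open>A1\<close> to \<open>A12\<close> are the stars emitted after the
    successive commands, each a prefix of the next.\<close>
  define A1 where "A1 = grid_rows TV x (nW x)"
  define A2 where "A2 = A1 @ cells (nD x) (\<lambda>_. TV) d k (nW x)"
  define A3 where "A3 = A2 @ grid_rows TW x (nI x)"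
  define A4 where "A4 = A3 @ cells (nD x) (\<lambda>_. TF) d k (nI x)"
  define A5 where "A5 = A4 @ cells (nD x) (\<lambda>i. TI (inscription x (- int (nL x) + int i)) @ TN) 0 k (nL x)"
  define A6 where "A6 = A5 @ cells (nD x) (\<lambda>i. TI (inscription x (0 + int i)) @ TH) (nL x * k) k 1"
  define A7 where "A7 = A6 @ cells (nD x) (\<lambda>i. TI (inscription x (1 + int i)) @ TN) (nL x * k + 1 * k) k (nL x)"
  define A8 where "A8 = A7 @ cells (nD x) (\<lambda>i. TI (inscription x (1 + int (nL x) + int i)) @ TN)
      (nL x * k + 1 * k + nL x * k) k (nP x)"
  define A9 where "A9 = A8 @ cells (nD x) (\<lambda>_. TB) 0 k (nL x)"
  define A10 where "A10 = A9 @ cells (nD x) (\<lambda>_. TC) (nL x * k) k (nP x)"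
  define A11 where "A11 = A10 @ cells (nD x) (\<lambda>_. TB) (nL x * k + nP x * k) k (nL x)"
  define A12 where "A12 = A11 @ cells (nD x) (\<lambda>_. TB) (nL x * k + nP x * k + nL x * k) k 1"
  have all: "all_stars x = A12"
    unfolding all_stars_def input_cells cert_cells A1_def A2_def A3_def A4_def A5_def A6_def A7_def
      A8_def A9_def A10_def A11_def A12_def d_def by (simp only: append_assoc)
  have pre: "fits B Us s" if "fits B (Us @ Vs) s" for Us Vs using that fits_append by blast
  have f12: "fits B A12 s" using B(1) all by simp
  have f11: "fits B A11 s" using f12 pre unfolding A12_def by blast
  have f10: "fits B A10 s" using f11 pre unfolding A11_def by blast
  have f9: "fits B A9 s" using f10 pre unfolding A10_def by blast
  have f8: "fits B A8 s" using f9 pre unfolding A9_def by blast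
  have f7: "fits B A7 s" using f8 pre unfolding A8_def by blast
  have f6: "fits B A6 s" using f7 pre unfolding A7_def by blast
  have f5: "fits B A5 s" using f6 pre unfolding A6_def by blast
  have f4: "fits B A4 s" using f5 pre unfolding A5_def by blast
  have f3: "fits B A3 s" using f4 pre unfolding A4_def by blast
  have f2: "fits B A2 s" using f3 pre unfolding A3_def by blast
  have f1: "fits B A1 s" using f2 pre unfolding A2_def by blast
  have Wk: "nW x * k \<le> B" "d + nW x * k \<le> B" using B(2) by (auto simp: d_def)
  have Ik: "nI x * k \<le> nW x * k" by (intro mult_le_mono1) (simp add: nW_def)
  have dIk: "d + nI x * k \<le> B" "nI x * k \<le> B" using Wk Ik by linarith+
  have parts: "nI x * k = nL x * k + nL x * k + nP x * k + k" by (simp add: nI_def algebra_simps)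
  have sums: "nL x * k \<le> B" "nL x * k + 1 * k \<le> B" "nL x * k + 1 * k + nL x * k \<le> B"
    "nL x * k + 1 * k + nL x * k + nP x * k \<le> B" "nL x * k + nP x * k \<le> B"
    "nL x * k + nP x * k + nL x * k \<le> B" "nL x * k + nP x * k + nL x * k + 1 * k \<le> B"
    using parts dIk by linarith+
  have row_X: "i * (nW x * k) + nW x * k \<le> B" if "i < nT x" for i
  proof -
    have "Suc i * (nW x * k) \<le> (nT x + 1) * (nW x * k)" using that by (intro mult_le_mono1) simp
    moreover have "i * (nW x * k) + nW x * k = Suc i * (nW x * k)" by simp
    ultimately show ?thesis using B(2) by linarith
  qed
  have 1: "runs x B (Loop rT rL2 (seg k rW (emit_stars TV))) s (eff A1 d 0 s)"
  proof -
    have "runs x B (Loop rT rL2 (seg k rW (emit_stars TV))) (eff [] 0 0 s) (eff ([] @ grid_rows TV x (nW x)) d 0 s)"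
      unfolding d_def
    proof (rule step_rows)
      fix i t assume t: "i < nT x" "ready (nD x) t" "\<And>u. u \<notin> {rX, rM, rB, rT, rL2} \<Longrightarrow> reg t u = reg s u"
        "reg t rX = i * (nW x * k)" "fits B (cells (nD x) (\<lambda>_. TV) (reg t rX) k (nW x)) t"
      have "reg t rW = nW x" "reg t rL1 = 0" using t(3)[of rW] t(3)[of rL1] s by (auto simp: regs')
      then show "runs x B (seg k rW (emit_stars TV)) t (eff (cells (nD x) (\<lambda>_. TV) (reg t rX) k (nW x)) (nW x * k) 0 t)"
        using t(2,4,5) row_X[OF t(1)] B(3) by (intro runs_seg_const) (auto simp: lr)
    qed (use f1 in \<open>simp add: A1_def\<close>)
    then show ?thesis by (simp add: A1_def)
  qed
  have 2: "runs x B (seg k rW (emit_stars TV)) (eff A1 d 0 s) (eff A2 (d + nW x * k) 0 s)"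
    unfolding A2_def by (rule step_seg) (use s B f2 Wk in \<open>auto simp: lr A2_def\<close>)
  have 3: "runs x B (Loop rT rL2 (seg k rI (emit_stars TW) ;; incs rX (2 * k))) (eff A2 0 0 s) (eff A3 d 0 s)"
    unfolding A3_def d_def
  proof (rule step_rows)
    fix i t assume t: "i < nT x" "ready (nD x) t" "\<And>u. u \<notin> {rX, rM, rB, rT, rL2} \<Longrightarrow> reg t u = reg s u"
      "reg t rX = i * (nW x * k)" "fits B (cells (nD x) (\<lambda>_. TW) (reg t rX) k (nI x)) t"
    let ?C = "cells (nD x) (\<lambda>_. TW) (reg t rX) k (nI x)"
    have "reg t rI = nI x" "reg t rL1 = 0" using t(3)[of rI] t(3)[of rL1] s by (auto simp: regs')
    moreover have "reg t rX + nI x * k \<le> B" using row_X[OF t(1)] Ik t(4) by linarith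
    ultimately have 1: "runs x B (seg k rI (emit_stars TW)) t (eff ?C (nI x * k) 0 t)"
      using t(2,5) sizes_le by (intro runs_seg_const) (auto simp: lr)
    have W: "nI x * k + 2 * k = nW x * k" by (simp add: nW_def algebra_simps)
    have "runs x B (incs rX (2 * k)) (eff ?C (nI x * k) 0 t) (eff [] (2 * k) 0 (eff ?C (nI x * k) 0 t))"
      by (rule runs_eqI[OF runs_incs]) (use row_X[OF t(1)] W t(4) in \<open>auto simp: regs\<close>)
    from runs_eff_Seq[OF 1 this] W
    show "runs x B (seg k rI (emit_stars TW) ;; incs rX (2 * k)) t (eff ?C (nW x * k) 0 t)" by simp
  qed (use f3 in \<open>simp add: A3_def\<close>)
  have 4: "runs x B (seg k rI (emit_stars TF)) (eff A3 d 0 s) (eff A4 (d + nI x * k) 0 s)"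
    unfolding A4_def by (rule step_seg) (use s f4 dIk sizes_le in \<open>auto simp: lr A4_def\<close>)
  have 5: "runs x B (Loop rL rL1 InL) (eff A4 0 0 s) (eff A4 0 (- int (nL x)) s)"
    using step_left[of rL "nL x" A4 0 0] s sizes_le by (simp add: lr)
  have 6: "runs x B (seg k rL (read_input ;; emit_stars TN ;; InR)) (eff A4 0 (- int (nL x)) s) (eff A5 (nL x * k) 0 s)"
    using step_input[of rL "nL x" 0 "\<lambda>i. TI (inscription x (- int (nL x) + int i)) @ TN" "- int (nL x)" TN A4]
      s f5 sums sizes_le by (simp add: lr A5_def)
  have 7: "runs x B (seg k rO (read_input ;; emit_stars TH ;; InR)) (eff A5 (nL x * k) 0 s) (eff A6 (nL x * k + 1 * k) 1 s)"
    using step_input[of rO 1 "nL x * k" "\<lambda>i. TI (inscription x (0 + int i)) @ TH" 0 TH A5]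
      s f6 sums sizes_le by (simp add: lr A6_def)
  have 8: "runs x B (seg k rL (read_input ;; emit_stars TN ;; InR)) (eff A6 (nL x * k + 1 * k) 1 s)
      (eff A7 (nL x * k + 1 * k + nL x * k) (1 + int (nL x)) s)"
    using step_input[of rL "nL x" "nL x * k + 1 * k" "\<lambda>i. TI (inscription x (1 + int i)) @ TN" 1 TN A6]
      s f7 sums sizes_le by (simp add: lr A7_def)
  have 9: "runs x B (seg k rP (read_input ;; emit_stars TN ;; InR)) (eff A7 (nL x * k + 1 * k + nL x * k) (1 + int (nL x)) s)
      (eff A8 (nL x * k + 1 * k + nL x * k + nP x * k) (1 + int (nL x) + int (nP x)) s)"
    using step_input[of rP "nP x" "nL x * k + 1 * k + nL x * k"
        "\<lambda>i. TI (inscription x (1 + int (nL x) + int i)) @ TN" "1 + int (nL x)" TN A7]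
      s f8 sums sizes_le by (simp add: lr A8_def)
  have 10: "runs x B (Loop rL rL1 InL) (eff A8 0 (1 + int (nL x) + int (nP x)) s) (eff A8 0 (1 + int (nP x)) s)"
    using step_left[of rL "nL x" A8 0 "1 + int (nL x) + int (nP x)"] s sizes_le by (simp add: lr)
  have 11: "runs x B (Loop rP rL1 InL) (eff A8 0 (1 + int (nP x)) s) (eff A8 0 1 s)"
    using step_left[of rP "nP x" A8 0 "1 + int (nP x)"] s sizes_le by (simp add: lr)
  have 12: "runs x B (Loop rO rL1 InL) (eff A8 0 1 s) (eff A8 0 0 s)"
    using step_left[of rO 1 A8 0 1] s sizes_le by (simp add: lr)
  have 13: "runs x B (seg k rL (emit_stars TB)) (eff A8 0 0 s) (eff A9 (nL x * k) 0 s)"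
    using step_seg[of rL "nL x" A8 TB 0 0] s f9 sums sizes_le by (simp add: lr A9_def)
  have 14: "runs x B (seg k rP (emit_stars TC)) (eff A9 (nL x * k) 0 s) (eff A10 (nL x * k + nP x * k) 0 s)"
    unfolding A10_def by (rule step_seg[OF _ _ _ _ sums(5)]) (use s f10 sizes_le in \<open>auto simp: lr A10_def\<close>)
  have 15: "runs x B (seg k rL (emit_stars TB)) (eff A10 (nL x * k + nP x * k) 0 s)
      (eff A11 (nL x * k + nP x * k + nL x * k) 0 s)"
    unfolding A11_def by (rule step_seg[OF _ _ _ _ sums(6)]) (use s f11 sizes_le in \<open>auto simp: lr A11_def\<close>)
  have 16: "runs x B (seg k rO (emit_stars TB)) (eff A11 (nL x * k + nP x * k + nL x * k) 0 s)
      (eff A12 (nL x * k + nP x * k + nL x * k + 1 * k) 0 s)"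
    unfolding A12_def by (rule step_seg[OF _ _ _ _ sums(7)]) (use s f12 sizes_le in \<open>auto simp: lr A12_def\<close>)
  show ?thesis
    unfolding edge_program_def all
    by (rule runs_Seq[OF runs_Seq[OF 1 runs_Seq[OF 2 step_clear]]
          runs_Seq[OF runs_Seq[OF 3 runs_Seq[OF 4 step_clear]]
          runs_Seq[OF 5 runs_Seq[OF runs_Seq[OF 6 runs_Seq[OF 7 runs_Seq[OF 8 runs_Seq[OF 9 step_clear]]]]
          runs_Seq[OF runs_Seq[OF 10 runs_Seq[OF 11 12]]
          runs_Seq[OF 13 runs_Seq[OF 14 runs_Seq[OF 15 runs_Seq[OF 16 step_clear]]]]]]]]])
qed

end

definition prepare :: com where
  "prepare = Scan rN ;; Loop rN rL1 InL ;; horner rP (coeffs p) ;; horner rT (coeffs q) ;;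
     Loop rT rH (incs rL 2) ;; Loop rL rH (incs rI 2) ;; Loop rP rH (incs rI 1) ;; incs rI 1 ;;
     Loop rI rH (incs rW 1) ;; incs rW 2 ;; Loop rW rH (incs rD k) ;; incs rO 1"

lemma runs_prepare:
  assumes B: "length x \<le> B" "poly p (Suc (length x)) \<le> B" "poly q (Suc (length x)) \<le> B" "1 \<le> B"
    "nW x \<le> B" "nD x \<le> B"
  obtains s where "runs x B prepare init_st s" "ready (nD x) s" "reg s rL1 = 0" "reg s rL2 = 0" "reg s rX = 0"
    "reg s rP = nP x" "reg s rT = nT x" "reg s rL = nL x" "reg s rI = nI x" "reg s rW = nW x" "reg s rO = 1"
    "reg s rM = 0" "reg s rB = 0" "ipos s = 0" "outp s = []"
proof -
  note i = init_st_def regs'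
  define s1 where "s1 = set_reg init_st rN (length x)"
  define s2 where "s2 = set_reg s1 rP (nP x)"
  define s3 where "s3 = set_reg s2 rT (nT x)"
  define s4 where "s4 = set_reg s3 rL (nL x)"
  define s5 where "s5 = set_reg s4 rI (2 * nL x)"
  define s6 where "s6 = set_reg s5 rI (2 * nL x + nP x)"
  define s7 where "s7 = set_reg s6 rI (nI x)"
  define s8 where "s8 = set_reg s7 rW (nI x)"
  define s9 where "s9 = set_reg s8 rW (nW x)"
  define s10 where "s10 = set_reg s9 rD (nD x)"
  define s11 where "s11 = set_reg s10 rO 1"
  note d = s1_def s2_def s3_def s4_def s5_def s6_def s7_def s8_def s9_def s10_def
  have le: "nI x \<le> B" "nL x \<le> B" "nP x \<le> B" "nT x \<le> B" "2 * nL x + nP x \<le> B"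
    using B(5) by (auto simp: nW_def nI_def nL_def)
  have 0: "runs x B (Scan rN) init_st (move_in s1 (int (length x)))"
  proof -
    have "exec x B (Scan rN) init_st (2 * length x + 1)
       (init_st\<lparr>reg := (reg init_st)(rN := reg init_st rN + length x), ipos := ipos init_st + int (length x)\<rparr>)"
      by (rule exec.Scan) (use B in \<open>auto simp: inscription_def bit_sym_def init_st_def\<close>)
    then show ?thesis
      unfolding runs_def by (simp add: s1_def set_reg_def move_in_def init_st_def exI)
  qed
  have 1: "runs x B (Loop rN rL1 InL) (move_in s1 (int (length x))) s1"
  proof -
    have "runs x B (Loop rN rL1 InL) (move_in s1 (int (length x))) (eff [] 0 (- int (length x)) (move_in s1 (int (length x))))"
      using B by (intro runs_moveL) (auto simp: loop_reg_def d i)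
    then show ?thesis by (rule runs_eqI) (auto simp: d i)
  qed
  have 2: "runs x B (horner rP (coeffs p)) s1 s2"
    by (rule runs_eqI[OF runs_horner[where n = "length x"]]) (use B in \<open>auto simp: d i nP_def\<close>)
  have 3: "runs x B (horner rT (coeffs q)) s2 s3"
    by (rule runs_eqI[OF runs_horner[where n = "length x"]]) (use B in \<open>auto simp: d i nT_def\<close>)
  have 4: "runs x B (Loop rT rH (incs rL 2)) s3 s4"
    by (rule runs_eqI[OF runs_add]) (use le in \<open>auto simp: d i nL_def\<close>)
  have 5: "runs x B (Loop rL rH (incs rI 2)) s4 s5"
    by (rule runs_eqI[OF runs_add]) (use le in \<open>auto simp: d i\<close>)
  have 6: "runs x B (Loop rP rH (incs rI 1)) s5 s6"
    by (rule runs_eqI[OF runs_add]) (use le in \<open>auto simp: d i\<close>)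
  have 7: "runs x B (incs rI 1) s6 s7"
    by (rule runs_eqI[OF runs_incs]) (use le in \<open>auto simp: d i nI_def\<close>)
  have 8: "runs x B (Loop rI rH (incs rW 1)) s7 s8"
    by (rule runs_eqI[OF runs_add]) (use le in \<open>auto simp: d i\<close>)
  have 9: "runs x B (incs rW 2) s8 s9"
    by (rule runs_eqI[OF runs_incs]) (use B in \<open>auto simp: d i nW_def\<close>)
  have 10: "runs x B (Loop rW rH (incs rD k)) s9 s10"
    by (rule runs_eqI[OF runs_add]) (use B in \<open>auto simp: d i nD_def\<close>)
  have 11: "runs x B (incs rO 1) s10 s11"
    by (rule runs_eqI[OF runs_incs]) (use B in \<open>auto simp: d s11_def i\<close>)
  have "runs x B prepare init_st s11"
    unfolding prepare_def
    by (rule runs_Seq[OF 0 runs_Seq[OF 1 runs_Seq[OF 2 runs_Seq[OF 3 runs_Seq[OF 4 runs_Seq[OF 5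
      runs_Seq[OF 6 runs_Seq[OF 7 runs_Seq[OF 8 runs_Seq[OF 9 runs_Seq[OF 10 11]]]]]]]]]]])
  then show thesis by (rule that) (auto simp: d s11_def i ready_def scratch_zero_def)
qed

text \<open>Vertex 0 is the hub, so stars are placed from 1 on, and after the silent run
  \<open>rM\<close> is the number of vertices. The weight bound comes last in the encoding and is
  taken from \<open>rB\<close> after the second run; the literal output in between closes the edge
  list and writes the stretch as 2/1.\<close>

definition program :: com where
  "program = prepare ;; incs rM 1 ;; mute edge_program ;; emit_num [rM] 0 ;; clear rM ;; clear rB ;; incs rM 1 ;;
     edge_program ;; outs ([False] @ enc_nat 2 @ enc_nat 1) ;; emit_num [rB] 0"

lemma encode_stars:
  "encode (stars_instance Ss) = enc_nat (1 + stars_size Ss) @ enc_edges (stars_edges 1 Ss) @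
     [False] @ enc_nat 2 @ enc_nat 1 @ enc_nat (budget Ss)"
proof -
  have "quotient_of 2 = (2, 1)" using quotient_of_number(3)[of "num.Bit0 num.One"] by simp
  then show ?thesis
    unfolding encode_def stars_instance_def
    by (simp add: enc_list_edges[unfolded One_nat_def])
qed

lemma runs_program:
  assumes B: "length x \<le> B" "poly p (Suc (length x)) \<le> B" "poly q (Suc (length x)) \<le> B"
    "nW x \<le> B" "(nT x + 1) * (nW x * k) \<le> B" "1 + stars_size (all_stars x) \<le> B" "budget (all_stars x) \<le> B"
    and lits: "\<And>S l. S \<in> set (all_stars x) \<Longrightarrow> l \<in> set S \<Longrightarrow> l \<le> B"
  shows "\<exists>s. runs x B program init_st s \<and> outp s = encode (stars_instance (all_stars x))"
proof -
  have D: "nD x \<le> B" using B(5) by (simp add: nD_def mult.commute)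
  have B1: "1 \<le> B" using B(6) by simp
  have nT: "nT x \<le> B" using B(4) by (auto simp: nW_def nI_def nL_def)
  obtain s where s: "runs x B prepare init_st s" "ready (nD x) s" "reg s rL1 = 0" "reg s rL2 = 0" "reg s rX = 0"
    "reg s rP = nP x" "reg s rT = nT x" "reg s rL = nL x" "reg s rI = nI x" "reg s rW = nW x" "reg s rO = 1"
    "reg s rM = 0" "reg s rB = 0" "ipos s = 0" "outp s = []"
    using runs_prepare[OF B(1-3) B1 B(4) D] by blast
  let ?n = "1 + stars_size (all_stars x)"
  define s1 where "s1 = set_reg s rM 1"
  define s2 where "s2 = set_out (eff (all_stars x) 0 0 s1) (outp s1)"
  define s3 where "s3 = put s2 (enc_nat ?n)"
  define s4 where "s4 = set_reg (set_reg s3 rM 0) rB 0"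
  define s5 where "s5 = set_reg s4 rM 1"
  define s6 where "s6 = eff (all_stars x) 0 0 s5"
  define s7 where "s7 = put s6 ([False] @ enc_nat 2 @ enc_nat 1)"
  define s8 where "s8 = put s7 (enc_nat (budget (all_stars x)))"
  have sz: "ready (nD x) s2" "ready (nD x) s7"
    using s(2) by (auto simp: s1_def s2_def s3_def s4_def s5_def s6_def s7_def ready_def scratch_zero_def regs)
  have fits: "fits B (all_stars x) s1" "fits B (all_stars x) s5"
    using B lits s unfolding fits_def s1_def s2_def s3_def s4_def s5_def by (auto simp: regs)
  have 1: "runs x B (incs rM 1) s s1"
    by (rule runs_eqI[OF runs_incs]) (use s B1 in \<open>auto simp: s1_def\<close>)
  have "runs x B edge_program s1 (eff (all_stars x) 0 0 s1)"
    by (rule runs_edge_program) (use s fits B nT in \<open>auto simp: s1_def regs'\<close>)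
  then have 2: "runs x B (mute edge_program) s1 s2" unfolding s2_def by (rule runs_mute)
  have 3: "runs x B (emit_num [rM] 0) s2 s3"
    by (rule runs_eqI[OF runs_emit_num])
      (use sz(1) B s in \<open>auto simp: s3_def s2_def s1_def ready_def scratch_zero_def num_val_def regs\<close>)
  have 4: "runs x B (clear rM) s3 (set_reg s3 rM 0)" "runs x B (clear rB) (set_reg s3 rM 0) s4"
    unfolding s4_def by (rule runs_clear)+
  have 5: "runs x B (incs rM 1) s4 s5"
    by (rule runs_eqI[OF runs_incs]) (use B1 in \<open>auto simp: s4_def s5_def regs\<close>)
  have 6: "runs x B edge_program s5 s6" unfolding s6_def
    by (rule runs_edge_program) (use s fits B nT in \<open>auto simp: s1_def s2_def s3_def s4_def s5_def regs' ready_def scratch_zero_def\<close>)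
  have 7: "runs x B (outs ([False] @ enc_nat 2 @ enc_nat 1)) s6 s7" unfolding s7_def by (rule runs_outs)
  have bB: "reg s7 rB = budget (all_stars x)" by (simp add: s7_def s6_def s5_def s4_def regs)
  have 8: "runs x B (emit_num [rB] 0) s7 s8"
    by (rule runs_eqI[OF runs_emit_num])
      (use sz(2) B bB in \<open>auto simp: s8_def ready_def scratch_zero_def num_val_def regs\<close>)
  have "runs x B program init_st s8"
    unfolding program_def
    by (rule runs_Seq[OF s(1) runs_Seq[OF 1 runs_Seq[OF 2 runs_Seq[OF 3 runs_Seq[OF 4(1) runs_Seq[OF 4(2)
      runs_Seq[OF 5 runs_Seq[OF 6 runs_Seq[OF 7 8]]]]]]]]])
  moreover have "outp s8 = encode (stars_instance (all_stars x))"
    unfolding encode_stars using s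
    by (simp add: s8_def s7_def s6_def s5_def s4_def s3_def s2_def s1_def regs)
  ultimately show ?thesis by blast
qed

section \<open>Polynomial bounds for the program\<close>

lemma vars_below_incs [simp]: "v < N \<Longrightarrow> vars_below N (incs v n)"
  by (induction n) auto

lemma vars_below_outs [simp]: "vars_below N (outs bs)"
  by (induction bs) auto

lemma vars_below_emit_num [simp]: "\<forall>r\<in>set rs. r < 17 \<Longrightarrow> vars_below 17 (emit_num rs n)"
  by (induction rs) (auto simp: emit_rU_def Loop_def halve_def clear_def regs)

lemma vars_below_emit_edge [simp]:
  "\<forall>r\<in>set (fst a). r < 17 \<Longrightarrow> \<forall>r\<in>set (fst b). r < 17 \<Longrightarrow> vars_below 17 (emit_edge a b)"
  by (simp add: emit_edge_def)

lemma vars_below_emit_stars [simp]: "vars_below 17 (emit_stars Ts)"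
proof (induction Ts)
  case (Cons T Ts)
  have "vars_below 17 (emit_links j T)" for j
    by (induction T arbitrary: j) (auto simp: ref_def regs)
  then show ?case using Cons by (simp add: emit_star_def regs)
qed simp

lemma vars_below_mute: "vars_below N c \<Longrightarrow> vars_below N (mute c)"
  by (induction c) auto

lemma vars_below_horner: "d < 17 \<Longrightarrow> vars_below 17 (horner d cs)"
  by (induction cs) (auto simp: Loop_def regs')

lemma vars_below_program: "vars_below 17 program"
proof -
  have "vars_below 17 edge_program"
    by (simp add: edge_program_def read_input_def seg_def Loop_def clear_def regs')
  moreover have "vars_below 17 prepare"
    by (simp add: prepare_def Loop_def vars_below_horner regs')
  ultimately show ?thesis
    by (simp add: program_def clear_def vars_below_mute emit_rU_def Loop_def halve_def regs')
qed

definition template_size :: "template \<Rightarrow> nat" where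
  "template_size Ts = (\<Sum>T\<leftarrow>Ts. Suc (length T))"

definition max_size :: nat where
  "max_size = template_size TV + template_size TW + template_size TF + template_size TH + template_size TN +
     template_size TB + template_size TC + template_size (TI 0) + template_size (TI 1) + template_size (TI 2)"

lemma stars_size_cells:
  assumes "\<And>i. i < n \<Longrightarrow> template_size (U i) \<le> m"
  shows "stars_size (cells D U X k' n) \<le> n * m"
  using assms
proof (induction n)
  case (Suc n)
  have "stars_size (map (inst X' D) Ts) = template_size Ts" for X' Ts
    by (induction Ts) (auto simp: template_size_def)
  moreover have "stars_size (cells D U X k' n) \<le> n * m" using Suc by simp
  moreover have "template_size (U n) \<le> m" using Suc.prems by simp
  ultimately show ?case by (simp add: cells_def)
qed (simp add: cells_def)

lemma stars_size_rows: "template_size T \<le> m \<Longrightarrow> stars_size (grid_rows T x n) \<le> nT x * (n * m)"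
proof -
  assume T: "template_size T \<le> m"
  have "stars_size (concat (map f [0..<j])) \<le> j * (n * m)" if "\<And>i. stars_size (f i) \<le> n * m" for f j
  proof (induction j)
    case (Suc j)
    then show ?case using that[of j] by simp
  qed simp
  then show ?thesis unfolding grid_rows_def using T by (simp add: stars_size_cells)
qed

text \<open>Variables take \<open>nT x + 1\<close> rows, steps \<open>nT x\<close> rows, and the
  final, input and certificate constraints one row each.\<close>

lemma stars_size_all: "stars_size (all_stars x) \<le> (2 * nT x + 4) * (nW x * max_size)"
proof -
  let ?m = max_size and ?W = "nW x * max_size"
  have I: "nI x * ?m \<le> ?W" by (intro mult_le_mono1) (simp add: nW_def)
  have "template_size (input_templates x i) \<le> ?m" for i
  proof -
    define Ti where "Ti = TI (inscription x (int i - int (nL x)))"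
    have "inscription x (int i - int (nL x)) \<in> {0, 1, 2}" by (auto simp: inscription_def bit_sym_def)
    then have "template_size Ti \<le> template_size (TI 0) + template_size (TI 1) + template_size (TI 2)"
      by (auto simp: Ti_def)
    moreover have "template_size (Ts @ Us) = template_size Ts + template_size Us" for Ts Us
      by (simp add: template_size_def)
    ultimately show ?thesis by (simp add: input_templates_def max_size_def flip: Ti_def)
  qed
  then have 1: "stars_size (cells (nD x) (input_templates x) 0 k (nI x)) \<le> ?W"
    using stars_size_cells[of "nI x" "input_templates x" ?m] I le_trans by blast
  have "template_size (cert_templates x i) \<le> ?m" for i
    by (simp add: cert_templates_def max_size_def)
  then have 2: "stars_size (cells (nD x) (cert_templates x) 0 k (nI x)) \<le> ?W"
    using stars_size_cells[of "nI x" "cert_templates x" ?m] I le_trans by blast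
  have 3: "stars_size (cells (nD x) (\<lambda>_. TF) d k (nI x)) \<le> ?W" for d
  proof -
    have "template_size TF \<le> ?m" by (simp add: max_size_def)
    then show ?thesis using stars_size_cells[of "nI x" "\<lambda>_. TF" ?m "nD x" d k] I le_trans by blast
  qed
  have 4: "stars_size (cells (nD x) (\<lambda>_. TV) d k (nW x)) \<le> ?W" for d
    using stars_size_cells[of "nW x" "\<lambda>_. TV" ?m "nD x" d k] by (simp add: max_size_def)
  have 5: "stars_size (grid_rows TV x (nW x)) \<le> nT x * ?W"
    by (rule stars_size_rows) (simp add: max_size_def)
  have "stars_size (grid_rows TW x (nI x)) \<le> nT x * (nI x * ?m)"
    by (rule stars_size_rows) (simp add: max_size_def)
  also have "\<dots> \<le> nT x * ?W" using I by simp
  finally have 6: "stars_size (grid_rows TW x (nI x)) \<le> nT x * ?W" .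
  show ?thesis
    unfolding all_stars_def stars_size_simps
    using 1 2 3[of "nT x * (nW x * k)"] 4[of "nT x * (nW x * k)"] 5 6
    by (simp only: add_mult_distrib)
qed

lemma budget_le: "budget Ss \<le> 2 * stars_size Ss"
  by (induction Ss) auto

theorem polytime_encode_stars:
  assumes lits: "\<And>x S l. S \<in> set (all_stars x) \<Longrightarrow> l \<in> set S \<Longrightarrow> l \<le> stars_size (all_stars x)"
  shows "polytime_function (\<lambda>x. encode (stars_instance (all_stars x)))"
proof -
  \<comment> \<open>\<open>W\<close> is the row length as a polynomial in the input length. The
    summands of \<open>b\<close> dominate the bounds demanded by \<open>runs_program\<close>; the
    factor 2 stems from \<open>budget_le\<close>.\<close>
  define W where "W = 4 * q + p + 3"
  define b where "b = [:0, 1:] + pcompose p [:1, 1:] + pcompose q [:1, 1:] + W + (q + 1) * (W * [:k:]) +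
    2 * ((2 * q + 4) * (W * [:max_size:])) + 1"
  have runs: "\<exists>s. runs x (poly b (length x)) program init_st s \<and> outp s = encode (stars_instance (all_stars x))" for x
  proof -
    let ?n = "length x"
    have W: "poly W ?n = nW x" by (simp add: W_def nW_def nI_def nL_def nT_def nP_def)
    have b: "poly b ?n = ?n + poly p (Suc ?n) + poly q (Suc ?n) + nW x + (nT x + 1) * (nW x * k) +
        2 * ((2 * nT x + 4) * (nW x * max_size)) + 1"
      unfolding b_def by (simp only: poly_add poly_mult poly_pcompose W) (simp add: nT_def)
    note size = stars_size_all[of x] budget_le[of "all_stars x"]
    have l: "l \<le> poly b ?n" if "S \<in> set (all_stars x)" "l \<in> set S" for S l
      using lits[OF that] size unfolding b by linarith
    have "?n \<le> poly b ?n" "poly p (Suc ?n) \<le> poly b ?n" "poly q (Suc ?n) \<le> poly b ?n"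
      "nW x \<le> poly b ?n" "(nT x + 1) * (nW x * k) \<le> poly b ?n"
      "1 + stars_size (all_stars x) \<le> poly b ?n" "budget (all_stars x) \<le> poly b ?n"
      unfolding b using size by linarith+
    from runs_program[OF this l] show ?thesis by simp
  qed
  show ?thesis
    by (rule polytime_functionI[OF vars_below_program, of b]) (use runs in \<open>metis runs_def\<close>)
qed

end

section \<open>Clauses for a predicate on bit vectors\<close>

text \<open>A position in the window and the number of a bit within the cell at this position.
  Position 0 is the anchor, whose cell also stores the auxiliary bits of the constraint.\<close>

type_synonym var_ref = "nat \<times> nat"
type_synonym literal = "var_ref \<times> bool"

definition sat :: "(var_ref \<Rightarrow> bool) \<Rightarrow> literal list list \<Rightarrow> bool" where
  "sat e cs \<longleftrightarrow> (\<forall>c\<in>set cs. \<exists>l\<in>set c. e (fst l) = snd l)"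

lemma sat_simps [simp]:
  "sat e []" "sat e (c # cs) \<longleftrightarrow> (\<exists>l\<in>set c. e (fst l) = snd l) \<and> sat e cs"
  "sat e (cs @ ds) \<longleftrightarrow> sat e cs \<and> sat e ds"
  by (auto simp: sat_def)

fun equalities :: "var_ref list \<Rightarrow> nat \<Rightarrow> literal list list" where
  "equalities [] n = []"
| "equalities (z # zs) n = [(z, True), ((0, n), False)] # [(z, False), ((0, n), True)] # equalities zs (Suc n)"

text \<open>Variable \<open>(0, n + i)\<close> stands for a disagreement of \<open>zs\<close> and \<open>bs\<close> before position \<open>i\<close>.\<close>

fun mismatch :: "var_ref list \<Rightarrow> bool list \<Rightarrow> nat \<Rightarrow> literal list list" where
  "mismatch (z # zs) (b # bs) n = [((0, Suc n), False), ((0, n), True), (z, \<not> b)] # mismatch zs bs (Suc n)"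
| "mismatch _ _ n = [[((0, n), True)]]"

definition block :: "nat \<Rightarrow> nat \<Rightarrow> var_ref list" where
  "block n w = map (Pair 0) [n..<n + w]"

text \<open>
  One row per forbidden vector. Each row copies the values of the previous row, so that no variable
  occurs more than three times with the same sign, whatever the number of forbidden vectors.
\<close>

fun avoid :: "var_ref list \<Rightarrow> bool list list \<Rightarrow> nat \<Rightarrow> literal list list" where
  "avoid zs [] n = []"
| "avoid zs (b # bs) n = equalities zs n @ [[((0, n + length zs), False)]] @
     mismatch (block n (length zs)) b (n + length zs) @
     avoid (block n (length zs)) bs (n + 2 * length zs + 1)"

text \<open>The intended values of the auxiliary variables, listed in the order of their numbers;
  they witness completeness.\<close>

fun mismatch_aux :: "bool \<Rightarrow> bool list \<Rightarrow> bool list \<Rightarrow> bool list" where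
  "mismatch_aux a (v # vs) (b # bs) = a # mismatch_aux (a \<or> v \<noteq> b) vs bs"
| "mismatch_aux a _ _ = [a]"

fun avoid_aux :: "bool list \<Rightarrow> bool list list \<Rightarrow> bool list" where
  "avoid_aux v [] = []"
| "avoid_aux v (b # bs) = v @ mismatch_aux False v b @ avoid_aux v bs"

section \<open>Correctness of the clauses\<close>

lemma length_block [simp]: "length (block n w) = w"
  by (simp add: block_def)

lemma block_0 [simp]: "block n 0 = []"
  by (simp add: block_def)

lemma block_Suc: "block n (Suc w) = (0, n) # block (Suc n) w"
  by (simp add: block_def upt_conv_Cons del: upt_Suc)

lemma set_block: "(i, a) \<in> set (block n w) \<longleftrightarrow> i = 0 \<and> n \<le> a \<and> a < n + w"
  by (auto simp: block_def)

lemma distinct_block [simp]: "distinct (block n w)"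
  by (simp add: block_def distinct_map inj_on_def)

lemma length_mismatch_aux [simp]: "length b = length v \<Longrightarrow> length (mismatch_aux a v b) = Suc (length v)"
  by (induction a v b rule: mismatch_aux.induct) auto

lemma length_avoid_aux: "\<forall>b\<in>set bs. length b = length v \<Longrightarrow> length (avoid_aux v bs) = length bs * (2 * length v + 1)"
  by (induction bs) auto

lemma sat_equalities: "sat e (equalities zs n) \<longleftrightarrow> map e zs = map e (block n (length zs))"
  by (induction zs arbitrary: n) (auto simp: block_Suc)

text \<open>The flag is false at first and true in the end, and each clause lets it rise only where
  the two vectors disagree.\<close>

lemma sat_mismatch_sound:
  "sat e (mismatch zs b n) \<Longrightarrow> length b = length zs \<Longrightarrow> \<not> e (0, n) \<Longrightarrow> map e zs \<noteq> b"
  by (induction zs b n rule: mismatch.induct) auto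

lemma sat_avoid_sound:
  "sat e (avoid zs bs n) \<Longrightarrow> \<forall>b\<in>set bs. length b = length zs \<Longrightarrow> map e zs \<notin> set bs"
proof (induction zs bs n rule: avoid.induct)
  case (2 zs b bs n)
  let ?zs = "block n (length zs)"
  have eq: "map e zs = map e ?zs" using 2(2) by (simp add: sat_equalities)
  have "map e ?zs \<noteq> b" using sat_mismatch_sound[of e ?zs b "n + length zs"] 2(2,3) by simp
  moreover have "map e ?zs \<notin> set bs" using 2 by simp
  ultimately show ?case using eq by simp
qed simp

definition agrees :: "(var_ref \<Rightarrow> bool) \<Rightarrow> nat \<Rightarrow> bool list \<Rightarrow> bool" where
  "agrees e n L \<longleftrightarrow> map e (block n (length L)) = L"

lemma agrees_append: "agrees e n (L @ M) \<longleftrightarrow> agrees e n L \<and> agrees e (n + length L) M"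
proof -
  have "block n (a + b) = block n a @ block (n + a) b" for a b
    using upt_add_eq_append[of n "n + a" b] by (simp add: block_def add.assoc flip: map_append)
  then show ?thesis by (auto simp: agrees_def)
qed

lemma agrees_Cons: "agrees e n (a # L) \<longleftrightarrow> e (0, n) = a \<and> agrees e (Suc n) L"
  by (auto simp: agrees_def block_Suc)

text \<open>\<open>a\<close> is the flag on entry, generalised because it is inherited from the
  positions already passed.\<close>

lemma sat_mismatch_complete:
  "agrees e n (mismatch_aux a (map e zs) b) \<Longrightarrow> length b = length zs \<Longrightarrow> a \<or> map e zs \<noteq> b \<Longrightarrow>
    sat e (mismatch zs b n)"
proof (induction zs b n arbitrary: a rule: mismatch.induct)
  case (1 z zs b bs n)
  have hd: "e (0, n) = a" "agrees e (Suc n) (mismatch_aux (a \<or> e z \<noteq> b) (map e zs) bs)"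
    using 1(2) by (auto simp: agrees_Cons)
  have "e (0, Suc n) = (a \<or> e z \<noteq> b)" using hd(2) by (cases zs; cases bs) (auto simp: agrees_Cons)
  moreover have "sat e (mismatch zs bs (Suc n))" using 1(1)[OF hd(2)] 1(3,4) by auto
  ultimately show ?case using hd by auto
qed (auto simp: agrees_def block_def)

lemma sat_avoid_complete:
  "map e zs = v \<Longrightarrow> agrees e n (avoid_aux v bs) \<Longrightarrow> \<forall>b\<in>set bs. length b = length zs \<Longrightarrow> v \<notin> set bs \<Longrightarrow>
    sat e (avoid zs bs n)"
proof (induction zs bs n rule: avoid.induct)
  case (2 zs b bs n)
  let ?zs = "block n (length zs)"
  have len: "length v = length zs" "length b = length zs" using 2(2,4) by auto
  have ag: "agrees e n v" "agrees e (n + length zs) (mismatch_aux False v b)"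
    "agrees e (n + 2 * length zs + 1) (avoid_aux v bs)"
    using 2(3) len by (auto simp: agrees_append mult_2 add_ac)
  have v: "map e ?zs = v" using ag(1) len by (simp add: agrees_def)
  have "sat e (equalities zs n)" using v 2(2) by (simp add: sat_equalities)
  moreover have "\<not> e (0, n + length zs)"
    using ag(2) len by (cases v; cases b) (auto simp: agrees_Cons)
  moreover have "sat e (mismatch ?zs b (n + length zs))"
    using sat_mismatch_complete[of e "n + length zs" False ?zs b] ag(2) v len 2(5) by simp
  moreover have "sat e (avoid ?zs bs (n + 2 * length zs + 1))"
    using 2(1)[OF v ag(3)] 2(4,5) by simp
  ultimately show ?case by simp
qed simp

section \<open>Sizes of clauses and numbers of occurrences\<close>

definition outside :: "nat \<Rightarrow> var_ref list \<Rightarrow> bool" where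
  "outside n zs \<longleftrightarrow> (\<forall>(i, a)\<in>set zs. i \<noteq> 0 \<or> a < n)"

lemma outside_block: "n + w \<le> m \<Longrightarrow> outside m (block n w)"
  by (auto simp: outside_def set_block)

definition clause_ok :: "literal list \<Rightarrow> bool" where
  "clause_ok c \<longleftrightarrow> c \<noteq> [] \<and> length c \<le> 3 \<and> distinct (map fst c)"

lemma equalities_ok: "outside n zs \<Longrightarrow> \<forall>c\<in>set (equalities zs n). clause_ok c"
proof (induction zs arbitrary: n)
  case (Cons z zs)
  have "outside (Suc n) zs" using Cons.prems by (fastforce simp: outside_def)
  then show ?case using Cons by (auto simp: clause_ok_def outside_def)
qed simp

lemma mismatch_ok: "outside n zs \<Longrightarrow> \<forall>c\<in>set (mismatch zs b n). clause_ok c"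
proof (induction zs b n rule: mismatch.induct)
  case (1 z zs b bs n)
  have "outside (Suc n) zs" using 1(2) by (fastforce simp: outside_def)
  then show ?case using 1 by (auto simp: clause_ok_def outside_def)
qed (auto simp: clause_ok_def)

lemma avoid_ok: "outside n zs \<Longrightarrow> \<forall>c\<in>set (avoid zs bs n). clause_ok c"
proof (induction zs bs n rule: avoid.induct)
  case (2 zs b bs n)
  then show ?case
    using equalities_ok[of n zs] mismatch_ok[OF outside_block[of n "length zs" "n + length zs"], of b]
      outside_block[of n "length zs" "n + 2 * length zs + 1"]
    by (auto simp: clause_ok_def)
qed simp

abbreviation "between n m r \<equiv> fst r = (0 :: nat) \<and> n \<le> snd r \<and> snd r < (m :: nat)"

lemma equalities_refs: "l \<in> set c \<Longrightarrow> c \<in> set (equalities zs n) \<Longrightarrow> fst l \<in> set zs \<or> between n (n + length zs) (fst l)"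
  by (induction zs arbitrary: n) (fastforce split: if_splits)+

lemma mismatch_refs: "l \<in> set c \<Longrightarrow> c \<in> set (mismatch zs b n) \<Longrightarrow> fst l \<in> set zs \<or> between n (n + length zs + 1) (fst l)"
  by (induction zs b n rule: mismatch.induct) fastforce+

lemma avoid_refs:
  "l \<in> set c \<Longrightarrow> c \<in> set (avoid zs bs n) \<Longrightarrow> fst l \<in> set zs \<or> between n (n + length bs * (2 * length zs + 1)) (fst l)"
proof (induction zs bs n rule: avoid.induct)
  case (2 zs b bs n)
  let ?zs = "block n (length zs)"
  from 2(3) consider "c \<in> set (equalities zs n)" | "c = [((0, n + length zs), False)]"
    | "c \<in> set (mismatch ?zs b (n + length zs))" | "c \<in> set (avoid ?zs bs (n + 2 * length zs + 1))" by auto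
  then show ?case
  proof cases
    case 1
    then show ?thesis using equalities_refs[OF 2(2) 1] by auto
  next
    case 3
    then show ?thesis using mismatch_refs[OF 2(2) 3] set_block[of "fst (fst l)" "snd (fst l)" n "length zs"] by auto
  next
    case 4
    then show ?thesis using 2(1)[OF 2(2) 4] set_block[of "fst (fst l)" "snd (fst l)" n "length zs"] by auto
  qed (use 2(2) in auto)
qed simp

definition cnt :: "literal \<Rightarrow> literal list list \<Rightarrow> nat" where
  "cnt l cs = count_list (concat cs) l"

lemma cnt_simps [simp]: "cnt l [] = 0" "cnt l (c # cs) = count_list c l + cnt l cs"
  "cnt l (cs @ ds) = cnt l cs + cnt l ds"
  by (auto simp: cnt_def)

lemma cnt_equalities: "cnt l (equalities zs n) \<le> count_list zs (fst l) + (if between n (n + length zs) (fst l) then 1 else 0)"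
proof (induction zs arbitrary: n)
  case (Cons z zs)
  show ?case using Cons[of "Suc n"] by (cases l) (auto split: if_splits)
qed simp

lemma cnt_mismatch: "length b = length zs \<Longrightarrow>
  cnt l (mismatch zs b n) \<le> count_list zs (fst l) +
    (if between (if snd l then n else Suc n) (n + length zs + 1) (fst l) then 1 else 0)"
proof (induction zs b n rule: mismatch.induct)
  case (1 z zs b bs n)
  then show ?case by (cases l) (auto split: if_splits)
qed auto

text \<open>A copied bit is used in the equality that defines it, in the comparison with its
  forbidden vector and in the equality that copies it further, at most once per sign in each. The
  bits \<open>zs\<close> themselves occur only in the first equalities.\<close>

lemma cnt_avoid:
  "outside n zs \<Longrightarrow> distinct zs \<Longrightarrow> \<forall>b\<in>set bs. length b = length zs \<Longrightarrow>
    cnt l (avoid zs bs n) \<le> (if fst l \<in> set zs then 1 else 0) + (if fst (fst l) = 0 \<and> n \<le> snd (fst l) then 3 else 0)"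
proof (induction zs bs n rule: avoid.induct)
  case (2 zs b bs n)
  let ?w = "length zs" and ?r = "fst l"
  let ?zs = "block n ?w"
  have cl: "count_list ys r = (if r \<in> set ys then 1 else 0)" if "distinct ys" for ys and r :: var_ref
    using that by (induction ys) auto
  have mem: "?r \<in> set ?zs \<longleftrightarrow> between n (n + ?w) ?r" using set_block[of "fst ?r" "snd ?r" n ?w] by simp
  have nin: "?r \<notin> set zs" if "fst ?r = 0" "n \<le> snd ?r" using 2(2) that by (cases ?r) (fastforce simp: outside_def)
  have 1: "cnt l (equalities zs n) \<le> (if ?r \<in> set zs then 1 else 0) + (if between n (n + ?w) ?r then 1 else 0)"
    using cnt_equalities[of l zs n] cl[OF 2(3)] by simp
  have mm: "cnt l (mismatch ?zs b (n + ?w)) \<le> (if between n (n + ?w) ?r then 1 else 0) +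
      (if between (n + ?w) (n + 2 * ?w + 1) ?r then 1 else 0)"
    using cnt_mismatch[of b ?zs l "n + ?w"] cl[of ?zs] 2(4) mem by (auto split: if_splits)
  have 3: "cnt l (avoid ?zs bs (n + 2 * ?w + 1)) \<le> (if between n (n + ?w) ?r then 1 else 0) +
      (if fst ?r = 0 \<and> n + 2 * ?w + 1 \<le> snd ?r then 3 else 0)"
    using 2(1) 2(4) mem outside_block[of n ?w "n + 2 * ?w + 1"] by simp
  have 4: "count_list [((0, n + ?w), False)] l \<le> (if between (n + ?w) (n + 2 * ?w + 1) ?r then 1 else 0)"
    by auto
  show ?case
  proof (cases "fst ?r = 0 \<and> n \<le> snd ?r")
    case True
    consider "snd ?r < n + ?w" | "n + ?w \<le> snd ?r" "snd ?r < n + 2 * ?w + 1" | "n + 2 * ?w + 1 \<le> snd ?r"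
      by linarith
    then show ?thesis using True 1 mm 3 4 nin by cases (simp_all split: if_splits)
  next
    case False
    then show ?thesis using 1 mm 3 4 by (auto split: if_splits)
  qed
qed simp

section \<open>Local constraints on a grid as bounded formulas\<close>

text \<open>
  Every cell holds an element of \<open>C\<close>, coded by \<open>m\<close> bits, followed by the auxiliary variables of
  all constraints anchored at this cell. Constraint \<open>i\<close> anchored at \<open>g\<close> reads the cells
  \<open>g + k W + j\<close> for \<open>(k, j)\<close> in \<open>wins i\<close>.
\<close>

locale window_csp =
  fixes m :: nat and dec :: "bool list \<Rightarrow> 'c" and enc :: "'c \<Rightarrow> bool list" and C :: "'c set"
    and np :: nat and wins :: "nat \<Rightarrow> (nat \<times> nat) list" and Q :: "nat \<Rightarrow> 'c list \<Rightarrow> bool"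
  assumes m: "0 < m" and dec: "dec v \<in> C" and enc: "c \<in> C \<Longrightarrow> length (enc c) = m \<and> dec (enc c) = c"
    and wins: "(k, j) \<in> set (wins i) \<Longrightarrow> k < 2 \<and> j < 3" "distinct (wins i)"
begin

fun chunks :: "nat \<Rightarrow> bool list \<Rightarrow> bool list list" where
  "chunks 0 v = []"
| "chunks (Suc n) v = take m v # chunks n (drop m v)"

lemma chunks_concat: "(\<And>v. v \<in> set vs \<Longrightarrow> length v = m) \<Longrightarrow> chunks (length vs) (concat vs) = vs"
  by (induction vs) auto

definition bads :: "nat \<Rightarrow> bool list list" where
  "bads i = filter (\<lambda>v. \<not> Q i (map dec (chunks (length (wins i)) v)))
     (List.n_lists (m * length (wins i)) [False, True])"

definition aux_len :: "nat \<Rightarrow> nat" where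
  "aux_len i = length (bads i) * (2 * (m * length (wins i)) + 1)"

definition off :: "nat \<Rightarrow> nat" where "off i = m + (\<Sum>j<i. aux_len j)"
definition K :: nat where "K = off np"

text \<open>Row offset \<open>k < 2\<close> and column offset \<open>j\<close> are packed into the
  position \<open>k + 2 * j\<close>, which \<open>site\<close> unpacks by \<open>mod 2\<close> and
  \<open>div 2\<close>.\<close>

definition refs :: "nat \<Rightarrow> var_ref list" where
  "refs i = concat (map (\<lambda>w. map (Pair (fst w + 2 * snd w)) [0..<m]) (wins i))"

definition cls :: "nat \<Rightarrow> literal list list" where "cls i = avoid (refs i) (bads i) (off i)"

text \<open>The row offset becomes a multiple of the row distance; the column offset and the bit
  become a variable number, and this one of the two literal vertices of that variable.\<close>

definition entry :: "literal \<Rightarrow> nat \<times> nat" where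
  "entry l = (fst (fst l) mod 2, 6 * (fst (fst l) div 2 * K + snd (fst l)) + (if snd l then 1 else 2))"

definition tmpl :: "nat \<Rightarrow> template" where "tmpl i = map (map entry) (cls i)"

definition var_tmpl :: template where
  "var_tmpl = concat (map (\<lambda>a. [[], [(0, 6 * a + 1)], [(0, 6 * a + 1), (0, 6 * a + 2)]]) [0..<K])"

definition clauses_of :: "nat \<Rightarrow> (nat \<times> nat) list \<Rightarrow> nat list list" where
  "clauses_of W U = concat (map (\<lambda>(g, i). map (inst (6 * K * g) (6 * K * W)) (tmpl i)) U)"

section \<open>Satisfying assignments and fillings of the grid\<close>

lemma off_le: "i \<le> j \<Longrightarrow> off i \<le> off j"
  unfolding off_def by (auto intro: sum_mono2)

lemma off_Suc: "off (Suc i) = off i + aux_len i"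
  by (simp add: off_def)

lemma m_le: "m \<le> off i" "m \<le> K" "0 < K"
  using m by (auto simp: off_def K_def)

lemma length_refs: "length (refs i) = m * length (wins i)"
  unfolding refs_def by (induction "wins i") (auto simp: length_concat comp_def case_prod_beta sum_list_triv)

lemma length_bads: "b \<in> set (bads i) \<Longrightarrow> length b = m * length (wins i)"
  by (auto simp: bads_def set_n_lists)

lemma bads_iff:
  "length v = m * length (wins i) \<Longrightarrow> v \<in> set (bads i) \<longleftrightarrow> \<not> Q i (map dec (chunks (length (wins i)) v))"
  by (auto simp: bads_def set_n_lists)

lemma map_refs: "map e (refs i) = concat (map (\<lambda>w. map (\<lambda>b. e (fst w + 2 * snd w, b)) [0..<m]) (wins i))"
  by (simp add: refs_def map_concat comp_def)

lemma cls_sound: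
  assumes "sat e (cls i)"
  shows "Q i (map (\<lambda>w. dec (map (\<lambda>b. e (fst w + 2 * snd w, b)) [0..<m])) (wins i))"
proof -
  let ?vs = "map (\<lambda>w. map (\<lambda>b. e (fst w + 2 * snd w, b)) [0..<m]) (wins i)"
  have "map e (refs i) \<notin> set (bads i)"
    using sat_avoid_sound[of e "refs i" "bads i" "off i"] assms length_bads length_refs by (simp add: cls_def)
  then have "Q i (map dec (chunks (length (wins i)) (map e (refs i))))"
    using bads_iff[of "map e (refs i)" i] length_refs by simp
  moreover have "chunks (length ?vs) (concat ?vs) = ?vs" by (rule chunks_concat) auto
  ultimately show ?thesis by (simp add: map_refs comp_def)
qed

lemma cls_complete:
  assumes d: "\<And>w. w \<in> set (wins i) \<Longrightarrow> d w \<in> C" and Q: "Q i (map d (wins i))"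
    and e: "\<And>w b. w \<in> set (wins i) \<Longrightarrow> b < m \<Longrightarrow> e (fst w + 2 * snd w, b) = enc (d w) ! b"
    and ag: "agrees e (off i) (avoid_aux (concat (map (\<lambda>w. enc (d w)) (wins i))) (bads i))"
  shows "sat e (cls i)"
proof -
  let ?vs = "map (\<lambda>w. enc (d w)) (wins i)"
  have len: "length v = m" if "v \<in> set ?vs" for v using that d enc by auto
  have "map (\<lambda>b. e (fst w + 2 * snd w, b)) [0..<m] = enc (d w)" if "w \<in> set (wins i)" for w
    using e[OF that] enc[OF d[OF that]] by (intro nth_equalityI) auto
  then have v: "map e (refs i) = concat ?vs" unfolding map_refs by (intro arg_cong[of _ _ concat] map_cong) auto
  have "map dec ?vs = map d (wins i)" using d enc by auto
  moreover have "chunks (length (wins i)) (concat ?vs) = ?vs"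
    using chunks_concat[of ?vs] len by simp
  ultimately have "Q i (map dec (chunks (length (wins i)) (concat ?vs)))" using Q by metis
  then have "concat ?vs \<notin> set (bads i)"
    using bads_iff[of "concat ?vs" i] v length_refs by (metis length_map)
  then show ?thesis
    unfolding cls_def using sat_avoid_complete[OF v ag] length_bads length_refs by simp
qed

definition site :: "nat \<Rightarrow> nat \<Rightarrow> var_ref \<Rightarrow> nat" where
  "site W g r = g + (fst r mod 2) * W + fst r div 2"

definition env :: "(nat \<Rightarrow> bool) \<Rightarrow> nat \<Rightarrow> nat \<Rightarrow> var_ref \<Rightarrow> bool" where
  "env x W g r = x (K * site W g r + snd r)"

definition val :: "nat \<Rightarrow> nat \<Rightarrow> literal \<Rightarrow> nat" where
  "val W g l = 6 * (K * site W g (fst l) + snd (fst l)) + (if snd l then 1 else 2)"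

lemma site_win: "w \<in> set (wins i) \<Longrightarrow> site W g (fst w + 2 * snd w, b) = g + fst w * W + snd w"
  using wins(1)[of "fst w" "snd w" i] by (simp add: site_def)

lemma inst_entry: "inst (6 * K * g) (6 * K * W) (map entry c) = map (val W g) c"
  unfolding inst_def by (auto simp: entry_def val_def site_def algebra_simps)

lemma lit_true_val: "lit_true x (val W g l) \<longleftrightarrow> env x W g (fst l) = snd l"
  using lit_true_simps(1,3)[of x "K * site W g (fst l) + snd (fst l)"] by (simp add: val_def env_def)

lemma set_clauses_of: "set (clauses_of W U) = (\<Union>(g, i)\<in>set U. map (val W g) ` set (cls i))"
  by (auto simp: clauses_of_def tmpl_def inst_entry)

lemma clauses_true_iff:
  "(\<forall>S\<in>set (clauses_of W U). \<exists>l\<in>set S. lit_true x l) \<longleftrightarrow> (\<forall>(g, i)\<in>set U. sat (env x W g) (cls i))"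
  unfolding set_clauses_of sat_def by (auto simp: lit_true_val)

definition holds :: "nat \<Rightarrow> (nat \<Rightarrow> 'c) \<Rightarrow> nat \<Rightarrow> nat \<Rightarrow> bool" where
  "holds W cont g i \<longleftrightarrow> Q i (map (\<lambda>w. cont (g + fst w * W + snd w)) (wins i))"

lemma sat_imp_holds:
  assumes "sat (env x W g) (cls i)"
  shows "holds W (\<lambda>g. dec (map (\<lambda>b. x (K * g + b)) [0..<m])) g i"
proof -
  have eq: "map (\<lambda>w. dec (map (\<lambda>b. env x W g (fst w + 2 * snd w, b)) [0..<m])) (wins i) =
      map (\<lambda>w. dec (map (\<lambda>b. x (K * (g + fst w * W + snd w) + b)) [0..<m])) (wins i)"
    by (intro map_cong) (simp_all add: env_def site_win)
  from cls_sound[OF assms] show ?thesis unfolding holds_def eq .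
qed

text \<open>All \<open>K\<close> bits of a cell in the assignment that belongs to a filling. The
  auxiliary bits are provided for every constraint, whether or not it is anchored at this cell. The
  number \<open>n\<close> of constraints is variable so that bits can be located by the length of a
  prefix.\<close>

definition cell :: "nat \<Rightarrow> (nat \<Rightarrow> 'c) \<Rightarrow> nat \<Rightarrow> nat \<Rightarrow> bool list" where
  "cell W cont n g = enc (cont g) @
     concat (map (\<lambda>i. avoid_aux (concat (map (\<lambda>w. enc (cont (g + fst w * W + snd w))) (wins i))) (bads i)) [0..<n])"

lemma length_cell:
  assumes "\<forall>g. cont g \<in> C"
  shows "length (cell W cont n g) = off n"
proof (induction n)
  case 0
  show ?case using enc assms by (simp add: cell_def off_def)
next
  case (Suc n)
  have "length (concat (map (\<lambda>w. enc (cont (g + fst w * W + snd w))) ws)) = m * length ws" for ws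
    using enc assms by (induction ws) auto
  then show ?case using Suc length_avoid_aux[of "bads n"] length_bads
    by (simp add: cell_def off_Suc aux_len_def)
qed

text \<open>Variable \<open>v\<close> is bit \<open>v mod K\<close> of cell \<open>v div K\<close>;
  the auxiliary bits of constraint \<open>i\<close> are found at \<open>off i\<close> because this
  is the length of the part before them.\<close>

lemma holds_imp_sat:
  assumes cont: "\<forall>g. cont g \<in> C" and "i < np" "holds W cont g i"
  shows "sat (env (\<lambda>v. cell W cont np (v div K) ! (v mod K)) W g) (cls i)"
proof (rule cls_complete)
  let ?x = "\<lambda>v. cell W cont np (v div K) ! (v mod K)" and ?d = "\<lambda>w. cont (g + fst w * W + snd w)"
  show "Q i (map ?d (wins i))" using assms(3) by (simp add: holds_def)
  show "env ?x W g (fst w + 2 * snd w, b) = enc (?d w) ! b" if "w \<in> set (wins i)" "b < m" for w b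
    using that m_le enc[of "?d w"] cont by (simp add: env_def site_win cell_def nth_append)
  let ?aux = "avoid_aux (concat (map (\<lambda>w. enc (?d w)) (wins i))) (bads i)"
  obtain n where "np = Suc i + n" using \<open>i < np\<close> less_iff_Suc_add by auto
  then have "[0..<np] = [0..<i] @ i # [Suc i..<np]"
    using upt_add_eq_append[of 0 i "Suc n"] by (simp add: upt_conv_Cons del: upt_Suc)
  then obtain zs where split: "cell W cont np g = cell W cont i g @ ?aux @ zs"
    unfolding cell_def by simp
  show "agrees (env ?x W g) (off i) ?aux"
    unfolding agrees_def
  proof (rule nth_equalityI)
    fix t assume "t < length (map (env ?x W g) (block (off i) (length ?aux)))"
    then have t: "t < length ?aux" by simp
    have len: "length (cell W cont i g) = off i" "length (cell W cont np g) = K"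
      using length_cell[OF cont] by (simp_all add: K_def)
    have K: "off i + t < K" using t len split by simp
    then have "env ?x W g (0, off i + t) = cell W cont np g ! (off i + t)" by (simp add: env_def site_def)
    also have "\<dots> = ?aux ! t" using t len(1) unfolding split by (simp add: nth_append)
    finally show "map (env ?x W g) (block (off i) (length ?aux)) ! t = ?aux ! t"
      using t by (simp add: block_def)
  qed simp
qed (use cont in auto)

theorem clauses_sat_iff:
  assumes "\<And>g i. (g, i) \<in> set U \<Longrightarrow> i < np"
  shows "(\<exists>x. \<forall>S\<in>set (clauses_of W U). \<exists>l\<in>set S. lit_true x l) \<longleftrightarrow>
    (\<exists>cont. (\<forall>g. cont g \<in> C) \<and> (\<forall>(g, i)\<in>set U. holds W cont g i))"
proof
  assume "\<exists>x. \<forall>S\<in>set (clauses_of W U). \<exists>l\<in>set S. lit_true x l"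
  then obtain x where "\<forall>(g, i)\<in>set U. sat (env x W g) (cls i)" by (auto simp: clauses_true_iff)
  then show "\<exists>cont. (\<forall>g. cont g \<in> C) \<and> (\<forall>(g, i)\<in>set U. holds W cont g i)"
    using sat_imp_holds dec by (intro exI[of _ "\<lambda>g. dec (map (\<lambda>b. x (K * g + b)) [0..<m])"]) auto
next
  assume "\<exists>cont. (\<forall>g. cont g \<in> C) \<and> (\<forall>(g, i)\<in>set U. holds W cont g i)"
  then obtain cont where cont: "\<forall>g. cont g \<in> C" "\<forall>(g, i)\<in>set U. holds W cont g i" by blast
  then have "\<forall>(g, i)\<in>set U. sat (env (\<lambda>v. cell W cont np (v div K) ! (v mod K)) W g) (cls i)"
    using holds_imp_sat[OF cont(1)] assms by blast
  then show "\<exists>x. \<forall>S\<in>set (clauses_of W U). \<exists>l\<in>set S. lit_true x l"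
    using clauses_true_iff by blast
qed

section \<open>Bounds for the clauses of a grid\<close>

lemma in_refs: "r \<in> set (refs i) \<Longrightarrow> \<exists>w\<in>set (wins i). fst r = fst w + 2 * snd w \<and> snd r < m"
  unfolding refs_def by auto force

lemma outside_refs: "outside (off i) (refs i)"
  unfolding outside_def using m_le(1)[of i] by (fastforce dest: in_refs)

lemma distinct_refs: "distinct (refs i)"
proof -
  have "distinct (concat (map (\<lambda>w. map (Pair (fst w + 2 * snd w)) [0..<m]) ws))"
    if "distinct ws" "\<forall>w\<in>set ws. fst w < 2" for ws :: "(nat \<times> nat) list"
    using that
  proof (induction ws)
    case (Cons w ws)
    have "fst w + 2 * snd w \<noteq> fst v + 2 * snd v" if "v \<in> set ws" for v
    proof
      assume eq: "fst w + 2 * snd w = fst v + 2 * snd v"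
      have "fst w < 2" "fst v < 2" using Cons.prems that by auto
      then have "fst w = fst v \<and> snd w = snd v" using eq by presburger
      then have "w = v" by (simp add: prod_eq_iff)
      then show False using Cons.prems that by simp
    qed
    then show ?case using Cons by (auto simp: distinct_map inj_on_def)
  qed simp
  moreover have "\<forall>w\<in>set (wins i). fst w < 2" using wins(1) by fastforce
  ultimately show ?thesis unfolding refs_def using wins(2) by blast
qed

lemma cls_ref:
  assumes "c \<in> set (cls i)" "l \<in> set c" "i < np"
  shows "(\<exists>w\<in>set (wins i). fst (fst l) = fst w + 2 * snd w) \<or> fst (fst l) = 0"
    and "fst (fst l) < 6" "snd (fst l) < K"
proof -
  have "fst l \<in> set (refs i) \<or> between (off i) (off i + aux_len i) (fst l)"
    using avoid_refs[of l c "refs i" "bads i" "off i"] assms by (simp add: cls_def length_refs aux_len_def)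
  moreover have "off i + aux_len i \<le> K" using off_le[of "Suc i" np] assms(3) by (simp add: off_Suc K_def)
  moreover have "fst w + 2 * snd w < 6" if "w \<in> set (wins i)" for w
    using wins(1)[of "fst w" "snd w" i] that by auto
  ultimately show "(\<exists>w\<in>set (wins i). fst (fst l) = fst w + 2 * snd w) \<or> fst (fst l) = 0"
    "fst (fst l) < 6" "snd (fst l) < K"
    using m_le(2) by (auto dest!: in_refs)
qed

lemma val_decode:
  assumes "snd (fst l) < K"
  shows "val W g l mod 6 = (if snd l then 1 else 2)" "val W g l div 6 mod K = snd (fst l)"
    "val W g l div 6 div K = site W g (fst l)"
proof -
  have md: "(6 * y + (if b then 1 else 2)) mod 6 = (if b then 1 else 2)" for y :: nat and b
    by (simp only: mod_mult_self4) simp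
  have "(6 * y + (if b then 1 else 2)) div 6 = y" for y :: nat and b by auto
  then have "val W g l div 6 = K * site W g (fst l) + snd (fst l)" unfolding val_def .
  moreover have "val W g l mod 6 = (if snd l then 1 else 2)" unfolding val_def by (rule md)
  ultimately show "val W g l mod 6 = (if snd l then 1 else 2)" "val W g l div 6 mod K = snd (fst l)"
    "val W g l div 6 div K = site W g (fst l)"
    using assms m_le(3) by auto
qed

text \<open>Column offsets are below 3, so in a grid with rows of length at least 3 different
  positions of a window are different cells.\<close>

lemma site_inj: "site W g r = site W g r' \<Longrightarrow> fst r < 6 \<Longrightarrow> fst r' < 6 \<Longrightarrow> 3 \<le> W \<Longrightarrow> fst r = fst r'"
proof -
  assume a: "site W g r = site W g r'" "fst r < 6" "fst r' < 6" "3 \<le> W"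
  have "fst r mod 2 = 0 \<or> fst r mod 2 = 1" "fst r' mod 2 = 0 \<or> fst r' mod 2 = 1"
    "fst r div 2 < 3" "fst r' div 2 < 3" using a by auto
  then have "fst r mod 2 = fst r' mod 2 \<and> fst r div 2 = fst r' div 2"
    using a(1,4) unfolding site_def by auto
  then show ?thesis by (metis div_mult_mod_eq)
qed

theorem clauses_ok:
  assumes S: "S \<in> set (clauses_of W U)" and W: "3 \<le> W"
    and U: "\<And>g i. (g, i) \<in> set U \<Longrightarrow> i < np \<and> g < N \<and> (\<forall>w\<in>set (wins i). g + fst w * W + snd w < N)"
  shows "S \<noteq> [] \<and> length S \<le> 3 \<and> distinct S \<and> set S \<subseteq> literals (K * N)"
proof -
  obtain g i c where gi: "(g, i) \<in> set U" "c \<in> set (cls i)" "S = map (val W g) c"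
    using S by (auto simp: set_clauses_of)
  have i: "i < np" using U gi by blast
  have c: "clause_ok c" using avoid_ok[OF outside_refs] gi(2) by (auto simp: cls_def)
  note ref = cls_ref[OF gi(2) _ i]
  have "inj_on (val W g) (set c)"
  proof (rule inj_onI)
    fix l l' assume l: "l \<in> set c" "l' \<in> set c" "val W g l = val W g l'"
    then have "snd (fst l) = snd (fst l')" "site W g (fst l) = site W g (fst l')"
      using val_decode ref(3) by metis+
    then have "fst l = fst l'" using site_inj[OF _ ref(2)[OF l(1)] ref(2)[OF l(2)] W] by (simp add: prod_eq_iff)
    then show "l = l'" using c l(1,2) by (auto simp: clause_ok_def distinct_map inj_on_def)
  qed
  moreover have "distinct c" using c by (auto simp: clause_ok_def distinct_map)
  moreover have "val W g l \<in> literals (K * N)" if l: "l \<in> set c" for l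
  proof -
    have "site W g (fst l) < N"
    proof (cases "fst (fst l) = 0")
      case True
      then show ?thesis using U[OF gi(1)] by (simp add: site_def)
    next
      case False
      then obtain w where w: "w \<in> set (wins i)" "fst (fst l) = fst w + 2 * snd w" using ref(1)[OF l] by auto
      have "site W g (fst l) = site W g (fst w + 2 * snd w, 0)" using w(2) by (simp add: site_def)
      then show ?thesis using U[OF gi(1)] w(1) site_win[OF w(1), of W g 0] by simp
    qed
    then have "K * Suc (site W g (fst l)) \<le> K * N" by (intro mult_le_mono2) simp
    then have "K * site W g (fst l) + snd (fst l) < K * N" using ref(3)[OF l] by simp
    then show ?thesis by (force simp: val_def literals_def)
  qed
  ultimately show ?thesis using c gi(3) by (auto simp: clause_ok_def distinct_map)
qed

text \<open>The vertex \<open>l\<close> determines sign, bit and cell, and the cell together with a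
  position in the window determines the anchor. So a use of \<open>l\<close> is determined by the
  kind of constraint and one of 6 positions, up to its at most 4 repetitions within the
  constraint.\<close>

theorem occ_clauses:
  assumes U: "distinct U" "\<And>g i. (g, i) \<in> set U \<Longrightarrow> i < np"
  shows "occ l (clauses_of W U) \<le> 24 * np"
proof -
  define R where "R g i = {y \<in> set (concat (cls i)). val W g y = l}" for g i
  have finR: "finite (R g i)" for g i by (simp add: R_def)
  have one: "occ l (map (map (val W g)) cs) = length (filter (\<lambda>y. val W g y = l) (concat cs))" for g cs
  proof -
    have "count_list (map (val W g) c) l = length (filter (\<lambda>y. val W g y = l) c)" for c
      by (induction c) auto
    then show ?thesis by (induction cs) auto
  qed
  have le4: "count_list (concat (cls i)) y \<le> 4" for i y
    using cnt_avoid[OF outside_refs distinct_refs, of "bads i" i y] length_bads length_refs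
    by (simp add: cls_def cnt_def split: if_splits)
  have cell: "occ l (map (map (val W g)) (cls i)) \<le> 4 * card (R g i)" for g i
  proof -
    let ?F = "filter (\<lambda>y. val W g y = l) (concat (cls i))"
    have "length ?F = (\<Sum>y\<in>R g i. count_list ?F y)"
      by (rule sum_count_set[symmetric]) (auto simp: R_def)
    also have "\<dots> \<le> (\<Sum>y\<in>R g i. 4)"
    proof (rule sum_mono)
      fix y
      have "count_list (filter P ys) y \<le> count_list ys y" for P and ys :: "literal list" by (induction ys) auto
      then show "count_list ?F y \<le> 4" using le4 le_trans by blast
    qed
    finally show ?thesis using one by simp
  qed
  have "clauses_of W V = concat (map (\<lambda>(g, i). map (map (val W g)) (cls i)) V)" for V
    unfolding clauses_of_def tmpl_def by (simp add: inst_entry comp_def)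
  moreover have "occ l (concat (map f V)) = (\<Sum>v\<leftarrow>V. occ l (f v))" for f and V :: "(nat \<times> nat) list"
    by (induction V) auto
  ultimately have "occ l (clauses_of W U) = (\<Sum>u\<leftarrow>U. occ l (map (map (val W (fst u))) (cls (snd u))))"
    by (simp add: case_prod_beta)
  also have "\<dots> \<le> (\<Sum>u\<leftarrow>U. 4 * card (R (fst u) (snd u)))" by (intro sum_list_mono cell)
  also have "\<dots> = 4 * (\<Sum>u\<in>set U. card (R (fst u) (snd u)))"
    using U(1) by (simp add: sum_list_distinct_conv_sum_set sum_distrib_left)
  also have "(\<Sum>u\<in>set U. card (R (fst u) (snd u))) = card (SIGMA u:set U. R (fst u) (snd u))"
    using finR by (simp add: card_SigmaI)
  also have "\<dots> \<le> card ({..<np} \<times> {..<6 :: nat})"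
  proof (rule card_inj_on_le)
    let ?S = "SIGMA u:set U. R (fst u) (snd u)"
    let ?f = "\<lambda>(u, y :: literal). (snd u :: nat, fst (fst y))"
    have y: "i < np \<and> fst (fst y) < 6 \<and> snd (fst y) < K \<and> val W g y = l" if "((g, i), y) \<in> ?S" for g i y
      using that U(2) cls_ref(2,3)[of _ i y] by (auto simp: R_def)
    show "inj_on ?f ?S"
    proof (rule inj_onI)
      fix s s' assume s: "s \<in> ?S" "s' \<in> ?S" "?f s = ?f s'"
      obtain g i z where s1: "s = ((g, i), z)" by (metis surj_pair)
      obtain g' i' z' where s2: "s' = ((g', i'), z')" by (metis surj_pair)
      have eq: "i = i'" "fst (fst z) = fst (fst z')" using s(3) s1 s2 by auto
      have z: "snd (fst z) < K" "val W g z = l" "snd (fst z') < K" "val W g' z' = l"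
        using y s s1 s2 by blast+
      have "snd (fst z) = snd (fst z')" "site W g (fst z) = site W g' (fst z')"
        "(if snd z then 1 else 2) = (if snd z' then 1 else (2 :: nat))"
        using val_decode[OF z(1), of W g] val_decode[OF z(3), of W g'] z by metis+
      then show "s = s'" using eq s1 s2 by (auto simp: site_def prod_eq_iff split: if_splits)
    qed
    show "?f ` ?S \<subseteq> {..<np} \<times> {..<6}" using y by fastforce
  qed auto
  also have "\<dots> = np * 6" by simp
  finally show ?thesis by simp
qed

end

section \<open>Computations as tilings of a grid\<close>

text \<open>
  Cell \<open>i\<close> of row \<open>t\<close> shows the tapes after \<open>t\<close> steps at distance \<open>i - L\<close> from the respective
  heads. Every cell also carries the state and the scanned symbols, so that a step is
  a local condition although the heads move independently.
\<close>

datatype content = Content (cstate: nat) (cread: "nat list") (csyms: "nat list") (chead: bool)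

definition contents :: "tm \<Rightarrow> content set" where
  "contents M = {Content q rs ss h | q rs ss h. q \<le> nstates M \<and>
     length rs = ntapes M \<and> set rs \<subseteq> {..<nsyms M} \<and> length ss = ntapes M \<and> set ss \<subseteq> {..<nsyms M}}"

text \<open>Halting configurations are continued by steps that change nothing, as in
  \<open>tm_step\<close>, so that every tableau can have the full number of rows.\<close>

definition action :: "tm \<Rightarrow> nat \<Rightarrow> nat list \<Rightarrow> nat \<times> (nat \<times> move) list" where
  "action M q rs = (if q = nstates M then (q, map (\<lambda>r. (r, Stay)) rs) else delta M q rs)"

text \<open>Cells are addressed relative to the head, so a tape slides against the move of its head:
  after \<open>MoveL\<close> the symbol at distance \<open>d\<close> is the one that was at distance
  \<open>d - 1\<close>.\<close>

definition source :: "content \<Rightarrow> content \<Rightarrow> content \<Rightarrow> move \<Rightarrow> content" where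
  "source c1 c2 c3 mv = (case mv of MoveL \<Rightarrow> c1 | Stay \<Rightarrow> c2 | MoveR \<Rightarrow> c3)"

text \<open>State and scanned symbols are equal in neighbouring cells, hence constant along a row,
  and they are tied to the tape contents in the head column. That column is the same in all
  rows.\<close>

definition step_ok :: "tm \<Rightarrow> content \<Rightarrow> content \<Rightarrow> content \<Rightarrow> content \<Rightarrow> bool" where
  "step_ok M c1 c2 c3 c4 \<longleftrightarrow>
     cstate c1 = cstate c2 \<and> cread c1 = cread c2 \<and> cstate c3 = cstate c2 \<and> cread c3 = cread c2 \<and>
     (chead c2 \<longrightarrow> cread c2 = csyms c2) \<and>
     cstate c4 = fst (action M (cstate c2) (cread c2)) \<and> chead c4 = chead c2 \<and>
     (\<forall>j<ntapes M. let a = snd (action M (cstate c2) (cread c2)) ! j; c = source c1 c2 c3 (snd a) in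
        csyms c4 ! j = (if chead c then fst a else csyms c ! j))"

definition view :: "config \<Rightarrow> int \<Rightarrow> content" where
  "view c d = Content (fst c) (map (\<lambda>tp. fst tp (snd tp)) (snd c)) (map (\<lambda>tp. fst tp (snd tp + d)) (snd c)) (d = 0)"

definition config_ok :: "tm \<Rightarrow> config \<Rightarrow> bool" where
  "config_ok M c \<longleftrightarrow> fst c \<le> nstates M \<and> length (snd c) = ntapes M \<and> (\<forall>tp\<in>set (snd c). \<forall>z. fst tp z < nsyms M)"

section \<open>Single steps as local conditions\<close>

lemma finite_contents: "finite (contents M)"
proof -
  let ?R = "{rs. set rs \<subseteq> {..<nsyms M} \<and> length rs = ntapes M}"
  have "contents M \<subseteq> (\<lambda>(q, rs, ss, h). Content q rs ss h) ` ({..nstates M} \<times> ?R \<times> ?R \<times> UNIV)"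
    by (force simp: contents_def)
  then show ?thesis by (rule finite_subset)
      (intro finite_imageI finite_cartesian_product finite_lists_length_eq; simp)
qed

lemma step_action: "tm_step M c = (fst (action M (fst c) (map (\<lambda>tp. fst tp (snd tp)) (snd c))),
  map2 act (snd c) (snd (action M (fst c) (map (\<lambda>tp. fst tp (snd tp)) (snd c)))))"
proof -
  have "map2 act tps (map (\<lambda>r. (r, Stay)) (map (\<lambda>tp. fst tp (snd tp)) tps)) = tps" for tps
    by (rule nth_equalityI) (auto simp: act_def)
  then show ?thesis by (cases c) (auto simp: tm_step_def action_def split: prod.splits)
qed

lemma action_ok:
  assumes "tm_wf M" "q \<le> nstates M" "length rs = ntapes M" "set rs \<subseteq> {..<nsyms M}"
  shows "fst (action M q rs) \<le> nstates M" "length (snd (action M q rs)) = ntapes M"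
    "fst ` set (snd (action M q rs)) \<subseteq> {..<nsyms M}"
proof -
  have "fst (action M q rs) \<le> nstates M \<and> length (snd (action M q rs)) = ntapes M \<and>
      fst ` set (snd (action M q rs)) \<subseteq> {..<nsyms M}"
  proof (cases "q = nstates M")
    case False
    then show ?thesis using assms unfolding tm_wf_def action_def
      by (auto simp: case_prod_beta)
  qed (use assms in \<open>auto simp: action_def\<close>)
  then show "fst (action M q rs) \<le> nstates M" "length (snd (action M q rs)) = ntapes M"
    "fst ` set (snd (action M q rs)) \<subseteq> {..<nsyms M}" by auto
qed

lemma config_ok_step:
  assumes "tm_wf M" "config_ok M c" shows "config_ok M (tm_step M c)"
proof -
  let ?rs = "map (\<lambda>tp. fst tp (snd tp)) (snd c)"
  note a = action_ok[OF assms(1), of "fst c" ?rs]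
  have rs: "fst c \<le> nstates M" "length ?rs = ntapes M" "set ?rs \<subseteq> {..<nsyms M}"
    using assms(2) by (auto simp: config_ok_def)
  have "\<forall>tp\<in>set (map2 act (snd c) (snd (action M (fst c) ?rs))). \<forall>z. fst tp z < nsyms M"
  proof
    fix tp assume "tp \<in> set (map2 act (snd c) (snd (action M (fst c) ?rs)))"
    then obtain tp' b where tp: "tp = act tp' b" "(tp', b) \<in> set (zip (snd c) (snd (action M (fst c) ?rs)))"
      by auto
    from tp(2) have "tp' \<in> set (snd c)" "b \<in> set (snd (action M (fst c) ?rs))"
      by (blast dest: set_zip_leftD set_zip_rightD)+
    with tp(1) show "\<forall>z. fst tp z < nsyms M" using a(3)[OF rs] assms(2) by (auto simp: act_def config_ok_def)
  qed
  then show ?thesis using a(1,2)[OF rs] assms(2) by (auto simp: step_action config_ok_def)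
qed

lemma view_contents: "config_ok M c \<Longrightarrow> view c d \<in> contents M"
  by (auto simp: view_def contents_def config_ok_def)

lemma view_step:
  assumes "tm_wf M" "config_ok M c"
  shows "step_ok M (view c (d - 1)) (view c d) (view c (d + 1)) (view (tm_step M c) d)"
proof -
  let ?rs = "map (\<lambda>tp. fst tp (snd tp)) (snd c)"
  let ?a = "snd (action M (fst c) ?rs)"
  have rs: "fst c \<le> nstates M" "length (snd c) = ntapes M" "set ?rs \<subseteq> {..<nsyms M}"
    using assms(2) by (auto simp: config_ok_def)
  have len: "length ?a = ntapes M" using action_ok(2)[OF assms(1) rs(1) _ rs(3)] rs(2) by simp
  have "csyms (view (tm_step M c) d) ! j =
      (let b = source (view c (d - 1)) (view c d) (view c (d + 1)) (snd (?a ! j)) in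
        if chead b then fst (?a ! j) else csyms b ! j)" if j: "j < ntapes M" for j
  proof -
    have "csyms (view (tm_step M c) d) ! j = (let tp = act (snd c ! j) (?a ! j) in fst tp (snd tp + d))"
      using j len rs(2) by (simp add: step_action view_def Let_def)
    then show ?thesis
      using j rs(2) by (cases "snd (?a ! j)") (auto simp: act_def source_def view_def Let_def algebra_simps)
  qed
  moreover have "csyms (view c 0) = ?rs" by (simp add: view_def)
  ultimately show ?thesis
    unfolding step_ok_def by (auto simp: view_def step_action Let_def)
qed

text \<open>The scanned symbols of the new cell stay open here; they are fixed in the head column by
  the step constraints of the next row.\<close>

lemma step_ok_unique:
  assumes "step_ok M c1 c2 c3 c4" "step_ok M d1 d2 d3 d4" "cstate c2 = cstate d2" "cread c2 = cread d2"
    "csyms c1 = csyms d1" "csyms c2 = csyms d2" "csyms c3 = csyms d3"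
    "chead c1 = chead d1" "chead c2 = chead d2" "chead c3 = chead d3"
  shows "cstate c4 = cstate d4" "chead c4 = chead d4" "j < ntapes M \<Longrightarrow> csyms c4 ! j = csyms d4 ! j"
proof -
  have "csyms (source c1 c2 c3 mv) = csyms (source d1 d2 d3 mv) \<and> chead (source c1 c2 c3 mv) = chead (source d1 d2 d3 mv)" for mv
    using assms by (cases mv) (auto simp: source_def)
  then show "cstate c4 = cstate d4" "chead c4 = chead d4" "j < ntapes M \<Longrightarrow> csyms c4 ! j = csyms d4 ! j"
    using assms unfolding step_ok_def Let_def by auto
qed

definition input_ok :: "tm \<Rightarrow> nat \<Rightarrow> content \<Rightarrow> bool" where
  "input_ok M s c \<longleftrightarrow> cstate c = 0 \<and> csyms c ! 0 = s \<and> (\<forall>j. 2 \<le> j \<and> j < ntapes M \<longrightarrow> csyms c ! j = 0)"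

text \<open>Bits may be followed by blanks but not conversely, so the certificate tape shows the
  inscription of a word.\<close>

definition cert_ok :: "content \<Rightarrow> content \<Rightarrow> bool" where
  "cert_ok c c' \<longleftrightarrow> csyms c ! 1 \<le> 2 \<and> (csyms c ! 1 = 0 \<longrightarrow> csyms c' ! 1 = 0)"

definition blank_ok :: "content \<Rightarrow> bool" where "blank_ok c \<longleftrightarrow> csyms c ! 1 = 0"

text \<open>The column of the output bit depends on the final position of the head. But the rest of
  the output tape is blank and 1 codes \<open>False\<close>, so excluding the symbol 1 in all
  columns expresses acceptance.\<close>

definition final_ok :: "tm \<Rightarrow> content \<Rightarrow> bool" where "final_ok M c \<longleftrightarrow> csyms c ! (ntapes M - 1) \<noteq> 1"

definition tableau :: "tm \<Rightarrow> bool list \<Rightarrow> nat \<Rightarrow> nat \<Rightarrow> nat \<Rightarrow> nat \<Rightarrow> (nat \<Rightarrow> nat \<Rightarrow> content) \<Rightarrow> bool" where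
  "tableau M x P T L w D \<longleftrightarrow>
     (\<forall>t i. D t i \<in> contents M) \<and>
     (\<forall>t<T. \<forall>i<w. step_ok M (D t i) (D t (i + 1)) (D t (i + 2)) (D (t + 1) (i + 1))) \<and>
     (\<forall>i<w. final_ok M (D T i)) \<and>
     (\<forall>i<w. input_ok M (inscription x (int i - int L)) (D 0 i) \<and> chead (D 0 i) = (i = L)) \<and>
     (\<forall>i<w. if L \<le> i \<and> i < L + P then cert_ok (D 0 i) (D 0 (i + 1)) else blank_ok (D 0 i))"

text \<open>Nothing is known beyond the borders of the grid, and this uncertainty spreads inwards by
  one column per step. The output bit is within distance \<open>T\<close> of column
  \<open>L\<close>, so a margin of \<open>2 * T\<close> on both sides keeps it reliable in row
  \<open>T\<close>.\<close>

locale verifier_run =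
  fixes M :: tm and R :: "bool list \<Rightarrow> bool" and x :: "bool list" and P T L w :: nat
  assumes wf: "tm_wf M" and out: "length y \<le> P \<Longrightarrow> tm_outputs_within M [x, y] T [R y]"
    and L: "L = 2 * T" and w: "w = 2 * L + P + 1"
begin

lemma two_tapes: "2 \<le> ntapes M"
  using out[of "[]"] by (simp add: tm_outputs_within_def)

definition run :: "bool list \<Rightarrow> nat \<Rightarrow> config" where
  "run y t = (tm_step M ^^ t) (tm_init M [x, y])"

lemma run_Suc: "run y (Suc t) = tm_step M (run y t)"
  by (simp add: run_def)

lemma run_ok: "config_ok M (run y t)"
proof (induction t)
  case 0
  have "inscription z i < nsyms M" for z i
    using wf by (auto simp: inscription_def bit_sym_def tm_wf_def)
  then show ?case by (auto simp: run_def tm_init_def config_ok_def)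
next
  case (Suc t)
  then show ?case using config_ok_step[OF wf] by (simp add: run_Suc)
qed

lemma run_final:
  assumes "length y \<le> P"
  shows "fst (last (snd (run y T))) = inscription [R y]"
proof -
  obtain t tps where t: "t \<le> T" "run y t = (nstates M, tps)" "fst (last tps) = inscription [R y]"
    using out[OF assms] by (auto simp: tm_outputs_within_def run_def)
  have "run y (t + n) = (nstates M, tps)" for n
    by (induction n) (auto simp: t(2) run_Suc tm_step_def)
  from this[of "T - t"] t show ?thesis by simp
qed

lemma head_bound: "j < ntapes M \<Longrightarrow> \<bar>snd (snd (run y t) ! j)\<bar> \<le> int t"
proof (induction t)
  case 0
  then show ?case by (simp add: run_def tm_init_def del: upt_Suc)
next
  case (Suc t)
  let ?c = "run y t"
  let ?rs = "map (\<lambda>tp. fst tp (snd tp)) (snd ?c)"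
  have ok: "config_ok M ?c" by (rule run_ok)
  then have "length (snd (action M (fst ?c) ?rs)) = ntapes M" "length (snd ?c) = ntapes M"
    using action_ok(2)[OF wf, of "fst ?c" ?rs] by (auto simp: config_ok_def)
  then have "snd (run y (Suc t)) ! j = act (snd ?c ! j) (snd (action M (fst ?c) ?rs) ! j)"
    using Suc.prems by (simp add: run_Suc step_action)
  moreover have "\<bar>shift mv h\<bar> \<le> \<bar>h\<bar> + 1" for mv h by (cases mv) auto
  ultimately show ?case using Suc by (fastforce simp: act_def intro: order_trans)
qed

lemma view_init:
  "view (run y 0) d = Content 0 (cread (view (run y 0) d))
    (map (\<lambda>j. inscription (if j = 0 then x else if j = 1 then y else []) d) [0..<ntapes M]) (d = 0)"
  by (auto simp: view_def run_def tm_init_def nth_Cons split: nat.splits)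

lemma accepting_tableau:
  assumes y: "length y \<le> P" "R y"
  shows "tableau M x P T L w (\<lambda>t i. view (run y t) (int i - int L))"
  unfolding tableau_def
proof (intro conjI allI impI)
  fix t i
  show "view (run y t) (int i - int L) \<in> contents M" by (rule view_contents[OF run_ok])
  show "step_ok M (view (run y t) (int i - int L)) (view (run y t) (int (i + 1) - int L))
      (view (run y t) (int (i + 2) - int L)) (view (run y (t + 1)) (int (i + 1) - int L))"
    using view_step[OF wf run_ok, of y t "int (i + 1) - int L"] by (simp add: run_Suc algebra_simps)
  have k: "ntapes M - 1 < ntapes M" "length (snd (run y T)) = ntapes M"
    using two_tapes run_ok[of y T] by (auto simp: config_ok_def)
  then have "csyms (view (run y T) d) ! (ntapes M - 1) = fst (last (snd (run y T))) (snd (last (snd (run y T))) + d)" for d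
  proof -
    have "last (snd (run y T)) = snd (run y T) ! (ntapes M - 1)" using k by (subst last_conv_nth) auto
    then show ?thesis using k by (simp add: view_def)
  qed
  then show "final_ok M (view (run y T) (int i - int L))"
    unfolding final_ok_def run_final[OF y(1)] using y(2) by (auto simp: inscription_def bit_sym_def)
  note v = view_init[of y "int i - int L"]
  show "input_ok M (inscription x (int i - int L)) (view (run y 0) (int i - int L))"
    using two_tapes by (subst v) (auto simp: input_ok_def inscription_def)
  show "chead (view (run y 0) (int i - int L)) = (i = L)" by (simp add: view_def)
  have s1: "csyms (view (run y 0) d) ! 1 = inscription y d" for d
    using two_tapes by (subst view_init) simp
  show "if L \<le> i \<and> i < L + P then cert_ok (view (run y 0) (int i - int L)) (view (run y 0) (int (i + 1) - int L))
      else blank_ok (view (run y 0) (int i - int L))"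
    using y(1) unfolding cert_ok_def blank_ok_def s1 by (auto simp: inscription_def bit_sym_def)
qed

context
  fixes D assumes D: "tableau M x P T L w D"
begin

text \<open>The certificate ends at the first blank; the certificate constraints force only blanks
  behind it, and the blank constraints clear the other columns.\<close>

lemma cert_word:
  obtains y where "length y \<le> P" "\<And>i. i < w \<Longrightarrow> csyms (D 0 i) ! 1 = inscription y (int i - int L)"
proof -
  define s where "s d = csyms (D 0 (L + d)) ! 1" for d
  have cert: "s d \<le> 2" "s d = 0 \<Longrightarrow> s (Suc d) = 0" if "d < P" for d
    using D that w unfolding tableau_def cert_ok_def s_def by (auto dest!: spec[of _ "L + d"])
  have blank: "csyms (D 0 i) ! 1 = 0" if "i < w" "i < L \<or> L + P \<le> i" for i
    using D that unfolding tableau_def blank_ok_def by (auto dest!: spec[of _ i])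
  have sP: "s P = 0" using blank[of "L + P"] w by (simp add: s_def)
  define n where "n = (LEAST d. s d = 0)"
  have n: "s n = 0" "n \<le> P" unfolding n_def using sP by (auto intro: LeastI Least_le)
  have pos: "s d \<noteq> 0" if "d < n" for d using that not_less_Least[of d "\<lambda>d. s d = 0"] by (simp add: n_def)
  have zero: "s d = 0" if "n \<le> d" "d \<le> P" for d
    using that by (induction d rule: dec_induct) (use n cert(2) in auto)
  define y where "y = map (\<lambda>d. s d = 2) [0..<n]"
  have "csyms (D 0 i) ! 1 = inscription y (int i - int L)" if i: "i < w" for i
  proof (cases "L \<le> i \<and> i < L + P")
    case True
    then obtain d where d: "i = L + d" "d < P" by (metis le_iff_add nat_add_left_cancel_less)
    have "s d = inscription y (int d)"
      using cert(1)[OF d(2)] pos[of d] zero[of d] d(2) by (cases "d < n") (auto simp: y_def inscription_def bit_sym_def)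
    then show ?thesis using d by (simp add: s_def)
  next
    case False
    then have "inscription y (int i - int L) = 0" using n by (auto simp: inscription_def y_def)
    then show ?thesis using blank[OF i] False by auto
  qed
  moreover have "length y \<le> P" using n by (simp add: y_def)
  ultimately show thesis using that by blast
qed

lemma reads_constant: "t < T \<Longrightarrow> i \<le> w \<Longrightarrow> cread (D t i) = cread (D t 0)"
proof (induction i)
  case (Suc i)
  then have "step_ok M (D t i) (D t (i + 1)) (D t (i + 2)) (D (t + 1) (i + 1))"
    using D by (auto simp: tableau_def)
  then show ?case using Suc by (simp add: step_ok_def)
qed simp

text \<open>Each row loses one column on either side because a cell depends on three cells below
  it.\<close>

lemma tableau_simulates:
  assumes y: "\<And>i. i < w \<Longrightarrow> csyms (D 0 i) ! 1 = inscription y (int i - int L)"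
  shows "t \<le> T \<Longrightarrow> t \<le> i \<Longrightarrow> i < w - t \<Longrightarrow>
    cstate (D t i) = cstate (view (run y t) (int i - int L)) \<and>
    csyms (D t i) = csyms (view (run y t) (int i - int L)) \<and> chead (D t i) = (i = L)"
proof (induction t arbitrary: i)
  case 0
  then have i: "i < w" by simp
  have D0: "input_ok M (inscription x (int i - int L)) (D 0 i)" "chead (D 0 i) = (i = L)" "D 0 i \<in> contents M"
    using D i by (auto simp: tableau_def)
  have "csyms (D 0 i) = map (\<lambda>j. inscription (if j = 0 then x else if j = 1 then y else []) (int i - int L)) [0..<ntapes M]"
  proof (rule nth_equalityI)
    fix j assume "j < length (csyms (D 0 i))"
    then have j: "j < ntapes M" using D0(3) by (auto simp: contents_def)
    consider "j = 0" | "j = 1" | "2 \<le> j" by linarith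
    then show "csyms (D 0 i) ! j =
        map (\<lambda>j. inscription (if j = 0 then x else if j = 1 then y else []) (int i - int L)) [0..<ntapes M] ! j"
      using j D0(1) y[OF i] by cases (auto simp: input_ok_def inscription_def)
  qed (use D0(3) in \<open>auto simp: contents_def\<close>)
  then show ?case using D0 by (subst (1 2) view_init) (simp add: input_ok_def)
next
  case (Suc t)
  let ?V = "\<lambda>i. view (run y t) (int i - int L)"
  have t: "t < T" "1 \<le> L" "L + 1 < w - t" using Suc.prems L w by auto
  have IH: "cstate (D t j) = cstate (?V j) \<and> csyms (D t j) = csyms (?V j) \<and> chead (D t j) = (j = L)"
    if "t \<le> j" "j < w - t" for j using Suc.IH[of j] that t by simp
  have ok: "step_ok M (D t j) (D t (j + 1)) (D t (j + 2)) (D (t + 1) (j + 1))" if "j < w" for j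
    using D t(1) that by (auto simp: tableau_def)
  \<comment> \<open>Column \<open>L\<close> is still in the reliable part, so the symbols recorded
    as scanned are the true ones there, and by \<open>reads_constant\<close> in the whole
    row.\<close>
  have "chead (D t L)" "csyms (D t L) = csyms (?V L)" using IH[of L] t L by auto
  then have "cread (D t L) = csyms (?V L)" using ok[of "L - 1"] t by (simp add: step_ok_def)
  moreover have "csyms (?V L) = cread (?V j)" for j by (simp add: view_def)
  ultimately have rd: "cread (D t j) = cread (?V j)" if "j \<le> w" for j
    using reads_constant[OF t(1), of L] reads_constant[OF t(1) that] t by simp
  obtain j where j: "i = j + 1" "t \<le> j" "j + 2 < w - t" using Suc.prems by (cases i) auto
  have tr: "step_ok M (?V j) (?V (j + 1)) (?V (j + 2)) (view (run y (Suc t)) (int i - int L))"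
    using view_step[OF wf run_ok, of y t "int i - int L"] j by (simp add: run_Suc algebra_simps)
  have hd: "chead (?V n) = (n = L)" for n by (simp add: view_def)
  have b: "t \<le> j" "j < w - t" "t \<le> j + 1" "j + 1 < w - t" "t \<le> j + 2" "j + 2 < w - t" "j + 1 \<le> w"
    using j by linarith+
  have "j < w" using j by simp
  note u = step_ok_unique[OF ok[OF this] tr]
  have eq: "cstate (D t (j + 1)) = cstate (?V (j + 1))" "cread (D t (j + 1)) = cread (?V (j + 1))"
    "csyms (D t j) = csyms (?V j)" "csyms (D t (j + 1)) = csyms (?V (j + 1))" "csyms (D t (j + 2)) = csyms (?V (j + 2))"
    "chead (D t j) = chead (?V j)" "chead (D t (j + 1)) = chead (?V (j + 1))" "chead (D t (j + 2)) = chead (?V (j + 2))"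
    unfolding hd using IH[OF b(1,2)] IH[OF b(3,4)] IH[OF b(5,6)] rd[OF b(7)] by blast+
  have "D (Suc t) i \<in> contents M" using D by (simp add: tableau_def)
  then have len: "length (csyms (D (Suc t) i)) = ntapes M" by (auto simp: contents_def)
  have len': "length (csyms (view (run y (Suc t)) d)) = ntapes M" for d
    using run_ok[of y "Suc t"] by (simp add: view_def config_ok_def)
  have "csyms (D (Suc t) i) = csyms (view (run y (Suc t)) (int i - int L))"
    using u(3)[OF eq] j(1) len len' by (intro nth_equalityI) auto
  moreover have "chead (D (Suc t) i) = (i = L)" using u(2)[OF eq] j(1) by (auto simp: view_def)
  ultimately show ?case using u(1)[OF eq] j(1) by simp
qed

lemma tableau_accepts: "\<exists>y. length y \<le> P \<and> R y"
proof -
  obtain y where y: "length y \<le> P" "\<And>i. i < w \<Longrightarrow> csyms (D 0 i) ! 1 = inscription y (int i - int L)"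
    using cert_word by blast
  have k: "ntapes M - 1 < ntapes M" "length (snd (run y T)) = ntapes M"
    using two_tapes run_ok[of y T] by (auto simp: config_ok_def)
  let ?tp = "last (snd (run y T))"
  have last: "?tp = snd (run y T) ! (ntapes M - 1)" using k by (subst last_conv_nth) auto
  have h: "\<bar>snd ?tp\<bar> \<le> int T" using head_bound[OF k(1), of y T] last by simp
  \<comment> \<open>The column of tape cell 0, where the output bit stands: its distance from the
    head is minus the head position.\<close>
  define i where "i = nat (int L - snd ?tp)"
  have i: "int i - int L = - snd ?tp" "T \<le> i" "i < w - T" using h L w by (auto simp: i_def)
  have "csyms (D T i) = csyms (view (run y T) (- snd ?tp))"
    using tableau_simulates[OF y(2), where t = T and i = i] i by simp
  then have "csyms (D T i) ! (ntapes M - 1) = fst ?tp 0"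
    using k last by (simp add: view_def)
  then have "csyms (D T i) ! (ntapes M - 1) = inscription [R y] 0" by (simp add: run_final[OF y(1)])
  moreover have "final_ok M (D T i)" using D i by (auto simp: tableau_def)
  ultimately have "R y" by (auto simp: final_ok_def inscription_def bit_sym_def split: if_splits)
  with y(1) show ?thesis by blast
qed

end

theorem tableau_iff: "(\<exists>D. tableau M x P T L w D) \<longleftrightarrow> (\<exists>y. length y \<le> P \<and> R y)"
  using accepting_tableau tableau_accepts by blast

end

section \<open>The reduction\<close>

text \<open>Vectors that are not codes are decoded to an arbitrary element, so every assignment
  describes a filling of the grid and no clauses for valid codes are required.
  \<open>Suc (card C)\<close> bits are plenty, and positive in number.\<close>

lemma ex_bit_code:
  assumes "finite C" "C \<noteq> {}"
  obtains m :: nat and enc :: "'a \<Rightarrow> bool list" and dec where "0 < m" "\<And>v. dec v \<in> C"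
    "\<And>c. c \<in> C \<Longrightarrow> length (enc c) = m \<and> dec (enc c) = c"
proof -
  define m where "m = Suc (card C)"
  let ?B = "{v :: bool list. set v \<subseteq> UNIV \<and> length v = m}"
  have "card ?B = 2 ^ m" using card_lists_length_eq[of "UNIV :: bool set" m] by simp
  moreover have "card C \<le> 2 ^ m" using less_exp[of m] by (simp add: m_def)
  moreover have "finite ?B" by (rule finite_lists_length_eq) simp
  ultimately obtain enc where enc: "enc ` C \<subseteq> ?B" "inj_on enc C"
    using card_le_inj[OF assms(1), of ?B] by auto
  obtain c0 where "c0 \<in> C" using assms(2) by blast
  define dec where "dec v = (if v \<in> enc ` C then inv_into C enc v else c0)" for v
  show thesis
  proof (rule that)
    show "0 < m" by (simp add: m_def)
    show "dec v \<in> C" for v using \<open>c0 \<in> C\<close> by (auto simp: dec_def inv_into_into)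
    show "length (enc c) = m \<and> dec (enc c) = c" if "c \<in> C" for c
      using enc that by (auto simp: dec_def)
  qed
qed

text \<open>A step reads three adjacent cells and the cell of the next row at the middle one; a
  certificate constraint reads a cell and its right neighbour.\<close>

definition windows :: "nat \<Rightarrow> (nat \<times> nat) list" where
  "windows i = (if i = 0 then [(0, 0), (0, 1), (0, 2), (1, 1)] else if i = 8 then [(0, 0), (0, 1)] else [(0, 0)])"

text \<open>The kinds 2, 3 and 4 prescribe the input symbols 0, 1 and 2, so the input enters only
  through the choice among three fixed templates.\<close>

definition constraint :: "tm \<Rightarrow> nat \<Rightarrow> content list \<Rightarrow> bool" where
  "constraint M i cs =
    (if i = 0 then step_ok M (cs ! 0) (cs ! 1) (cs ! 2) (cs ! 3)
     else if i = 1 then final_ok M (cs ! 0)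
     else if i \<le> 4 then input_ok M (i - 2) (cs ! 0)
     else if i = 5 then chead (cs ! 0)
     else if i = 6 then \<not> chead (cs ! 0)
     else if i = 7 then blank_ok (cs ! 0)
     else cert_ok (cs ! 0) (cs ! 1))"

lemma poly_nat_mono: "n \<le> k \<Longrightarrow> poly (r :: nat poly) n \<le> poly r k"
  by (induction r) (auto intro!: add_mono mult_mono)

locale reduction =
  fixes M :: tm and R :: "bool list \<Rightarrow> bool list \<Rightarrow> bool" and p r :: "nat poly"
    and m :: nat and enc :: "content \<Rightarrow> bool list" and dec :: "bool list \<Rightarrow> content"
  assumes wf: "tm_wf M" and out: "tm_outputs_within M [x, y] (poly r (length x + length y)) [R x y]"
    and m: "0 < m" and dec: "dec v \<in> contents M"
    and enc: "c \<in> contents M \<Longrightarrow> length (enc c) = m \<and> dec (enc c) = c"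

sublocale reduction \<subseteq> csp: window_csp m dec enc "contents M" 9 windows "constraint M"
  by unfold_locales (use m dec enc in \<open>auto simp: windows_def split: if_splits\<close>)

context reduction
begin

text \<open>The time of the verifier on the longest admissible certificates, so that one number of
  rows serves all of them.\<close>

definition steps :: "nat poly" where "steps = pcompose r ([:0, 1:] + p)"
definition final_tmpl :: template where "final_tmpl = csp.tmpl 1"
definition input_tmpl :: "nat \<Rightarrow> template" where "input_tmpl s = csp.tmpl (2 + s)"

sublocale emitter csp.K csp.var_tmpl "csp.tmpl 0" final_tmpl "csp.tmpl 5" "csp.tmpl 6" "csp.tmpl 7" "csp.tmpl 8"
  input_tmpl p steps .

sublocale run: verifier_run M "R x" x "nP x" "nT x" "nL x" "nI x" for x
proof
  show "tm_outputs_within M [x, y] (nT x) [R x y]" if "length y \<le> nP x" for y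
  proof -
    have "poly r (length x + length y) \<le> nT x"
      unfolding nT_def unfolding steps_def poly_pcompose by (rule poly_nat_mono) (use that in \<open>simp add: nP_def\<close>)
    then show ?thesis using out[of x y] unfolding tm_outputs_within_def by (meson le_trans)
  qed
qed (auto simp: wf nL_def nI_def)

definition row :: "nat \<Rightarrow> (nat \<Rightarrow> nat list) \<Rightarrow> nat \<Rightarrow> (nat \<times> nat) list" where
  "row g F n = concat (map (\<lambda>i. map (Pair (g + i)) (F i)) [0..<n])"

text \<open>Pairs of an anchor and a kind of constraint, in the order in which the program emits
  their clauses.\<close>

definition uses :: "bool list \<Rightarrow> (nat \<times> nat) list" where
  "uses x = concat (map (\<lambda>t. row (t * nW x) (\<lambda>_. [0]) (nI x)) [0..<nT x]) @
     row (nT x * nW x) (\<lambda>_. [1]) (nI x) @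
     row 0 (\<lambda>i. [2 + inscription x (int i - int (nL x)), if i = nL x then 5 else 6]) (nI x) @
     row 0 (\<lambda>i. [if nL x \<le> i \<and> i < nL x + nP x then 8 else 7]) (nI x)"

definition size_grid :: "bool list \<Rightarrow> nat" where "size_grid x = nW x * (nT x + 1)"

lemma clauses_of_append: "csp.clauses_of W (U @ U') = csp.clauses_of W U @ csp.clauses_of W U'"
  by (simp add: csp.clauses_of_def)

lemma clauses_of_concat: "csp.clauses_of W (concat Us) = concat (map (csp.clauses_of W) Us)"
  by (induction Us) (auto simp: clauses_of_append, simp add: csp.clauses_of_def)

lemma cells_row:
  assumes "\<And>i. i < n \<Longrightarrow> U i = concat (map csp.tmpl (F i))" "X = 6 * csp.K * g"
  shows "cells (nD x) U X k n = csp.clauses_of (nW x) (row g F n)"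
proof -
  have "map (inst Y D) (concat (map csp.tmpl js)) = concat (map (\<lambda>j. map (inst Y D) (csp.tmpl j)) js)" for Y D js
    by (induction js) auto
  then have "cells (nD x) U X k n =
      concat (map (\<lambda>i. concat (map (\<lambda>j. map (inst (X + i * k) (nD x)) (csp.tmpl j)) (F i))) [0..<n])"
    unfolding cells_def using assms(1) by (intro arg_cong[of _ _ concat] map_cong) auto
  also have "\<dots> = csp.clauses_of (nW x) (row g F n)"
    unfolding row_def clauses_of_concat
    by (intro arg_cong[of _ _ concat]) (simp add: csp.clauses_of_def comp_def assms(2) nD_def algebra_simps)
  finally show ?thesis .
qed

section \<open>The emitted stars as variables and clauses\<close>

definition var_range :: "nat \<Rightarrow> nat \<Rightarrow> nat list list" where
  "var_range a b = concat (map (\<lambda>v. [[], [6 * v + 1], [6 * v + 1, 6 * v + 2]]) [a..<b])"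

lemma var_range_append: "a \<le> b \<Longrightarrow> b \<le> c \<Longrightarrow> var_range a b @ var_range b c = var_range a c"
  unfolding var_range_def using upt_add_eq_append[of a b "c - b"] by simp

lemma inst_var_tmpl: "map (inst (6 * (csp.K * g)) D) csp.var_tmpl = var_range (csp.K * g) (csp.K * g + csp.K)"
proof -
  have rng: "[csp.K * g..<csp.K * g + csp.K] = map (\<lambda>i. csp.K * g + i) [0..<csp.K]"
    by (simp add: map_add_upt add.commute)
  show ?thesis
    unfolding var_range_def rng csp.var_tmpl_def by (simp add: map_concat comp_def algebra_simps)
qed

lemma cells_var: "cells D (\<lambda>_. csp.var_tmpl) (6 * (csp.K * g)) k n = var_range (csp.K * g) (csp.K * (g + n))"
proof (induction n)
  case 0
  show ?case by (simp add: cells_def var_range_def)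
next
  case (Suc n)
  have "cells D (\<lambda>_. csp.var_tmpl) (6 * (csp.K * g)) k (Suc n) =
      cells D (\<lambda>_. csp.var_tmpl) (6 * (csp.K * g)) k n @ map (inst (6 * (csp.K * (g + n))) D) csp.var_tmpl"
    by (simp add: cells_def algebra_simps)
  also have "\<dots> = var_range (csp.K * g) (csp.K * (g + n)) @ var_range (csp.K * (g + n)) (csp.K * (g + n) + csp.K)"
    unfolding Suc inst_var_tmpl ..
  also have "\<dots> = var_range (csp.K * g) (csp.K * (g + Suc n))"
    by (subst var_range_append) (auto simp: algebra_simps)
  finally show ?case .
qed

lemma all_stars_eq:
  "all_stars x = varstars (csp.K * size_grid x) @ csp.clauses_of (nW x) (uses x)"
proof -
  let ?W = "nW x"
  have row: "cells (nD x) (\<lambda>_. csp.var_tmpl) (t * (?W * k)) k ?W =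
      var_range (csp.K * (?W * t)) (csp.K * (?W * t + ?W))" for t
  proof -
    have e: "t * (?W * k) = 6 * (csp.K * (?W * t))" by simp
    show ?thesis unfolding e by (rule cells_var)
  qed
  have rows: "concat (map (\<lambda>t. cells (nD x) (\<lambda>_. csp.var_tmpl) (t * (?W * k)) k ?W) [0..<n]) =
      var_range 0 (csp.K * (?W * n))" for n
  proof (induction n)
    case (Suc n)
    have "?W * Suc n = ?W * n + ?W" by simp
    moreover have "var_range 0 (csp.K * (?W * n)) @ var_range (csp.K * (?W * n)) (csp.K * (?W * n + ?W)) =
        var_range 0 (csp.K * (?W * n + ?W))" by (rule var_range_append) simp_all
    ultimately show ?case using Suc row[of n] by (simp add: add.commute)
  qed (simp add: var_range_def)
  have "size_grid x = ?W * nT x + ?W" by (simp add: size_grid_def)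
  moreover have "var_range 0 (csp.K * (?W * nT x)) @ var_range (csp.K * (?W * nT x)) (csp.K * (?W * nT x + ?W)) =
      var_range 0 (csp.K * (?W * nT x + ?W))" by (rule var_range_append) simp_all
  ultimately have vars: "grid_rows csp.var_tmpl x ?W @ cells (nD x) (\<lambda>_. csp.var_tmpl) (nT x * (?W * k)) k ?W =
      varstars (csp.K * size_grid x)"
    unfolding grid_rows_def rows unfolding row by (simp add: var_range_def varstars_def)
  have crows: "cells (nD x) (\<lambda>_. csp.tmpl j) (t * (?W * k)) k n = csp.clauses_of ?W (row (t * ?W) (\<lambda>_. [j]) n)" for t j n
    by (rule cells_row) simp_all
  have "cells (nD x) (input_templates x) 0 k (nI x) = csp.clauses_of ?W
      (row 0 (\<lambda>i. [2 + inscription x (int i - int (nL x)), if i = nL x then 5 else 6]) (nI x))"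
    by (rule cells_row) (auto simp: input_templates_def input_tmpl_def)
  moreover have "cells (nD x) (cert_templates x) 0 k (nI x) = csp.clauses_of ?W
      (row 0 (\<lambda>i. [if nL x \<le> i \<and> i < nL x + nP x then 8 else 7]) (nI x))"
    by (rule cells_row) (auto simp: cert_templates_def)
  moreover have "all_stars x = (grid_rows csp.var_tmpl x ?W @ cells (nD x) (\<lambda>_. csp.var_tmpl) (nT x * (?W * k)) k ?W) @
     grid_rows (csp.tmpl 0) x (nI x) @ cells (nD x) (\<lambda>_. final_tmpl) (nT x * (nW x * k)) k (nI x) @
     cells (nD x) (input_templates x) 0 k (nI x) @ cells (nD x) (cert_templates x) 0 k (nI x)"
    by (simp add: all_stars_def)
  ultimately show ?thesis
    unfolding vars unfolding uses_def clauses_of_append clauses_of_concat grid_rows_def final_tmpl_def crows by (simp add: comp_def)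
qed

lemma set_row: "(g', j) \<in> set (row g F n) \<longleftrightarrow> (\<exists>i<n. g' = g + i \<and> j \<in> set (F i))"
  unfolding row_def by auto

lemma set_uses: "(g, j) \<in> set (uses x) \<longleftrightarrow>
  (\<exists>i<nI x. (j = 0 \<and> (\<exists>t<nT x. g = t * nW x + i)) \<or> (j = 1 \<and> g = nT x * nW x + i) \<or>
    (g = i \<and> (j = 2 + inscription x (int i - int (nL x)) \<or> j = (if i = nL x then 5 else 6) \<or>
      j = (if nL x \<le> i \<and> i < nL x + nP x then 8 else 7))))"
proof -
  have "(g, j) \<in> set (concat (map (\<lambda>t. row (t * nW x) (\<lambda>_. [0]) (nI x)) [0..<nT x])) \<longleftrightarrow>
      (\<exists>i<nI x. j = 0 \<and> (\<exists>t<nT x. g = t * nW x + i))"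
    unfolding set_concat set_map set_upt UN_iff by (simp add: set_row Bex_def) blast
  then show ?thesis
    unfolding uses_def set_append Un_iff set_row list.set add_0 insert_iff empty_iff by blast
qed

lemma inscription_le: "inscription x i \<le> 2"
  by (simp add: inscription_def bit_sym_def)

lemma distinct_row:
  assumes "\<And>i. i < n \<Longrightarrow> distinct (F i)" shows "distinct (row g F n)"
  using assms
proof (induction n)
  case (Suc n)
  have "row g F (Suc n) = row g F n @ map (Pair (g + n)) (F n)" by (simp add: row_def)
  then show ?case using Suc by (auto simp: set_row distinct_map inj_on_def)
qed (simp add: row_def)

text \<open>Needed for \<open>occ_clauses\<close>. Anchors in different rows differ because
  \<open>nI x < nW x\<close>, and the families anchored in row 0 use different kinds.\<close>

lemma distinct_uses: "distinct (uses x)"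
proof -
  have "distinct (concat (map (\<lambda>t. row (t * nW x) (\<lambda>_. [0]) (nI x)) [0..<n]))" for n
  proof (induction n)
    case (Suc n)
    have "g < n * nW x" if gj: "(g, j) \<in> set (concat (map (\<lambda>t. row (t * nW x) (\<lambda>_. [0]) (nI x)) [0..<n]))" for g j
    proof -
      obtain t i where t: "t < n" "i < nI x" "g = t * nW x + i" using gj by (auto simp: set_row)
      then have "g < Suc t * nW x" by (simp add: nW_def)
      also have "\<dots> \<le> n * nW x" using t by (intro mult_le_mono1) simp
      finally show ?thesis .
    qed
    then show ?case using Suc distinct_row[of "nI x" "\<lambda>_. [0]"] by (fastforce simp: set_row)
  qed simp
  moreover have "distinct (row 0 (\<lambda>i. [2 + inscription x (int i - int (nL x)), if i = nL x then 5 else 6]) (nI x))"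
  proof (rule distinct_row)
    fix i
    have "2 + inscription x (int i - int (nL x)) < 5" using inscription_le[of x "int i - int (nL x)"] by simp
    then show "distinct [2 + inscription x (int i - int (nL x)), if i = nL x then 5 else 6]" by auto
  qed
  moreover have ne: "inscription x i \<noteq> 5" "inscription x i \<noteq> 6" for i
    using inscription_le[of x i] by simp_all
  ultimately show ?thesis
    unfolding uses_def using ne by (auto simp: set_row intro!: distinct_row split: if_splits)
qed

text \<open>Windows stay inside the grid: two columns on the right are free of anchors, and steps
  are not anchored in the last row.\<close>

lemma uses_bounds:
  assumes "(g, j) \<in> set (uses x)"
  shows "j < 9 \<and> g < size_grid x \<and> (\<forall>w\<in>set (windows j). g + fst w * nW x + snd w < size_grid x)"
proof -
  obtain i where i: "i < nI x" "(j = 0 \<and> (\<exists>t<nT x. g = t * nW x + i)) \<or> (j = 1 \<and> g = nT x * nW x + i) \<or>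
    (g = i \<and> (j = 2 + inscription x (int i - int (nL x)) \<or> j = (if i = nL x then 5 else 6) \<or>
      j = (if nL x \<le> i \<and> i < nL x + nP x then 8 else 7)))"
    using assms unfolding set_uses by blast
  have N: "size_grid x = nT x * nW x + nW x" by (simp add: size_grid_def algebra_simps)
  have iW: "i + 2 < nW x" using i(1) by (simp add: nW_def)
  consider t where "j = 0" "t < nT x" "g = t * nW x + i" | "j = 1" "g = nT x * nW x + i" | "g = i" "2 \<le> j" "j < 9"
    using i(2) inscription_le[of x "int i - int (nL x)"] by (auto split: if_splits)
  then show ?thesis
  proof cases
    case 1
    have "Suc t * nW x \<le> nT x * nW x" using 1 by (intro mult_le_mono1) simp
    then show ?thesis using 1 iW N by (auto simp: windows_def)
  qed (use iW N in \<open>auto simp: windows_def\<close>)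
qed

lemma holds_iff:
  "csp.holds W cont g 0 \<longleftrightarrow> step_ok M (cont g) (cont (g + 1)) (cont (g + 2)) (cont (g + W + 1))"
  "csp.holds W cont g (Suc 0) \<longleftrightarrow> final_ok M (cont g)"
  "s \<le> 2 \<Longrightarrow> csp.holds W cont g (Suc (Suc s)) \<longleftrightarrow> input_ok M s (cont g)"
  "csp.holds W cont g 5 \<longleftrightarrow> chead (cont g)"
  "csp.holds W cont g 6 \<longleftrightarrow> \<not> chead (cont g)"
  "csp.holds W cont g 7 \<longleftrightarrow> blank_ok (cont g)"
  "csp.holds W cont g 8 \<longleftrightarrow> cert_ok (cont g) (cont (g + 1))"
  by (auto simp: csp.holds_def constraint_def windows_def)

lemma uses_hold_iff:
  "(\<forall>(g, j)\<in>set (uses x). csp.holds (nW x) cont g j) \<longleftrightarrow>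
    (\<forall>t<nT x. \<forall>i<nI x. csp.holds (nW x) cont (t * nW x + i) 0) \<and>
    (\<forall>i<nI x. csp.holds (nW x) cont (nT x * nW x + i) 1) \<and>
    (\<forall>i<nI x. csp.holds (nW x) cont i (2 + inscription x (int i - int (nL x))) \<and>
      csp.holds (nW x) cont i (if i = nL x then 5 else 6)) \<and>
    (\<forall>i<nI x. csp.holds (nW x) cont i (if nL x \<le> i \<and> i < nL x + nP x then 8 else 7))"
  (is "?L \<longleftrightarrow> ?A \<and> ?B \<and> ?C \<and> ?D")
proof -
  have "?L \<longleftrightarrow> (\<forall>g j. (g, j) \<in> set (uses x) \<longrightarrow> csp.holds (nW x) cont g j)" by auto
  then show ?thesis unfolding set_uses by blast
qed

lemma uses_imp_tableau:
  "(\<forall>(g, j)\<in>set (uses x). csp.holds (nW x) cont g j) \<and> (\<forall>g. cont g \<in> contents M) \<Longrightarrow>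
    tableau M x (nP x) (nT x) (nL x) (nI x) (\<lambda>t i. cont (t * nW x + i))"
  unfolding uses_hold_iff tableau_def
  by (auto simp: holds_iff inscription_le algebra_simps split: if_splits)

text \<open>Cells are numbered row by row, so quotient and remainder by the row length give row and
  column.\<close>

lemma tableau_imp_uses:
  assumes "tableau M x (nP x) (nT x) (nL x) (nI x) D"
  defines "cont \<equiv> \<lambda>g. D (g div nW x) (g mod nW x)"
  shows "\<forall>(g, j)\<in>set (uses x). csp.holds (nW x) cont g j" "cont g \<in> contents M"
proof -
  have D: "cont (t * nW x + i) = D t i" if "i < nW x" for t i using that by (simp add: cont_def)
  have D': "cont (t * nW x + i + nW x + 1) = D (t + 1) (i + 1)" if "i + 1 < nW x" for t i
    using D[of "i + 1" "t + 1"] that by (simp add: algebra_simps)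
  have D0: "cont i = D 0 i" if "i < nW x" for i using D[of i 0] that by simp
  have W: "i < nW x" "i + 1 < nW x" "i + 2 < nW x" if "i < nI x" for i using that by (auto simp: nW_def)
  show "cont g \<in> contents M" using assms(1) by (simp add: cont_def tableau_def)
  have "csp.holds (nW x) cont (t * nW x + i) 0" if "t < nT x" "i < nI x" for t i
    unfolding holds_iff using assms(1) that W[OF that(2)] D[of i t] D[of "i + 1" t] D[of "i + 2" t] D'[of i t]
    by (simp add: tableau_def add.assoc)
  moreover have "csp.holds (nW x) cont (nT x * nW x + i) 1" if "i < nI x" for i
    using assms(1) that W[OF that] D[of i "nT x"] by (simp add: holds_iff tableau_def)
  moreover have "csp.holds (nW x) cont i (2 + inscription x (int i - int (nL x)))" if "i < nI x" for i
    using assms(1) that W[OF that] D0[of i] by (simp add: holds_iff inscription_le tableau_def)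
  moreover have "csp.holds (nW x) cont i (if i = nL x then 5 else 6)" if "i < nI x" for i
  proof -
    have "chead (cont i) \<longleftrightarrow> i = nL x" using assms(1) that W[OF that] D0[of i] by (simp add: tableau_def)
    then show ?thesis by (cases "i = nL x") (simp_all add: holds_iff)
  qed
  moreover have "csp.holds (nW x) cont i (if nL x \<le> i \<and> i < nL x + nP x then 8 else 7)" if "i < nI x" for i
    using assms(1) that W[OF that] D0[of i] D0[of "i + 1"] by (auto simp: holds_iff tableau_def)
  ultimately show "\<forall>(g, j)\<in>set (uses x). csp.holds (nW x) cont g j"
    unfolding uses_hold_iff by blast
qed

sublocale inst: clause_list "csp.K * size_grid x" "csp.clauses_of (nW x) (uses x)" for x
  by unfold_locales
    (use csp.clauses_ok[of _ "nW x" "uses x" "size_grid x"] uses_bounds in \<open>auto simp: nW_def nI_def\<close>)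

lemma all_stars_inst: "all_stars x = inst.stars x"
  by (simp add: all_stars_eq inst.stars_def)

lemma correct: "stars_instance (all_stars x) \<in> spanner_yes \<longleftrightarrow> (\<exists>y. length y \<le> poly p (length x) \<and> R x y)"
proof -
  have "stars_instance (all_stars x) \<in> spanner_yes \<longleftrightarrow>
      (\<exists>cont. (\<forall>g. cont g \<in> contents M) \<and> (\<forall>(g, i)\<in>set (uses x). csp.holds (nW x) cont g i))"
    unfolding all_stars_inst inst.yes_iff
    by (rule csp.clauses_sat_iff) (use uses_bounds in blast)
  also have "\<dots> \<longleftrightarrow> (\<exists>D. tableau M x (nP x) (nT x) (nL x) (nI x) D)"
  proof
    show "\<exists>D. tableau M x (nP x) (nT x) (nL x) (nI x) D"
      if "\<exists>cont. (\<forall>g. cont g \<in> contents M) \<and> (\<forall>(g, i)\<in>set (uses x). csp.holds (nW x) cont g i)"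
      using that uses_imp_tableau by blast
    assume "\<exists>D. tableau M x (nP x) (nT x) (nL x) (nI x) D"
    then obtain D where "tableau M x (nP x) (nT x) (nL x) (nI x) D" ..
    from tableau_imp_uses[OF this]
    show "\<exists>cont. (\<forall>g. cont g \<in> contents M) \<and> (\<forall>(g, i)\<in>set (uses x). csp.holds (nW x) cont g i)"
      by (intro exI[of _ "\<lambda>g. D (g div nW x) (g mod nW x)"] conjI allI)
  qed
  also have "\<dots> \<longleftrightarrow> (\<exists>y. length y \<le> nP x \<and> R x y)" by (rule run.tableau_iff)
  finally show ?thesis by (simp add: nP_def)
qed

lemma params:
  "breadth_param (stars_instance (all_stars x)) \<le> 896" "size_param (stars_instance (all_stars x)) \<le> 896"
  "nbhd_param (stars_instance (all_stars x)) \<le> 896"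
proof -
  have "length S \<le> 3" if "S \<in> set (csp.clauses_of (nW x) (uses x))" for S
    using csp.clauses_ok[OF that, of "size_grid x"] uses_bounds by (auto simp: nW_def nI_def)
  moreover have "occ l (csp.clauses_of (nW x) (uses x)) \<le> 216" for l
    using csp.occ_clauses[OF distinct_uses, of x l "nW x"] uses_bounds by auto
  ultimately show "breadth_param (stars_instance (all_stars x)) \<le> 896"
    "size_param (stars_instance (all_stars x)) \<le> 896" "nbhd_param (stars_instance (all_stars x)) \<le> 896"
    using inst.params_le[of x 3 216] unfolding all_stars_inst by auto
qed

text \<open>Literals are vertices in the blocks of the variables, so they do not exceed the number
  of vertices and fit into the counters.\<close>

lemma polytime: "polytime_function (\<lambda>x. encode (stars_instance (all_stars x)))"
proof (rule polytime_encode_stars)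
  fix x S l assume S: "S \<in> set (all_stars x)" "l \<in> set S"
  let ?V = "csp.K * size_grid x"
  have "6 * ?V \<le> stars_size (all_stars x)" by (simp add: all_stars_eq)
  moreover have "l < 6 * ?V"
  proof (cases "S \<in> set (csp.clauses_of (nW x) (uses x))")
    case True
    then show ?thesis using inst.clauses[of S x] inst.literals_bounds[of l x] S(2) by blast
  next
    case False
    then have "S \<in> set (varstars ?V)" using S(1) by (simp add: all_stars_eq)
    then show ?thesis using S(2) by (auto simp: varstars_def split: if_splits)
  qed
  ultimately show "l \<le> stars_size (all_stars x)" by linarith
qed

end

section \<open>Hardness for all combinations of the parameters\<close>

lemma NP_hard_bounded:
  assumes Ks: "Ks \<subseteq> {breadth_param, size_param, nbhd_param}"
  shows "NP_hard encode {I \<in> {I \<in> spanner_instances. basic_instance I \<and> stretch I = 2}. \<forall>\<kappa>\<in>Ks. \<kappa> I \<le> 896} spanner_yes"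
  unfolding NP_hard_def
proof
  fix A assume "A \<in> NP"
  then obtain R p where R: "polytime_relation R" and
    A: "\<And>x. x \<in> A \<longleftrightarrow> (\<exists>y. length y \<le> poly p (length x) \<and> R x y)"
    by (auto simp: NP_def)
  obtain M r where M: "tm_wf M" "\<And>x y. tm_outputs_within M [x, y] (poly r (length x + length y)) [R x y]"
    using R by (auto simp: polytime_relation_def)
  have "Content 0 (replicate (ntapes M) 0) (replicate (ntapes M) 0) True \<in> contents M"
    using M(1) by (auto simp: contents_def tm_wf_def)
  then have "contents M \<noteq> {}" by blast
  with finite_contents obtain m :: nat and enc :: "content \<Rightarrow> bool list" and dec where "0 < m" "\<And>v. dec v \<in> contents M"
    "\<And>c. c \<in> contents M \<Longrightarrow> length (enc c) = m \<and> dec (enc c) = c"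
    by (rule ex_bit_code) (rule that)
  then interpret reduction M R p r m enc dec using M by unfold_locales auto
  let ?f = "\<lambda>x. stars_instance (all_stars x)"
  have "?f x \<in> {I \<in> {I \<in> spanner_instances. basic_instance I \<and> stretch I = 2}. \<forall>\<kappa>\<in>Ks. \<kappa> I \<le> 896}" for x
    using inst.instance_ok[of x] params[of x] Ks unfolding all_stars_inst by auto
  moreover have "x \<in> A \<longleftrightarrow> ?f x \<in> spanner_yes" for x using A correct by simp
  ultimately show "\<exists>f. polytime_function f \<and>
      (\<forall>x. \<exists>i\<in>{I \<in> {I \<in> spanner_instances. basic_instance I \<and> stretch I = 2}. \<forall>\<kappa>\<in>Ks. \<kappa> I \<le> 896}.
        f x = encode i \<and> (x \<in> A \<longleftrightarrow> i \<in> spanner_yes))"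
    using polytime by blast
qed

lemma para_NP_hard_basic:
  assumes "Ks \<subseteq> {breadth_param, size_param, nbhd_param}"
  shows "para_NP_hard encode {I \<in> spanner_instances. basic_instance I \<and> stretch I = 2} spanner_yes Ks"
  unfolding para_NP_hard_def by (rule exI) (rule NP_hard_bounded[OF assms])

text \<open>The same reduction works, since the yes-instances do not depend on the restriction. So
  the general case follows from the basic one.\<close>

lemma NP_hard_superset:
  assumes "NP_hard e Inst Yes" "Inst \<subseteq> Inst'" shows "NP_hard e Inst' Yes"
  unfolding NP_hard_def
proof
  fix A assume "A \<in> NP"
  then obtain f where f: "polytime_function f" "\<And>x. \<exists>i\<in>Inst. f x = e i \<and> (x \<in> A \<longleftrightarrow> i \<in> Yes)"
    using assms(1) unfolding NP_hard_def by metis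
  have "\<exists>i\<in>Inst'. f x = e i \<and> (x \<in> A \<longleftrightarrow> i \<in> Yes)" for x
    using f(2)[of x] assms(2) by (elim bexE) (rule bexI, auto)
  then show "\<exists>f. polytime_function f \<and> (\<forall>x. \<exists>i\<in>Inst'. f x = e i \<and> (x \<in> A \<longleftrightarrow> i \<in> Yes))"
    using f(1) by (intro exI[of _ f] conjI allI)
qed

lemma para_NP_hard_superset:
  assumes "para_NP_hard e Inst Yes Ks" "Inst \<subseteq> Inst'" shows "para_NP_hard e Inst' Yes Ks"
proof -
  obtain c where "NP_hard e {i \<in> Inst. \<forall>\<kappa>\<in>Ks. \<kappa> i \<le> c} Yes"
    using assms(1) unfolding para_NP_hard_def ..
  then have "NP_hard e {i \<in> Inst'. \<forall>\<kappa>\<in>Ks. \<kappa> i \<le> c} Yes"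
    by (rule NP_hard_superset) (use assms(2) in blast)
  then show ?thesis unfolding para_NP_hard_def ..
qed

theorem mainTheorem13:
  "(\<forall>Ks. Ks \<noteq> {} \<and> Ks \<subseteq> {breadth_param, size_param, nbhd_param} \<longrightarrow>
       para_NP_hard encode spanner_instances spanner_yes Ks) \<and>
   (\<exists>\<alpha>\<ge>1. \<forall>Ks. Ks \<noteq> {} \<and> Ks \<subseteq> {breadth_param, size_param, nbhd_param} \<longrightarrow>
       para_NP_hard encode {I \<in> spanner_instances. basic_instance I \<and> stretch I = \<alpha>}
         spanner_yes Ks)"
proof (intro conjI allI impI)
  fix Ks assume "Ks \<noteq> {} \<and> Ks \<subseteq> {breadth_param, size_param, nbhd_param}"
  then show "para_NP_hard encode spanner_instances spanner_yes Ks"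
    by (intro para_NP_hard_superset[OF para_NP_hard_basic]) auto
next
  show "\<exists>\<alpha>\<ge>1. \<forall>Ks. Ks \<noteq> {} \<and> Ks \<subseteq> {breadth_param, size_param, nbhd_param} \<longrightarrow>
       para_NP_hard encode {I \<in> spanner_instances. basic_instance I \<and> stretch I = \<alpha>} spanner_yes Ks"
    using para_NP_hard_basic by (intro exI[of _ 2]) simp
qed

end
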